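(* Let $\Omega\subset\mathbb{R}^2$ be a connected open set, and let $u\in W^{1,1}(\Omega;\mathbb{R}^2)$ and $v\in W^{1,1}(\Omega;\mathbb{R}^2)$ satisfy $\det(Du)>0$ and $\det(Dv)>0$ a.e. in $\Omega$, and $$\int_{\Omega}\big|[Du]_c\big|^2+\big|[Dv]_c\big|^2\,dz<\infty .$$ Suppose that there is a function $K\in L^1(\Omega)$ with $\|Du(z)\|^2\le K(z)\det(Du(z))$ for a.e. $z\in\Omega$. Suppose further that for a.e. $z\in\Omega$ there is some $\lambda>0$ (depending on $z$) such that $S(Du(z))=\lambda S(Dv(z))$. Then for any $z\in\Omega\setminus B_u$, where $B_u$ is the branch set of $u$ (the set of points of $\Omega$ at which $u$ fails to be a local homeomorphism), there exist $r_z>0$ and a conformal map $\phi:u(B_{r_z}(z))\to\mathbb{R}^2$ such that $$v(x)=\phi(u(x))\quad\text{for all }x\in B_{r_z}(z).$$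
   Context: $\mathbb{R}^2$ is identified with $\mathbb{C}$ via $(x,y)\leftrightarrow x+iy$. For a $2\times2$ real matrix $A=(a_{ij})$, its conformal part is $$[A]_c=\frac12\begin{pmatrix} a_{11}+a_{22} & -(a_{21}-a_{12})\\ a_{21}-a_{12} & a_{11}+a_{22}\end{pmatrix}.$$ $\|A\|$ denotes the operator norm and $|A|$ the Hilbert–Schmidt norm. $S(A)=\sqrt{A^TA}$. "Conformal map" here means a map whose gradient is at every point a conformal matrix, i.e. of the form $\begin{pmatrix} a&-b\\ b&a\end{pmatrix}$ with $a,b\in\mathbb{R}$ (possibly zero); equivalently, a holomorphic function, with no requirement of injectivity or nonvanishing derivative. $B_r(z)$ is the open ball of radius $r$ centred at $z$. Under the hypotheses, $u$ and $v$ are identified with their continuous representatives. *)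

theory Defs
  imports "HOL-Analysis.Analysis"
begin

section \<open>Weak gradients and the Sobolev space \<open>W\<^sup>1\<^sup>,\<^sup>1\<close>\<close>

definition partial_deriv :: "'n::finite \<Rightarrow> (real^'n \<Rightarrow> real) \<Rightarrow> (real^'n \<Rightarrow> real)" where
  "partial_deriv j f = (\<lambda>x. frechet_derivative f (at x) (axis j 1))"

text \<open>Every iterated partial derivative, including \<open>f\<close> itself (the empty list), is differentiable
  everywhere, hence continuous; this is \<open>C\<^sup>\<infinity>\<close>.\<close>

definition smooth :: "(real^'n::finite \<Rightarrow> real) \<Rightarrow> bool" where
  "smooth f \<longleftrightarrow> (\<forall>js x. foldr partial_deriv js f differentiable (at x))"

definition test_function :: "(real^'n::finite) set \<Rightarrow> (real^'n \<Rightarrow> real) \<Rightarrow> bool" where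
  "test_function \<Omega> f \<longleftrightarrow>
     smooth f \<and> compact (closure {x. f x \<noteq> 0}) \<and> closure {x. f x \<noteq> 0} \<subseteq> \<Omega>"

definition locally_integrable_on ::
  "(real^'n::finite \<Rightarrow> 'b::euclidean_space) \<Rightarrow> (real^'n) set \<Rightarrow> bool" where
  "locally_integrable_on f \<Omega> \<longleftrightarrow> (\<forall>C. compact C \<and> C \<subseteq> \<Omega> \<longrightarrow> set_integrable lebesgue C f)"

text \<open>\<open>D z $ i $ j\<close> is the weak derivative in direction \<open>j\<close> of the \<open>i\<close>-th component.\<close>

definition weak_gradient ::
  "(real^'n::finite) set \<Rightarrow> (real^'n \<Rightarrow> real^'m::finite) \<Rightarrow> (real^'n \<Rightarrow> real^'n^'m) \<Rightarrow> bool" where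
  "weak_gradient \<Omega> u D \<longleftrightarrow>
     locally_integrable_on u \<Omega> \<and> locally_integrable_on D \<Omega> \<and>
     (\<forall>f i j. test_function \<Omega> f \<longrightarrow>
        (LINT x:\<Omega>|lebesgue. u x $ i * partial_deriv j f x) =
        - (LINT x:\<Omega>|lebesgue. D x $ i $ j * f x))"

definition W11 :: "(real^'n::finite) set \<Rightarrow> (real^'n \<Rightarrow> real^'m::finite) set" where
  "W11 \<Omega> = {u. set_integrable lebesgue \<Omega> u \<and>
                (\<exists>D. weak_gradient \<Omega> u D \<and> set_integrable lebesgue \<Omega> D)}"

section \<open>Matrices\<close>

text \<open>The Hilbert--Schmidt norm of a matrix is its \<^const>\<open>norm\<close> as an element of
  \<^typ>\<open>real^2^2\<close>; the operator norm is \<^const>\<open>onorm\<close> of the induced linear map.\<close>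

definition op_norm :: "real^'n^'m::finite \<Rightarrow> real" where
  "op_norm A = onorm (\<lambda>x. A *v x)"

definition conformal_part :: "real^2^2 \<Rightarrow> real^2^2" where
  "conformal_part A = (1/2) *\<^sub>R
     vector [vector [A$1$1 + A$2$2, - (A$2$1 - A$1$2)],
             vector [A$2$1 - A$1$2, A$1$1 + A$2$2]]"

definition conformal_matrix :: "real^2^2 \<Rightarrow> bool" where
  "conformal_matrix A \<longleftrightarrow> (\<exists>a b. A = vector [vector [a, - b], vector [b, a]])"

definition pos_semidef :: "real^'n^'n::finite \<Rightarrow> bool" where
  "pos_semidef P \<longleftrightarrow> transpose P = P \<and> (\<forall>x. 0 \<le> x \<bullet> (P *v x))"

definition psd_sqrt :: "real^'n^'n::finite \<Rightarrow> real^'n^'n" where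
  "psd_sqrt M = (THE P. pos_semidef P \<and> P ** P = M)"

definition stretch :: "real^'n^'n::finite \<Rightarrow> real^'n^'n" where
  "stretch A = psd_sqrt (transpose A ** A)"

lemma pos_semidef_2_iff:
  fixes P :: "real^2^2"
  shows "pos_semidef P \<longleftrightarrow>
    P$1$2 = P$2$1 \<and> P$1$1 \<ge> 0 \<and> P$2$2 \<ge> 0 \<and> P$1$2*P$2$1 \<le> P$1$1*P$2$2"
proof
  assume P: "pos_semidef P"
  have "transpose P $ 2 $ 1 = P $ 2 $ 1" using P by (simp only: pos_semidef_def)
  then have s: "P$1$2 = P$2$1" by (simp add: transpose_def)
  have q: "0 \<le> a*(P$1$1*a+P$1$2*b) + b*(P$2$1*a+P$2$2*b)" for a b
  proof -
    have "0 \<le> (vector [a,b]::real^2) \<bullet> (P *v vector [a,b])" using P unfolding pos_semidef_def by blast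
    then show ?thesis by (simp add: inner_vec_def sum_2 matrix_vector_mult_def vector_2)
  qed
  have 1: "P$1$1 \<ge> 0" using q[of 1 0] by simp
  have 2: "P$2$2 \<ge> 0" using q[of 0 1] by simp
  have 3: "P$1$2*P$2$1 \<le> P$1$1*P$2$2"
  proof (cases "P$1$1 = 0")
    case True
    have "P$1$2 = 0"
    proof (rule ccontr)
      assume n: "P$1$2 \<noteq> 0"
      show False using q[of "-(P$2$2+1)/(2*P$1$2)" 1] True s n 2 by (simp add: field_simps)
    qed
    then show ?thesis using True s by simp
  next
    case False
    have "0 \<le> P$1$1*(P$1$1*P$2$2 - P$1$2*P$1$2)" using q[of "-P$1$2" "P$1$1"] s by (simp add: algebra_simps)
    then show ?thesis using False 1 s by (simp add: zero_le_mult_iff)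
  qed
  show "P$1$2 = P$2$1 \<and> P$1$1 \<ge> 0 \<and> P$2$2 \<ge> 0 \<and> P$1$2*P$2$1 \<le> P$1$1*P$2$2" using s 1 2 3 by blast
next
  assume h: "P$1$2 = P$2$1 \<and> P$1$1 \<ge> 0 \<and> P$2$2 \<ge> 0 \<and> P$1$2*P$2$1 \<le> P$1$1*P$2$2"
  have t: "transpose P = P" using h by (simp add: vec_eq_iff forall_2 transpose_def)
  have "0 \<le> x \<bullet> (P *v x)" for x
  proof -
    define a where "a = x$1" define b where "b = x$2"
    have e: "x \<bullet> (P *v x) = P$1$1*a^2 + 2*P$1$2*a*b + P$2$2*b^2"
      using h by (simp add: inner_vec_def sum_2 matrix_vector_mult_def a_def b_def algebra_simps power2_eq_square)
    show ?thesis
    proof (cases "P$1$1 = 0")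
      case True then have "P$2$1*P$2$1 \<le> 0" using h by auto
      then have "P$1$2 = 0" using h by (auto simp: mult_le_0_iff)
      then show ?thesis using e True h by simp
    next
      case False
      have "P$1$1*(P$1$1*a^2 + 2*P$1$2*a*b + P$2$2*b^2) = (P$1$1*a+P$1$2*b)^2 + (P$1$1*P$2$2 - P$1$2*P$1$2)*b^2"
        by (simp add: algebra_simps power2_eq_square)
      also have "\<dots> \<ge> 0" using h by (intro add_nonneg_nonneg mult_nonneg_nonneg) auto
      finally show ?thesis using e False h by (simp add: zero_le_mult_iff)
    qed
  qed
  then show "pos_semidef P" using t unfolding pos_semidef_def by blast
qed

lemma psd_sqrt_unique_2:
  fixes P Q :: "real^2^2"
  assumes "pos_semidef P" "pos_semidef Q" "P ** P = Q ** Q"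
  shows "P = Q"
proof -
  define p q s :: real where "p = P$1$1" "q = P$1$2" "s = P$2$2"
  define p2 q2 s2 :: real where "p2 = Q$1$1" "q2 = Q$1$2" "s2 = Q$2$2"
  note d = p_q_s_def p2_q2_s2_def
  have h: "P$2$1 = q" "Q$2$1 = q2" "p \<ge> 0" "s \<ge> 0" "q * q \<le> p * s" "p2 \<ge> 0" "s2 \<ge> 0" "q2 * q2 \<le> p2 * s2"
    using assms(1,2) unfolding pos_semidef_2_iff d by auto
  have e: "(P ** P) $ i $ j = (Q ** Q) $ i $ j" for i j using assms(3) by simp
  have e1: "p * p+q * q = p2 * p2+q2 * q2" and e2: "q * (p+s) = q2 * (p2+s2)" and e3: "q * q+s * s = q2 * q2+s2 * s2"
    using e[of 1 1] e[of 1 2] e[of 2 2] h(1,2) by (simp_all add: matrix_matrix_mult_def sum_2 d algebra_simps)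
  have "(p * s-q * q)\<^sup>2 = (p * p+q * q)*(q * q+s * s) - (q * (p+s))\<^sup>2"
    by (simp add: power2_eq_square algebra_simps)
  also have "\<dots> = (p2 * s2-q2 * q2)\<^sup>2" unfolding e1 e2 e3 by (simp add: power2_eq_square algebra_simps)
  finally have dd: "p * s-q * q = p2 * s2-q2 * q2" using h by (simp add: power2_eq_iff_nonneg)
  have "(p+s)\<^sup>2 = (p2+s2)\<^sup>2" using dd e1 e3 by (simp add: power2_eq_square algebra_simps)
  then have t: "p+s = p2+s2" using h by (simp add: power2_eq_iff_nonneg)
  have "p = p2 \<and> q = q2 \<and> s = s2"
  proof (cases "p + s = 0")
    case True
    then have "p = 0" "s = 0" "p2 = 0" "s2 = 0" using h t by linarith+
    then show ?thesis using h by (auto simp: mult_le_0_iff)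
  next
    case False
    have "q = q2" using e2 t False by simp
    moreover have "(p-s)*(p+s) = (p2-s2)*(p2+s2)" using e1 e3 by (simp add: algebra_simps)
    then have "p - s = p2 - s2" using False t by simp
    ultimately show ?thesis using t by linarith
  qed
  then show ?thesis using h by (simp add: vec_eq_iff forall_2 d)
qed

lemma psd_sqrt_exists_2:
  fixes M :: "real^2^2"
  assumes "pos_semidef M"
  shows "\<exists>P. pos_semidef P \<and> P ** P = M"
proof -
  define a b c where "a = M$1$1" "b = M$1$2" "c = M$2$2"
  note D = a_b_c_def
  have h: "M$2$1 = b" "a \<ge> 0" "c \<ge> 0" "b*b \<le> a*c" using assms unfolding pos_semidef_2_iff D by auto
  define d where "d = sqrt (a*c-b*b)"
  have d: "d \<ge> 0" "d*d = a*c-b*b" using h by (auto simp: d_def)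
  define t where "t = sqrt (a+c+2*d)"
  have t: "t \<ge> 0" "t*t = a+c+2*d" using h d by (auto simp: t_def)
  show ?thesis
  proof (cases "t = 0")
    case True
    then have "a = 0" "c = 0" using t h d by auto
    moreover then have "b = 0" using h by (auto simp: mult_le_0_iff)
    ultimately have "M = 0" using h by (simp add: vec_eq_iff forall_2 D)
    then show ?thesis by (intro exI[of _ 0]) (simp add: pos_semidef_2_iff)
  next
    case False
    then have tp: "t > 0" using t by simp
    define P :: "real^2^2" where "P = vector [vector [(a+d)/t, b/t], vector [b/t, (c+d)/t]]"
    have *: "b*b \<le> (a+d)*(c+d)"
    proof -
      have "0 \<le> d*(a+c+d)" using h d by simp
      then show ?thesis using h by (simp add: algebra_simps)
    qed
    have "pos_semidef P" unfolding pos_semidef_2_iff P_def using tp h d * by (simp add: vector_2 divide_right_mono)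
    moreover have "P ** P = M"
    proof -
      have "(a+d)*(a+d)+b*b = a*(t*t)" "b*(a+d)+b*(c+d) = b*(t*t)" "(c+d)*(c+d)+b*b = c*(t*t)"
        unfolding t using d(2) by (simp_all add: algebra_simps)
      then have "((a+d)*(a+d)+b*b)/(t*t) = a" "(b*(a+d)+b*(c+d))/(t*t) = b" "((c+d)*(c+d)+b*b)/(t*t) = c"
        using False by auto
      then show ?thesis using h(1)
        by (simp add: vec_eq_iff forall_2 matrix_matrix_mult_def sum_2 P_def vector_2 add_divide_distrib D algebra_simps)
    qed
    ultimately show ?thesis by blast
  qed
qed

text \<open>The definite description in \<open>psd_sqrt\<close> is well-defined where it is used for
  2-by-2 matrices.\<close>

lemma stretch_2:
  fixes A :: "real^2^2"
  shows "pos_semidef (stretch A) \<and> stretch A ** stretch A = transpose A ** A"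
proof -
  have "pos_semidef (transpose A ** A)"
    unfolding pos_semidef_def matrix_transpose_mul
    by (simp add: matrix_vector_mul_assoc[symmetric] dot_lmul_matrix[symmetric] flip: transpose_matrix_vector)
       (simp add: dot_lmul_matrix transpose_matrix_vector)
  then have "\<exists>!P. pos_semidef P \<and> P ** P = transpose A ** A"
    using psd_sqrt_exists_2 psd_sqrt_unique_2 by metis
  then show ?thesis unfolding stretch_def psd_sqrt_def by (rule theI')
qed

section \<open>Conformal maps and the branch set\<close>

text \<open>The derivative may vanish and the map need not be injective.\<close>

definition conformal_map_on :: "(real^2 \<Rightarrow> real^2) \<Rightarrow> (real^2) set \<Rightarrow> bool" where
  "conformal_map_on \<phi> S \<longleftrightarrow>
     (\<forall>y\<in>S. \<exists>A. conformal_matrix A \<and> (\<phi> has_derivative (\<lambda>h. A *v h)) (at y))"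

definition local_homeomorphism_at ::
  "('a::topological_space) set \<Rightarrow> ('a \<Rightarrow> 'b::topological_space) \<Rightarrow> 'a \<Rightarrow> bool" where
  "local_homeomorphism_at \<Omega> u z \<longleftrightarrow>
     (\<exists>U g. open U \<and> z \<in> U \<and> U \<subseteq> \<Omega> \<and> open (u ` U) \<and> homeomorphism U (u ` U) u g)"

definition branch_set ::
  "('a::topological_space) set \<Rightarrow> ('a \<Rightarrow> 'b::topological_space) \<Rightarrow> 'a set" where
  "branch_set \<Omega> u = {z \<in> \<Omega>. \<not> local_homeomorphism_at \<Omega> u z}"

end

theory Submission
  imports Defs "HOL-Complex_Analysis.Cauchy_Integral_Formula"
begin

text \<open>
  Near a point outside the branch set, \<open>u\<close> is injective on a small closed disc \<open>Q\<close>, so there is only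
  one candidate for the factor, \<open>\<phi> = v \<circ> u\<^sup>-\<^sup>1\<close>, and it is continuous. The task is to show that it is
  holomorphic, although nothing is known about the differentiability of \<open>u\<^sup>-\<^sup>1\<close>; to this end, \<open>\<phi>\<close> is
  recovered from averages taken on the side of \<open>u\<close>.

  Since \<open>det Du > 0\<close>, the conformal part controls the whole gradient
  (\<open>entry_square_le_conformal_part\<close>), so \<open>u\<close> and \<open>v\<close> have square integrable gradients. Proportional
  stretches mean that \<open>u\<close> and \<open>v\<close>, as complex functions, solve the same Beltrami equation; in a form
  without Beltrami coefficients this reads \<open>dv \<and> du = 0\<close> (\<open>proportional_stretch_wedge_eq_0\<close>).

  Take smooth kernels \<open>k\<^sub>n \<ge> 0\<close> supported in squares shrinking to the origin, let \<open>J = det Du\<close>, and put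
  \<open>T\<^sub>n(w) = \<integral>\<^sub>Q J(x) k\<^sub>n(w - u x) dx\<close> and \<open>\<Phi>\<^sub>n(w) = \<integral>\<^sub>Q v(x) J(x) k\<^sub>n(w - u x) dx\<close>.
  These are smooth in \<open>w\<close>. Differentiating the kernel produces the forms \<open>d(k\<^sub>n(w - u)) \<and> du\<close>, and
  integration by parts moves the derivative to the other factor (\<open>sobolev_pairing_identity\<close>): the
  gradient of \<open>T\<^sub>n\<close> becomes an integral against \<open>d1 = 0\<close>, and the Cauchy--Riemann defect of \<open>\<Phi>\<^sub>n\<close> an
  integral against \<open>dv \<and> du = 0\<close>. So \<open>T\<^sub>n\<close> is a constant, positive because \<open>J > 0\<close>, and
  \<open>\<Phi>\<^sub>n\<close> is holomorphic. But \<open>\<Phi>\<^sub>n / T\<^sub>n\<close> at \<open>w\<close> is a weighted average of the values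
  \<open>v(x) = \<phi>(u x)\<close> over the points \<open>x\<close> with \<open>u x\<close> close to \<open>w\<close>, hence it converges uniformly to \<open>\<phi>\<close>, and a
  uniform limit of holomorphic functions is holomorphic (\<open>quotient_map_holomorphic\<close>).

  Integration by parts is an instance of Stokes' theorem for smooth functions
  (\<open>smooth_pairing_identity\<close>) and passes to Sobolev functions by mollification: the functions converge
  uniformly and their gradients in square mean (\<open>weak_gradient_sobolev_approximable\<close>), which suffices
  because the identity is quadratic in the gradients.
\<close>

section \<open>Smooth bump functions\<close>

text \<open>With \<open>s = 1/t\<close> this controls \<open>exp (- 1/t)\<close> and all its derivatives as \<open>t\<close> tends to zero.
  The power \<open>s ^ k\<close> is there for the induction, which absorbs one factor \<open>s\<close> per coefficient.\<close>

lemma poly_mult_exp_minus_bounded: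
  "\<exists>M. \<forall>s>0. \<bar>s ^ k * poly p s * exp (- s)\<bar> \<le> (M::real)"
proof (induction p arbitrary: k)
  case 0
  then show ?case by auto
next
  case (pCons c p)
  from pCons.IH[of "Suc k"] obtain M where M: "\<And>s. s > 0 \<Longrightarrow> \<bar>s ^ Suc k * poly p s * exp (- s)\<bar> \<le> M"
    by blast
  have "\<bar>s ^ k * poly (pCons c p) s * exp (- s)\<bar> \<le> \<bar>c\<bar> * fact k + M" if s: "s > 0" for s
  proof -
    have "(\<Sum>i<Suc k. s ^ i /\<^sub>R fact i) \<le> exp s"
      unfolding exp_def using s by (intro sum_le_suminf summable_exp_generic) auto
    moreover have "s ^ k /\<^sub>R fact k \<le> (\<Sum>i<Suc k. s ^ i /\<^sub>R fact i)"
      using s by (intro member_le_sum) auto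
    ultimately have "s ^ k \<le> fact k * exp s" by (simp add: field_simps)
    then have "s ^ k * exp (- s) \<le> fact k" by (simp add: exp_minus field_simps)
    then have "\<bar>c\<bar> * (s ^ k * exp (- s)) \<le> \<bar>c\<bar> * fact k" by (intro mult_left_mono) auto
    moreover have "\<bar>c * (s ^ k * exp (- s))\<bar> = \<bar>c\<bar> * (s ^ k * exp (- s))" using s by (simp add: abs_mult)
    moreover have "s ^ k * poly (pCons c p) s * exp (- s)
        = c * (s ^ k * exp (- s)) + s ^ Suc k * poly p s * exp (- s)"
      by (simp add: algebra_simps)
    ultimately show ?thesis using M[OF s] by linarith
  qed
  then show ?case by blast
qed

text \<open>The derivatives of \<open>exp (- 1/t)\<close> are polynomials in \<open>1/t\<close> times the function itself, so carrying the
  polynomial as a parameter gives a family closed under differentiation.\<close>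

definition flat_exp :: "real poly \<Rightarrow> real \<Rightarrow> real" where
  "flat_exp p t = (if t > 0 then poly p (1/t) * exp (- (1/t)) else 0)"

lemma flat_exp_eq_0: "t \<le> 0 \<Longrightarrow> flat_exp p t = 0"
  by (simp add: flat_exp_def)

lemma flat_exp_uminus: "flat_exp (- p) t = - flat_exp p t"
  by (simp add: flat_exp_def)

lemma flat_exp_smult: "flat_exp (smult c p) t = c * flat_exp p t"
  by (simp add: flat_exp_def)

lemma flat_exp_quadratic: "\<exists>M. \<forall>t. \<bar>flat_exp p t\<bar> \<le> M * t^2"
proof -
  from poly_mult_exp_minus_bounded[of 2 p] obtain M
    where M: "\<And>s. s > 0 \<Longrightarrow> \<bar>s ^ 2 * poly p s * exp (- s)\<bar> \<le> M" by blast
  have M0: "M \<ge> 0" using M[of 1] by linarith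
  have "\<bar>flat_exp p t\<bar> \<le> M * t^2" for t
  proof (cases "t > 0")
    case True
    then show ?thesis using M[of "1/t"]
      by (simp add: flat_exp_def abs_mult power_divide field_simps)
  qed (use M0 in \<open>simp add: flat_exp_def\<close>)
  then show ?thesis by blast
qed

text \<open>The polynomial comes from the chain rule: \<open>1/t\<close> has derivative \<open>- 1/t\<^sup>2\<close>. At zero the quadratic bound
  makes the difference quotient vanish.\<close>

lemma DERIV_flat_exp: "(flat_exp p has_field_derivative flat_exp ([:0,0,1:] * (p - pderiv p)) t) (at t)"
proof (cases t "0::real" rule: linorder_cases)
  case less
  have "((\<lambda>_. 0) has_field_derivative 0) (at t)" by simp
  moreover have "\<forall>\<^sub>F s in nhds t. flat_exp p s = 0"
    using less by (intro eventually_nhds_in_open[of "{..<0}", THEN eventually_mono]) (auto simp: flat_exp_def)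
  ultimately show ?thesis using less by (subst DERIV_cong_ev[OF refl _ refl]) (auto simp: flat_exp_def)
next
  case greater
  have "((\<lambda>s. poly p (1/s) * exp (- (1/s))) has_field_derivative
         flat_exp ([:0,0,1:] * (p - pderiv p)) t) (at t)"
    using greater
    by (auto intro!: derivative_eq_intros simp: flat_exp_def field_simps power2_eq_square)
  moreover have "\<forall>\<^sub>F s in nhds t. flat_exp p s = poly p (1/s) * exp (- (1/s))"
    using greater by (intro eventually_nhds_in_open[of "{0<..}", THEN eventually_mono]) (auto simp: flat_exp_def)
  ultimately show ?thesis by (subst DERIV_cong_ev[OF refl _ refl]) auto
next
  case equal
  obtain M where M: "\<And>s. \<bar>flat_exp p s\<bar> \<le> M * s^2" using flat_exp_quadratic by blast
  have "((\<lambda>h. flat_exp p h / h) \<longlongrightarrow> 0) (at 0)"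
  proof (rule Lim_null_comparison)
    show "\<forall>\<^sub>F h in at 0. norm (flat_exp p h / h) \<le> M * \<bar>h\<bar>"
      using M by (intro always_eventually) (auto simp: divide_simps power2_eq_square mult.assoc)
    show "((\<lambda>h. M * \<bar>h\<bar>) \<longlongrightarrow> 0) (at (0::real))" by (auto intro!: tendsto_eq_intros)
  qed
  then show ?thesis using equal by (simp add: DERIV_def flat_exp_def)
qed

text \<open>A class of one-variable functions supported in \<open>[-r, r]\<close> that is closed under
  differentiation, so that each member is automatically smooth. Products of two flat exponentials,
  one for each end point, are not themselves closed under the product rule; their sums are.\<close>

inductive bump :: "real \<Rightarrow> (real \<Rightarrow> real) \<Rightarrow> bool" for r where
  prod: "bump r (\<lambda>t. flat_exp p (r + t) * flat_exp q (r - t))"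
| add: "bump r a \<Longrightarrow> bump r b \<Longrightarrow> bump r (\<lambda>t. a t + b t)"

lemma bump_eq_0: "bump r a \<Longrightarrow> r \<le> \<bar>t\<bar> \<Longrightarrow> a t = 0"
proof (induction rule: bump.induct)
  case (prod p q)
  then have "r + t \<le> 0 \<or> r - t \<le> 0" by linarith
  then show ?case by (auto simp: flat_exp_eq_0)
qed auto

lemma bump_cmult: "bump r a \<Longrightarrow> bump r (\<lambda>t. c * a t)"
proof (induction rule: bump.induct)
  case (prod p q)
  show ?case using bump.prod[of r "smult c p" q] by (simp add: flat_exp_smult mult.assoc)
next
  case (add a b)
  then show ?case using bump.add by (simp add: distrib_left)
qed

lemma bump_uminus: "bump r a \<Longrightarrow> bump r (\<lambda>t. - a t)"
  using bump_cmult[of r a "-1"] by simp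

lemma bump_deriv_ex: "bump r a \<Longrightarrow> \<exists>a'. bump r a' \<and> (\<forall>t. (a has_field_derivative a' t) (at t))"
proof (induction rule: bump.induct)
  case (prod p q)
  define D where "D p = [:0,0,1:] * (p - pderiv p)" for p :: "real poly"
  have D: "(flat_exp p has_field_derivative flat_exp (D p) t) (at t)" for p t
    unfolding D_def by (rule DERIV_flat_exp)
  have "((\<lambda>t. flat_exp p (r + t) * flat_exp q (r - t)) has_field_derivative
      flat_exp (D p) (r + t) * flat_exp q (r - t) + flat_exp p (r + t) * flat_exp (- D q) (r - t)) (at t)" for t
    by (auto intro!: derivative_eq_intros DERIV_chain'[OF _ D] simp: flat_exp_uminus)
  then show ?case using bump.add[OF bump.prod bump.prod] by blast
next
  case (add a b)
  then obtain a' b' where "bump r a'" "bump r b'" "\<forall>t. (a has_field_derivative a' t) (at t)"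
    "\<forall>t. (b has_field_derivative b' t) (at t)" by blast
  then show ?case by (intro exI[of _ "\<lambda>t. a' t + b' t"]) (auto intro!: bump.add DERIV_add)
qed

lemma bump_deriv: "bump r a \<Longrightarrow> bump r (deriv a)"
  and DERIV_bump: "bump r a \<Longrightarrow> (a has_field_derivative deriv a t) (at t)"
proof -
  assume "bump r a"
  then obtain a' where a': "bump r a'" "\<And>t. (a has_field_derivative a' t) (at t)" using bump_deriv_ex by blast
  then have "a' = deriv a" by (metis DERIV_imp_deriv ext)
  with a' show "bump r (deriv a)" "(a has_field_derivative deriv a t) (at t)" by auto
qed

lemma bump_continuous: "bump r a \<Longrightarrow> continuous_on S a"
  by (intro continuous_at_imp_continuous_on ballI DERIV_isCont[OF DERIV_bump])

lemma bump_measurable [measurable (raw)]: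
  "bump r a \<Longrightarrow> f \<in> borel_measurable M \<Longrightarrow> (\<lambda>x. a (f x)) \<in> borel_measurable M"
  by (rule measurable_compose[OF _ borel_measurable_continuous_onI[OF bump_continuous]])

lemma bump_bounded:
  assumes "bump r a" obtains M where "M \<ge> 0" "\<And>t. \<bar>a t\<bar> \<le> M"
proof -
  have "compact (a ` cball 0 \<bar>r\<bar>)" by (intro compact_continuous_image bump_continuous[OF assms]) auto
  then have "bounded (a ` cball 0 \<bar>r\<bar>)" by (rule compact_imp_bounded)
  then obtain M where "\<forall>t\<in>cball 0 \<bar>r\<bar>. \<bar>a t\<bar> \<le> M" unfolding bounded_iff by auto
  then have M: "\<bar>a t\<bar> \<le> M" if "\<bar>t\<bar> \<le> \<bar>r\<bar>" for t using that by simp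
  have "M \<ge> 0" using M[of 0] by auto
  moreover have "\<bar>a t\<bar> \<le> M" for t
    using M[of t] bump_eq_0[OF assms, of t] \<open>M \<ge> 0\<close> by (cases "\<bar>t\<bar> \<le> \<bar>r\<bar>") auto
  ultimately show ?thesis using that by blast
qed

lemma bump_increment_le:
  assumes "bump r a" "\<And>t. \<bar>deriv a t\<bar> \<le> M"
  shows "\<bar>a (t + h) - a t\<bar> \<le> M * \<bar>h\<bar>"
  using field_differentiable_bound[of UNIV a "deriv a" M t "t + h"] DERIV_bump[OF assms(1)] assms(2)
  by auto

text \<open>The remainder is uniform in the base point, which permits differentiation under an integral by
  integrating the remainder.\<close>

lemma bump_taylor:
  assumes "bump r a"
  obtains L where "L \<ge> 0" "\<And>t h. \<bar>a (t + h) - a t - deriv a t * h\<bar> \<le> L * h^2"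
proof -
  obtain M where M: "M \<ge> 0" "\<And>t. \<bar>deriv (deriv a) t\<bar> \<le> M"
    using bump_bounded[OF bump_deriv[OF bump_deriv[OF assms]]] by blast
  have "\<bar>a (t + h) - a t - deriv a t * h\<bar> \<le> M * h^2" for t h
  proof -
    have D: "((\<lambda>s. a s - deriv a t * s) has_field_derivative deriv a s - deriv a t) (at s within S)" for s S
      by (auto intro!: derivative_eq_intros DERIV_subset[OF DERIV_bump[OF assms]])
    have "norm ((a (t + h) - deriv a t * (t + h)) - (a t - deriv a t * t)) \<le> (M * \<bar>h\<bar>) * norm (t + h - t)"
    proof (rule field_differentiable_bound[of "cball t \<bar>h\<bar>"])
      fix s assume "s \<in> cball t \<bar>h\<bar>"
      then have "\<bar>s - t\<bar> \<le> \<bar>h\<bar>" by (simp add: dist_real_def)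
      then have "M * \<bar>s - t\<bar> \<le> M * \<bar>h\<bar>" using M(1) by (intro mult_left_mono)
      with bump_increment_le[OF bump_deriv[OF assms] M(2), of t "s - t"]
      show "norm (deriv a s - deriv a t) \<le> M * \<bar>h\<bar>" by simp
    qed (use D in \<open>auto simp: dist_real_def\<close>)
    then show ?thesis by (simp add: algebra_simps power2_eq_square)
  qed
  with M(1) show ?thesis using that by blast
qed

definition std_bump :: "real \<Rightarrow> real \<Rightarrow> real" where
  "std_bump r t = flat_exp 1 (r + t) * flat_exp 1 (r - t)"

lemma bump_std_bump: "bump r (std_bump r)"
  unfolding std_bump_def[abs_def] by (rule bump.prod)

lemma std_bump_nonneg: "std_bump r t \<ge> 0"
  by (simp add: std_bump_def flat_exp_def)

lemma std_bump_pos: "\<bar>t\<bar> < r \<Longrightarrow> std_bump r t > 0"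
  by (auto simp: std_bump_def flat_exp_def abs_less_iff)

section \<open>Product kernels in the plane\<close>

lemma norm_vec2_le: "norm (h::real^2) \<le> \<bar>h$1\<bar> + \<bar>h$2\<bar>"
  using norm_le_l1_cart[of h] by (simp add: sum_2)

lemma has_derivative_nth [derivative_intros]:
  "((\<lambda>x::real^2. x $ i) has_derivative (\<lambda>h. h $ i)) (at x within S)"
  by (rule bounded_linear_imp_has_derivative[OF bounded_linear_vec_nth])

lemma partial_deriv_eqI:
  fixes f :: "real^2 \<Rightarrow> real"
  assumes "\<And>x. (f has_derivative (\<lambda>h. f1 x * h$1 + f2 x * h$2)) (at x)"
  shows "partial_deriv 1 f = f1" "partial_deriv 2 f = f2"
  using frechet_derivative_at[OF assms, symmetric]
  by (auto simp: partial_deriv_def axis_def fun_eq_iff)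

lemma has_derivative_product_kernel:
  assumes "bump r a" "bump r b"
  shows "((\<lambda>y::real^2. a (y$1) * b (y$2)) has_derivative
     (\<lambda>h. (deriv a (y$1) * b (y$2)) * h$1 + (a (y$1) * deriv b (y$2)) * h$2)) (at y)"
proof -
  have "((\<lambda>y::real^2. a (y$1)) has_derivative (\<lambda>h. deriv a (y$1) * h$1)) (at y)"
    "((\<lambda>y::real^2. b (y$2)) has_derivative (\<lambda>h. deriv b (y$2) * h$2)) (at y)"
    using has_derivative_compose[OF has_derivative_nth DERIV_bump[OF assms(1), unfolded has_field_derivative_def]]
      has_derivative_compose[OF has_derivative_nth DERIV_bump[OF assms(2), unfolded has_field_derivative_def]]
    by auto
  from has_derivative_mult[OF this] show ?thesis
    by (rule has_derivative_eq_rhs) (auto simp: algebra_simps)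
qed

lemma has_derivative_reflected_kernel:
  fixes x :: "real^2"
  assumes "bump r a" "bump r b"
  shows "((\<lambda>y::real^2. a (x$1 - y$1) * b (x$2 - y$2)) has_derivative
     (\<lambda>h. (- deriv a (x$1 - y$1) * b (x$2 - y$2)) * h$1 + (- (a (x$1 - y$1) * deriv b (x$2 - y$2))) * h$2)) (at y)"
proof -
  have "((\<lambda>y::real^2. x - y) has_derivative (\<lambda>h. - h)) (at y)" for y by (auto intro!: derivative_eq_intros)
  from has_derivative_compose[OF this has_derivative_product_kernel[OF assms]]
  show ?thesis by (simp add: algebra_simps)
qed

text \<open>Each partial derivative differentiates one factor and keeps the product form, so iterated partial
  derivatives stay in the same class.\<close>

lemma foldr_partial_deriv_kernel:
  fixes x :: "real^2"
  assumes "bump r a" "bump r b"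
  shows "\<exists>a' b'. bump r a' \<and> bump r b' \<and>
     foldr partial_deriv js (\<lambda>y::real^2. a (x$1 - y$1) * b (x$2 - y$2)) = (\<lambda>y::real^2. a' (x$1 - y$1) * b' (x$2 - y$2))"
proof (induction js)
  case Nil
  then show ?case using assms by auto
next
  case (Cons j js)
  then obtain a' b' where *: "bump r a'" "bump r b'"
    "foldr partial_deriv js (\<lambda>y::real^2. a (x$1 - y$1) * b (x$2 - y$2)) = (\<lambda>y::real^2. a' (x$1 - y$1) * b' (x$2 - y$2))"
    by blast
  note p = partial_deriv_eqI[OF has_derivative_reflected_kernel[OF *(1,2)]]
  note u = bump_uminus[OF bump_deriv[OF *(1)]] bump_uminus[OF bump_deriv[OF *(2)]]
  have "j = 1 \<or> j = (2::2)" by (rule exhaust_2)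
  then show ?case
  proof
    assume "j = 1"
    then have "foldr partial_deriv (j # js) (\<lambda>y. a (x$1 - y$1) * b (x$2 - y$2)) =
        (\<lambda>y. - deriv a' (x$1 - y$1) * b' (x$2 - y$2))"
      by (simp add: *(3) p(1))
    then show ?thesis using *(2) u(1) by blast
  next
    assume "j = 2"
    then have "foldr partial_deriv (j # js) (\<lambda>y. a (x$1 - y$1) * b (x$2 - y$2)) =
        (\<lambda>y. a' (x$1 - y$1) * - deriv b' (x$2 - y$2))"
      by (simp add: *(3) p(2))
    then show ?thesis using *(1) u(2) by blast
  qed
qed

lemma test_function_kernel:
  fixes x :: "real^2"
  assumes ab: "bump r a" "bump r b" and sub: "cball x (2 * r) \<subseteq> \<Omega>"
  shows "test_function \<Omega> (\<lambda>y::real^2. a (x$1 - y$1) * b (x$2 - y$2))"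
proof -
  let ?f = "\<lambda>y::real^2. a (x$1 - y$1) * b (x$2 - y$2)"
  have "smooth ?f"
    unfolding smooth_def
  proof (intro allI)
    fix js y
    obtain a' b' where "bump r a'" "bump r b'"
      and eq: "foldr partial_deriv js ?f = (\<lambda>y::real^2. a' (x$1 - y$1) * b' (x$2 - y$2))"
      using foldr_partial_deriv_kernel[OF ab] by blast
    then show "foldr partial_deriv js ?f differentiable at y"
      unfolding eq differentiable_def by (blast intro: has_derivative_reflected_kernel)
  qed
  moreover have "{y. ?f y \<noteq> 0} \<subseteq> cball x (2 * r)"
  proof
    fix y assume "y \<in> {y. ?f y \<noteq> 0}"
    then have "\<not> r \<le> \<bar>x$1 - y$1\<bar>" "\<not> r \<le> \<bar>x$2 - y$2\<bar>"
      using bump_eq_0[OF ab(1)] bump_eq_0[OF ab(2)] by auto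
    then show "y \<in> cball x (2 * r)" using norm_vec2_le[of "x - y"] by (simp add: dist_norm)
  qed
  then have "closure {y. ?f y \<noteq> 0} \<subseteq> cball x (2 * r)" by (simp add: closure_minimal)
  moreover from this have "compact (closure {y. ?f y \<noteq> 0})"
    using bounded_subset[OF bounded_cball] by (simp add: compact_eq_bounded_closed)
  ultimately show ?thesis using sub unfolding test_function_def by blast
qed

text \<open>Expand one factor at a time: the error splits into the two one-variable remainders and the mixed
  term \<open>a' p (b (t + q) - b t)\<close>, each of second order.\<close>

lemma product_kernel_taylor:
  assumes "bump r a" "bump r b"
  obtains L where "L \<ge> 0" "\<And>y h :: real^2.
    \<bar>a ((y + h)$1) * b ((y + h)$2) - a (y$1) * b (y$2)
      - (deriv a (y$1) * b (y$2) * h$1 + a (y$1) * deriv b (y$2) * h$2)\<bar> \<le> L * (norm h)^2"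
proof -
  obtain A where A: "A \<ge> 0" "\<And>t. \<bar>a t\<bar> \<le> A" using bump_bounded[OF assms(1)] by blast
  obtain A' where A': "A' \<ge> 0" "\<And>t. \<bar>deriv a t\<bar> \<le> A'" using bump_bounded[OF bump_deriv[OF assms(1)]] by blast
  obtain B where B: "B \<ge> 0" "\<And>t. \<bar>b t\<bar> \<le> B" using bump_bounded[OF assms(2)] by blast
  obtain B' where B': "B' \<ge> 0" "\<And>t. \<bar>deriv b t\<bar> \<le> B'" using bump_bounded[OF bump_deriv[OF assms(2)]] by blast
  obtain L where L: "L \<ge> 0" "\<And>t h. \<bar>a (t + h) - a t - deriv a t * h\<bar> \<le> L * h^2" using bump_taylor[OF assms(1)] by blast
  obtain L' where L': "L' \<ge> 0" "\<And>t h. \<bar>b (t + h) - b t - deriv b t * h\<bar> \<le> L' * h^2" using bump_taylor[OF assms(2)] by blast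
  have "\<bar>a ((y + h)$1) * b ((y + h)$2) - a (y$1) * b (y$2)
      - (deriv a (y$1) * b (y$2) * h$1 + a (y$1) * deriv b (y$2) * h$2)\<bar> \<le> (L * B + A' * B' + A * L') * (norm h)^2"
    for y h :: "real^2"
  proof -
    define s where "s = y$1" define t where "t = y$2" define p where "p = h$1" define q where "q = h$2"
    have pq: "\<bar>p\<bar> \<le> norm h" "\<bar>q\<bar> \<le> norm h" unfolding p_def q_def by (rule component_le_norm_cart)+
    then have sq: "p^2 \<le> (norm h)^2" "q^2 \<le> (norm h)^2" by (simp_all add: abs_le_square_iff[symmetric])
    have 1: "\<bar>(a (s + p) - a s - deriv a s * p) * b (t + q)\<bar> \<le> (L * (norm h)^2) * B"
      unfolding abs_mult using L B sq(1)
      by (intro mult_mono order_trans[OF L(2) mult_left_mono]) auto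
    have 2: "\<bar>deriv a s * p * (b (t + q) - b t)\<bar> \<le> (A' * norm h) * (B' * norm h)"
      unfolding abs_mult using A' B' pq
      by (intro mult_mono order_trans[OF bump_increment_le[OF assms(2) B'(2)] mult_left_mono]) auto
    have 3: "\<bar>a s * (b (t + q) - b t - deriv b t * q)\<bar> \<le> A * (L' * (norm h)^2)"
      unfolding abs_mult using L' A sq(2)
      by (intro mult_mono order_trans[OF L'(2) mult_left_mono]) auto
    have "a (s + p) * b (t + q) - a s * b t - (deriv a s * b t * p + a s * deriv b t * q)
       = (a (s + p) - a s - deriv a s * p) * b (t + q) + deriv a s * p * (b (t + q) - b t)
         + a s * (b (t + q) - b t - deriv b t * q)"
      by (simp add: algebra_simps)
    then have "\<bar>a (s + p) * b (t + q) - a s * b t - (deriv a s * b t * p + a s * deriv b t * q)\<bar>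
       \<le> (L * (norm h)^2) * B + (A' * norm h) * (B' * norm h) + A * (L' * (norm h)^2)"
      using 1 2 3 by linarith
    then show ?thesis by (simp add: s_def t_def p_def q_def algebra_simps power2_eq_square)
  qed
  moreover have "0 \<le> L * B + A' * B' + A * L'" using A A' B B' L L' by auto
  ultimately show ?thesis using that by blast
qed

section \<open>Smearing against a kernel\<close>

text \<open>The density at \<open>w\<close> of the image under \<open>h\<close> of the measure \<open>G dM\<close>, smoothed by the product kernel
  \<open>a \<otimes> b\<close>. With \<open>h\<close> the identity this is convolution; with \<open>h = u\<close> and \<open>G = J\<close> it is the pushed forward
  Jacobian.\<close>

definition smear :: "'a measure \<Rightarrow> ('a \<Rightarrow> real) \<Rightarrow> ('a \<Rightarrow> real^2) \<Rightarrow> (real \<Rightarrow> real) \<Rightarrow> (real \<Rightarrow> real) \<Rightarrow> real^2 \<Rightarrow> real"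
  where "smear M G h a b w = (LINT x|M. G x * (a (w$1 - h x$1) * b (w$2 - h x$2)))"

lemma integrable_smear:
  fixes h :: "'a \<Rightarrow> real^2" and w :: "real^2"
  assumes G: "integrable M G" and h: "h \<in> borel_measurable M" and ab: "bump r a" "bump r b"
  shows "integrable M (\<lambda>x. G x * (a (w$1 - h x$1) * b (w$2 - h x$2)))"
proof -
  obtain A where A: "A \<ge> 0" "\<And>t. \<bar>a t\<bar> \<le> A" using bump_bounded[OF ab(1)] by blast
  obtain B where B: "B \<ge> 0" "\<And>t. \<bar>b t\<bar> \<le> B" using bump_bounded[OF ab(2)] by blast
  have [measurable]: "(\<lambda>x. h x $ i) \<in> borel_measurable M" for i
    using measurable_compose[OF h borel_measurable_continuous_onI[OF continuous_on_component[OF continuous_on_id]]] by simp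
  note [measurable] = bump_measurable[OF ab(1)] bump_measurable[OF ab(2)] borel_measurable_integrable[OF G]
  show ?thesis
  proof (rule Bochner_Integration.integrable_bound[of M "\<lambda>x. (A * B) * G x"])
    show "AE x in M. norm (G x * (a (w$1 - h x$1) * b (w$2 - h x$2))) \<le> norm ((A * B) * G x)"
    proof (rule AE_I2)
      fix x
      have "\<bar>a (w$1 - h x$1) * b (w$2 - h x$2)\<bar> \<le> A * B"
        unfolding abs_mult using A B by (intro mult_mono) auto
      then have "\<bar>G x\<bar> * \<bar>a (w$1 - h x$1) * b (w$2 - h x$2)\<bar> \<le> \<bar>G x\<bar> * (A * B)" by (intro mult_left_mono) auto
      then show "norm (G x * (a (w$1 - h x$1) * b (w$2 - h x$2))) \<le> norm ((A * B) * G x)"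
        using A B by (simp add: abs_mult mult_ac)
    qed
  qed (use G in auto)
qed

lemma bounded_smear:
  fixes h :: "'a \<Rightarrow> real^2" and w :: "real^2"
  assumes G: "integrable M G" and h: "h \<in> borel_measurable M" and ab: "bump r a" "bump r b"
  shows "bounded (range (smear M G h a b))"
proof -
  obtain A where A: "A \<ge> 0" "\<And>t. \<bar>a t\<bar> \<le> A" using bump_bounded[OF ab(1)] by blast
  obtain B where B: "B \<ge> 0" "\<And>t. \<bar>b t\<bar> \<le> B" using bump_bounded[OF ab(2)] by blast
  have "\<bar>smear M G h a b w\<bar> \<le> (LINT x|M. \<bar>G x\<bar> * (A * B))" for w
  proof -
    have "\<bar>smear M G h a b w\<bar> \<le> (LINT x|M. \<bar>G x * (a (w$1 - h x$1) * b (w$2 - h x$2))\<bar>)"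
      unfolding smear_def using integral_norm_bound[of M "\<lambda>x. G x * (a (w$1 - h x$1) * b (w$2 - h x$2))"] by simp
    also have "\<dots> \<le> (LINT x|M. \<bar>G x\<bar> * (A * B))"
    proof (rule integral_mono)
      show "\<bar>G x * (a (w$1 - h x$1) * b (w$2 - h x$2))\<bar> \<le> \<bar>G x\<bar> * (A * B)" for x
        unfolding abs_mult using A B by (intro mult_mono) auto
    qed (use integrable_smear[OF G h ab, of w] G in auto)
    finally show ?thesis .
  qed
  then show ?thesis unfolding bounded_iff by auto
qed

text \<open>The quadratic Taylor remainder of the kernel is uniform, so integrating it against \<open>G\<close> gives a
  remainder of second order.\<close>

lemma has_derivative_smear:
  fixes h :: "'a \<Rightarrow> real^2" and w :: "real^2"
  assumes G: "integrable M G" and h: "h \<in> borel_measurable M" and ab: "bump r a" "bump r b"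
  shows "(smear M G h a b has_derivative
    (\<lambda>d. smear M G h (deriv a) b w * d$1 + smear M G h a (deriv b) w * d$2)) (at w)"
proof -
  note da = bump_deriv[OF ab(1)] and db = bump_deriv[OF ab(2)]
  obtain L where L: "L \<ge> 0" "\<And>y h :: real^2.
    \<bar>a ((y + h)$1) * b ((y + h)$2) - a (y$1) * b (y$2)
      - (deriv a (y$1) * b (y$2) * h$1 + a (y$1) * deriv b (y$2) * h$2)\<bar> \<le> L * (norm h)^2"
    using product_kernel_taylor[OF ab] by blast
  define D where "D d = smear M G h (deriv a) b w * d$1 + smear M G h a (deriv b) w * d$2" for d :: "real^2"
  define C where "C = L * (LINT x|M. \<bar>G x\<bar>)"
  have int: "integrable M (\<lambda>x. G x * (a (w$1 - h x$1) * b (w$2 - h x$2)))"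
    "integrable M (\<lambda>x. G x * (deriv a (w$1 - h x$1) * b (w$2 - h x$2)))"
    "integrable M (\<lambda>x. G x * (a (w$1 - h x$1) * deriv b (w$2 - h x$2)))" for w :: "real^2"
    using integrable_smear[OF G h ab] integrable_smear[OF G h da ab(2)] integrable_smear[OF G h ab(1) db] by auto
  have bl: "bounded_linear D" unfolding D_def
    by (intro bounded_linear_add bounded_linear_mult_right[THEN bounded_linear_compose] bounded_linear_vec_nth)
  have est: "\<bar>smear M G h a b (w + d) - smear M G h a b w - D d\<bar> \<le> C * (norm d)^2" for d
  proof -
    let ?R = "\<lambda>x. G x * (a ((w + d)$1 - h x$1) * b ((w + d)$2 - h x$2)) - G x * (a (w$1 - h x$1) * b (w$2 - h x$2))
       - (G x * (deriv a (w$1 - h x$1) * b (w$2 - h x$2)) * d$1 + G x * (a (w$1 - h x$1) * deriv b (w$2 - h x$2)) * d$2)"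
    have eq: "smear M G h a b (w + d) - smear M G h a b w - D d = (LINT x|M. ?R x)"
      unfolding smear_def D_def using int[of w] int(1)[of "w + d"] by (simp del: vector_add_component)
    have "\<bar>smear M G h a b (w + d) - smear M G h a b w - D d\<bar> \<le> (LINT x|M. \<bar>?R x\<bar>)" unfolding eq using integral_norm_bound[of M ?R] unfolding real_norm_def .
    also have "\<dots> \<le> (LINT x|M. \<bar>G x\<bar> * (L * (norm d)^2))"
    proof (rule integral_mono)
      show "integrable M (\<lambda>x. \<bar>?R x\<bar>)"
        by (intro integrable_abs Bochner_Integration.integrable_diff Bochner_Integration.integrable_add
            integrable_mult_left int[of w] int(1)[of "w + d"])
      show "integrable M (\<lambda>x. \<bar>G x\<bar> * (L * (norm d)^2))" using G by auto
      fix x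
      let ?y = "w - h x"
      have "?R x = G x * (a ((?y + d)$1) * b ((?y + d)$2) - a (?y$1) * b (?y$2)
          - (deriv a (?y$1) * b (?y$2) * d$1 + a (?y$1) * deriv b (?y$2) * d$2))"
        by (simp add: algebra_simps)
      then show "\<bar>?R x\<bar> \<le> \<bar>G x\<bar> * (L * (norm d)^2)"
        by (simp only: abs_mult) (intro mult_left_mono L(2) abs_ge_zero)
    qed
    also have "\<dots> = C * (norm d)^2" by (simp add: C_def mult_ac)
    finally show ?thesis .
  qed
  have "(\<lambda>d. norm (smear M G h a b (w + d) - smear M G h a b w - D d) / norm d) \<midarrow>0\<rightarrow> 0"
  proof (rule Lim_null_comparison)
    show "\<forall>\<^sub>F d in at 0. norm (norm (smear M G h a b (w + d) - smear M G h a b w - D d) / norm d) \<le> C * norm d"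
      unfolding eventually_at_filter using est
      by (intro always_eventually) (auto simp: divide_simps power2_eq_square mult.assoc)
    show "((\<lambda>d. C * norm d) \<longlongrightarrow> 0) (at (0::real^2))" by (auto intro!: tendsto_eq_intros)
  qed
  with bl have "(smear M G h a b has_derivative D) (at w)" by (simp add: has_derivative_at)
  then show ?thesis by (simp add: D_def[abs_def])
qed

section \<open>Integrals of directional derivatives\<close>

lemma lborel_integral_translation:
  fixes g :: "'a::euclidean_space \<Rightarrow> real"
  assumes "g \<in> borel_measurable borel"
  shows "(LINT x|lborel. g (c + x)) = (LINT x|lborel. g x)"
  using integral_distr[of "(+) c" lborel borel g] assms lborel_distr_plus[of c] by simp

lemma lborel_integrable_translation:
  fixes g :: "'a::euclidean_space \<Rightarrow> real"
  assumes "integrable lborel g"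
  shows "integrable lborel (\<lambda>x. g (c + x))"
  using integrable_distr[of "(+) c" lborel borel g] assms lborel_distr_plus[of c] by simp

text \<open>The difference quotients have integral zero by translation invariance, and the bounded derivative
  and compact support provide a dominating function for the passage to the limit.\<close>

lemma integral_directional_derivative_eq_0:
  fixes g :: "'a::euclidean_space \<Rightarrow> real"
  assumes D: "\<And>x. (g has_derivative g' x) (at x)" and B: "\<And>x. \<bar>g' x b\<bar> \<le> B"
    and supp: "bounded {x. g x \<noteq> 0}"
  shows "integrable lborel (\<lambda>x. g' x b)" "(LINT x|lborel. g' x b) = 0"
proof -
  have cont: "continuous_on UNIV g" using D by (meson continuous_at_imp_continuous_on has_derivative_continuous)
  then have [measurable]: "g \<in> borel_measurable borel" by (rule borel_measurable_continuous_onI)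
  obtain R where R: "\<And>x. g x \<noteq> 0 \<Longrightarrow> norm x \<le> R" using supp unfolding bounded_iff by auto
  have int: "integrable lborel g"
  proof -
    have "integrable lborel (\<lambda>x. indicator (cball 0 R) x *\<^sub>R g x)"
      by (rule borel_integrable_compact) (use cont continuous_on_subset in auto)
    moreover have "(\<lambda>x. indicator (cball 0 R) x *\<^sub>R g x) = g" using R by (force simp: indicator_def)
    ultimately show ?thesis by simp
  qed
  define q where "q n x = (g ((inverse (real (Suc n))) *\<^sub>R b + x) - g x) * real (Suc n)" for n x
  have line: "((\<lambda>t. g (x + t *\<^sub>R b)) has_field_derivative g' (x + t *\<^sub>R b) b) (at t)" for x t
  proof -
    have "((\<lambda>t. x + t *\<^sub>R b) has_derivative (\<lambda>h. h *\<^sub>R b)) (at t)" by (auto intro!: derivative_eq_intros)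
    from has_derivative_compose[OF this D]
    have "((\<lambda>t. g (x + t *\<^sub>R b)) has_derivative (\<lambda>h. g' (x + t *\<^sub>R b) (h *\<^sub>R b))) (at t)" .
    moreover have "g' y (h *\<^sub>R b) = g' y b * h" for h y
      using linear_cmul[OF has_derivative_linear[OF D]] by simp
    ultimately show ?thesis by (simp add: has_field_derivative_def)
  qed
  have q_bound: "\<bar>q n x\<bar> \<le> B" for n x
  proof -
    have "norm (g (x + inverse (real (Suc n)) *\<^sub>R b) - g (x + 0 *\<^sub>R b)) \<le> B * norm (inverse (real (Suc n)) - 0)"
      by (rule field_differentiable_bound[of UNIV]) (use line B in auto)
    then have "\<bar>g (inverse (real (Suc n)) *\<^sub>R b + x) - g x\<bar> \<le> B * inverse (real (Suc n))"
      by (simp add: add.commute)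
    then have "\<bar>g (inverse (real (Suc n)) *\<^sub>R b + x) - g x\<bar> * real (Suc n) \<le> B * inverse (real (Suc n)) * real (Suc n)"
      by (rule mult_right_mono) simp
    also have "B * inverse (real (Suc n)) * real (Suc n) = B" by simp
    finally show ?thesis by (simp add: q_def abs_mult)
  qed
  have q_supp: "q n x = 0" if "x \<notin> cball 0 (R + norm b)" for n x
  proof -
    have "norm (inverse (real (Suc n)) *\<^sub>R b) \<le> norm b"
      by (simp add: mult_left_le_one_le inverse_le_1_iff del: of_nat_Suc)
    moreover have "norm x \<le> norm (inverse (real (Suc n)) *\<^sub>R b + x) + norm (inverse (real (Suc n)) *\<^sub>R b)"
      using norm_triangle_ineq4[of "inverse (real (Suc n)) *\<^sub>R b + x" "inverse (real (Suc n)) *\<^sub>R b"] by simp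
    moreover have "norm x > R + norm b" using that by simp
    ultimately have "norm (inverse (real (Suc n)) *\<^sub>R b + x) > R" "norm x > R" using norm_ge_zero[of b] by linarith+
    then show ?thesis using R[of x] R[of "inverse (real (Suc n)) *\<^sub>R b + x"] unfolding q_def by force
  qed
  have q_lim: "(\<lambda>n. q n x) \<longlonglongrightarrow> g' x b" for x
  proof -
    have "((\<lambda>h. (g (x + h *\<^sub>R b) - g x) / h) \<longlongrightarrow> g' x b) (at 0)"
      using line[of x 0] by (simp add: DERIV_def)
    moreover have "filterlim (\<lambda>n. inverse (real (Suc n))) (at 0) sequentially"
      using LIMSEQ_inverse_real_of_nat by (auto simp: filterlim_at)
    ultimately have "(\<lambda>n. (g (x + inverse (real (Suc n)) *\<^sub>R b) - g x) / inverse (real (Suc n))) \<longlonglongrightarrow> g' x b"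
      by (rule filterlim_compose)
    then show ?thesis by (simp add: q_def divide_inverse add.commute del: of_nat_Suc)
  qed
  have q_meas [measurable]: "q n \<in> borel_measurable lborel" for n unfolding q_def by measurable
  have lim_meas: "(\<lambda>x. g' x b) \<in> borel_measurable lborel"
    by (rule borel_measurable_LIMSEQ_real[of _ q]) (use q_lim in auto)
  have w: "integrable lborel (\<lambda>x. B * indicator (cball 0 (R + norm b)) x)"
    using emeasure_lborel_cball_finite[of 0 "R + norm b"] by (intro integrable_mult_right integrable_real_indicator) auto
  have dom: "AE x in lborel. norm (q n x) \<le> B * indicator (cball 0 (R + norm b)) x" for n
    using q_bound q_supp by (intro AE_I2) (auto simp: indicator_def)
  have lim: "AE x in lborel. (\<lambda>n. q n x) \<longlonglongrightarrow> g' x b" using q_lim by (intro AE_I2)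
  note dc = lim_meas q_meas w lim dom
  show "integrable lborel (\<lambda>x. g' x b)" by (rule integrable_dominated_convergence[OF dc])
  have "(LINT x|lborel. q n x) = 0" for n
    unfolding q_def using int lborel_integrable_translation[OF int] lborel_integral_translation[of g] by simp
  with integral_dominated_convergence[OF dc] show "(LINT x|lborel. g' x b) = 0"
    by (simp add: LIMSEQ_const_iff)
qed

section \<open>Limits of products of square integrable functions\<close>

lemma integrable_mult_square_integrable:
  fixes f g :: "'a \<Rightarrow> real"
  assumes [measurable]: "f \<in> borel_measurable M" "g \<in> borel_measurable M"
    and "integrable M (\<lambda>x. (f x)\<^sup>2)" "integrable M (\<lambda>x. (g x)\<^sup>2)"
  shows "integrable M (\<lambda>x. f x * g x)"
proof (rule Bochner_Integration.integrable_bound)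
  show "integrable M (\<lambda>x. (f x)\<^sup>2 + (g x)\<^sup>2)" using assms by simp
  have "\<bar>s * t\<bar> \<le> s\<^sup>2 + t\<^sup>2" for s t :: real
  proof -
    have "2 * (\<bar>s\<bar> * \<bar>t\<bar>) \<le> s\<^sup>2 + t\<^sup>2" using sum_squares_bound[of "\<bar>s\<bar>" "\<bar>t\<bar>"] by (simp add: mult.assoc)
    moreover have "0 \<le> \<bar>s\<bar> * \<bar>t\<bar>" by simp
    ultimately show ?thesis unfolding abs_mult by linarith
  qed
  then show "AE x in M. norm (f x * g x) \<le> norm ((f x)\<^sup>2 + (g x)\<^sup>2)"
    by (intro AE_I2) auto
qed simp

lemma integrable_square_diff:
  fixes f g :: "'a \<Rightarrow> real"
  assumes [measurable]: "f \<in> borel_measurable M" "g \<in> borel_measurable M"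
    and "integrable M (\<lambda>x. (f x)\<^sup>2)" "integrable M (\<lambda>x. (g x)\<^sup>2)"
  shows "integrable M (\<lambda>x. (f x - g x)\<^sup>2)"
  using integrable_mult_square_integrable[OF assms] assms(3,4)
  unfolding power2_diff by (auto simp: mult.assoc)

lemma Cauchy_Schwarz_integral:
  fixes f g :: "'a \<Rightarrow> real"
  assumes [measurable]: "f \<in> borel_measurable M" "g \<in> borel_measurable M"
    and sq: "integrable M (\<lambda>x. (f x)\<^sup>2)" "integrable M (\<lambda>x. (g x)\<^sup>2)"
  shows "(LINT x|M. \<bar>f x * g x\<bar>) \<le> sqrt (LINT x|M. (f x)\<^sup>2) * sqrt (LINT x|M. (g x)\<^sup>2)"
proof -
  have int: "integrable M (\<lambda>x. \<bar>f x * g x\<bar>)" using integrable_mult_square_integrable[OF assms] by simp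
  have "(\<integral>\<^sup>+x. ennreal \<bar>f x\<bar> * ennreal \<bar>g x\<bar> \<partial>M)\<^sup>2
      \<le> (\<integral>\<^sup>+x. (ennreal \<bar>f x\<bar>)\<^sup>2 \<partial>M) * (\<integral>\<^sup>+x. (ennreal \<bar>g x\<bar>)\<^sup>2 \<partial>M)"
    by (rule Cauchy_Schwarz_nn_integral) auto
  moreover have "(\<integral>\<^sup>+x. ennreal \<bar>f x\<bar> * ennreal \<bar>g x\<bar> \<partial>M) = ennreal (LINT x|M. \<bar>f x * g x\<bar>)"
    using int by (subst nn_integral_eq_integral[symmetric]) (auto simp: ennreal_mult' abs_mult)
  moreover have "(\<integral>\<^sup>+x. (ennreal \<bar>h x\<bar>)\<^sup>2 \<partial>M) = ennreal (LINT x|M. (h x)\<^sup>2)" if "integrable M (\<lambda>x. (h x)\<^sup>2)" for h :: "'a \<Rightarrow> real"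
    using that by (subst nn_integral_eq_integral[symmetric]) (auto simp: ennreal_power)
  ultimately have "ennreal ((LINT x|M. \<bar>f x * g x\<bar>)\<^sup>2) \<le> ennreal ((LINT x|M. (f x)\<^sup>2) * (LINT x|M. (g x)\<^sup>2))"
    using sq by (simp add: ennreal_power ennreal_mult')
  then have "(LINT x|M. \<bar>f x * g x\<bar>)\<^sup>2 \<le> (LINT x|M. (f x)\<^sup>2) * (LINT x|M. (g x)\<^sup>2)"
    by (simp add: ennreal_le_iff)
  from real_le_rsqrt[OF this] show ?thesis by (simp add: real_sqrt_mult)
qed

text \<open>Write \<open>X'Y' - XY = (X' - X)(Y' - Y) + (X' - X) Y + X (Y' - Y)\<close> and apply Cauchy--Schwarz to each
  term.\<close>

lemma tendsto_integral_abs_mult_diff: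
  fixes X Y :: "'a \<Rightarrow> real"
  assumes [measurable]: "\<And>n. X' n \<in> borel_measurable M" "X \<in> borel_measurable M"
      "\<And>n. Y' n \<in> borel_measurable M" "Y \<in> borel_measurable M"
    and sq: "\<And>n. integrable M (\<lambda>x. (X' n x)\<^sup>2)" "integrable M (\<lambda>x. (X x)\<^sup>2)"
      "\<And>n. integrable M (\<lambda>x. (Y' n x)\<^sup>2)" "integrable M (\<lambda>x. (Y x)\<^sup>2)"
    and lim: "(\<lambda>n. LINT x|M. (X' n x - X x)\<^sup>2) \<longlonglongrightarrow> 0" "(\<lambda>n. LINT x|M. (Y' n x - Y x)\<^sup>2) \<longlonglongrightarrow> 0"
  shows "(\<lambda>n. LINT x|M. \<bar>X' n x * Y' n x - X x * Y x\<bar>) \<longlonglongrightarrow> 0"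
proof (rule tendsto_sandwich[OF _ _ tendsto_const])
  let ?x = "\<lambda>n. sqrt (LINT x|M. (X' n x - X x)\<^sup>2)" and ?y = "\<lambda>n. sqrt (LINT x|M. (Y' n x - Y x)\<^sup>2)"
  let ?X = "sqrt (LINT x|M. (X x)\<^sup>2)" and ?Y = "sqrt (LINT x|M. (Y x)\<^sup>2)"
  note dx = integrable_square_diff[OF _ _ sq(1,2)] and dy = integrable_square_diff[OF _ _ sq(3,4)]
  show "\<forall>\<^sub>F n in sequentially. 0 \<le> (LINT x|M. \<bar>X' n x * Y' n x - X x * Y x\<bar>)" by simp
  have "(LINT x|M. \<bar>X' n x * Y' n x - X x * Y x\<bar>) \<le> ?x n * ?y n + ?x n * ?Y + ?X * ?y n" for n
  proof -
    let ?a = "\<lambda>x. \<bar>(X' n x - X x) * (Y' n x - Y x)\<bar>" and ?b = "\<lambda>x. \<bar>(X' n x - X x) * Y x\<bar>"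
      and ?c = "\<lambda>x. \<bar>X x * (Y' n x - Y x)\<bar>"
    have i: "integrable M ?a" "integrable M ?b" "integrable M ?c"
      by (intro integrable_abs integrable_mult_square_integrable dx dy sq; measurable)+
    have i': "integrable M (\<lambda>x. \<bar>X' n x * Y' n x - X x * Y x\<bar>)"
      by (intro integrable_abs Bochner_Integration.integrable_diff integrable_mult_square_integrable sq; measurable)
    have "\<bar>X' n x * Y' n x - X x * Y x\<bar> \<le> ?a x + ?b x + ?c x" for x
    proof -
      have "X' n x * Y' n x - X x * Y x = (X' n x - X x) * (Y' n x - Y x) + (X' n x - X x) * Y x + X x * (Y' n x - Y x)"
        by (simp add: algebra_simps)
      then show ?thesis by linarith
    qed
    then have "(LINT x|M. \<bar>X' n x * Y' n x - X x * Y x\<bar>) \<le> (LINT x|M. ?a x + ?b x + ?c x)"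
      using i i' by (intro integral_mono) auto
    also have "\<dots> = (LINT x|M. ?a x) + (LINT x|M. ?b x) + (LINT x|M. ?c x)" using i by simp
    also have "\<dots> \<le> ?x n * ?y n + ?x n * ?Y + ?X * ?y n"
      using Cauchy_Schwarz_integral[OF _ _ dx[of n] dy[of n]] Cauchy_Schwarz_integral[OF _ _ dx[of n] sq(4)]
        Cauchy_Schwarz_integral[OF _ _ sq(2) dy[of n]] by (intro add_mono) measurable
    finally show ?thesis .
  qed
  then show "\<forall>\<^sub>F n in sequentially. (LINT x|M. \<bar>X' n x * Y' n x - X x * Y x\<bar>) \<le> ?x n * ?y n + ?x n * ?Y + ?X * ?y n"
    by simp
  show "(\<lambda>n. ?x n * ?y n + ?x n * ?Y + ?X * ?y n) \<longlonglongrightarrow> 0"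
    by (auto intro!: tendsto_eq_intros lim)
qed

lemma tendsto_integral_uniform_mult:
  fixes A P :: "'a \<Rightarrow> real"
  assumes [measurable]: "\<And>n. A' n \<in> borel_measurable M" "A \<in> borel_measurable M"
    and P: "\<And>n. integrable M (P' n)" "integrable M P"
    and lim: "(\<lambda>n. LINT x|M. \<bar>P' n x - P x\<bar>) \<longlonglongrightarrow> 0"
    and unif: "uniform_limit (space M) A' A sequentially"
    and bA: "\<And>x. x \<in> space M \<Longrightarrow> \<bar>A x\<bar> \<le> K" and bA': "\<And>n x. x \<in> space M \<Longrightarrow> \<bar>A' n x\<bar> \<le> K' n"
  shows "(\<lambda>n. LINT x|M. A' n x * P' n x) \<longlonglongrightarrow> (LINT x|M. A x * P x)"
proof (rule LIMSEQ_I)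
  fix e :: real assume e: "e > 0"
  define I where "I = (LINT x|M. \<bar>P x\<bar>)"
  have I: "I \<ge> 0" unfolding I_def by simp
  define d where "d = min 1 (e / (2 * (I + 1)))"
  have d: "d > 0" "d \<le> 1" "d * I < e / 2"
  proof -
    show "d > 0" "d \<le> 1" using e I by (auto simp: d_def)
    have "d * I \<le> e / (2 * (I + 1)) * I" using I by (intro mult_right_mono) (auto simp: d_def)
    also have "\<dots> < e / 2" using e I by (simp add: field_simps)
    finally show "d * I < e / 2" .
  qed
  have mP [measurable]: "P \<in> borel_measurable M" "\<And>n. P' n \<in> borel_measurable M" using P by auto
  have iAP: "integrable M (\<lambda>x. A x * P x)"
  proof (rule Bochner_Integration.integrable_bound[of M "\<lambda>x. K * P x"])
    show "AE x in M. norm (A x * P x) \<le> norm (K * P x)"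
    proof (rule AE_I2)
      fix x assume "x \<in> space M"
      from bA[OF this] have "\<bar>A x\<bar> \<le> \<bar>K\<bar>" by linarith
      then show "norm (A x * P x) \<le> norm (K * P x)" by (simp add: abs_mult mult_right_mono)
    qed
  qed (use P in auto)
  have iAP': "integrable M (\<lambda>x. A' n x * P' n x)" for n
  proof (rule Bochner_Integration.integrable_bound[of M "\<lambda>x. K' n * P' n x"])
    show "AE x in M. norm (A' n x * P' n x) \<le> norm (K' n * P' n x)"
    proof (rule AE_I2)
      fix x assume "x \<in> space M"
      from bA'[OF this, of n] have "\<bar>A' n x\<bar> \<le> \<bar>K' n\<bar>" by linarith
      then show "norm (A' n x * P' n x) \<le> norm (K' n * P' n x)" by (simp add: abs_mult mult_right_mono)
    qed
  qed (use P in auto)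
  have "\<forall>\<^sub>F n in sequentially. \<forall>x\<in>space M. dist (A' n x) (A x) < d"
    using unif d(1) by (auto simp: uniform_limit_iff)
  moreover have "(\<lambda>n. (1 + \<bar>K\<bar>) * (LINT x|M. \<bar>P' n x - P x\<bar>)) \<longlonglongrightarrow> 0"
    using tendsto_mult_right_zero[OF lim] by auto
  then have "\<forall>\<^sub>F n in sequentially. (1 + \<bar>K\<bar>) * (LINT x|M. \<bar>P' n x - P x\<bar>) < e / 2"
    by (rule order_tendstoD(2)) (use e in simp)
  ultimately have "\<forall>\<^sub>F n in sequentially. norm ((LINT x|M. A' n x * P' n x) - (LINT x|M. A x * P x)) < e"
  proof eventually_elim
    case (elim n)
    have "norm ((LINT x|M. A' n x * P' n x) - (LINT x|M. A x * P x)) = \<bar>LINT x|M. A' n x * P' n x - A x * P x\<bar>"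
      using iAP iAP' by simp
    also have "\<dots> \<le> (LINT x|M. \<bar>A' n x * P' n x - A x * P x\<bar>)"
      using integral_norm_bound[of M "\<lambda>x. A' n x * P' n x - A x * P x"] by simp
    also have "\<dots> \<le> (LINT x|M. (1 + \<bar>K\<bar>) * \<bar>P' n x - P x\<bar> + d * \<bar>P x\<bar>)"
    proof (rule integral_mono)
      fix x assume x: "x \<in> space M"
      have a: "\<bar>A' n x - A x\<bar> \<le> d" using elim(1) x by (auto simp: dist_real_def less_imp_le)
      have "\<bar>A' n x\<bar> \<le> 1 + \<bar>K\<bar>" using a d(2) bA[OF x] by linarith
      then have "\<bar>A' n x * (P' n x - P x)\<bar> \<le> (1 + \<bar>K\<bar>) * \<bar>P' n x - P x\<bar>" unfolding abs_mult by (rule mult_right_mono) simp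
      moreover have "\<bar>(A' n x - A x) * P x\<bar> \<le> d * \<bar>P x\<bar>" unfolding abs_mult using a by (rule mult_right_mono) simp
      moreover have "A' n x * P' n x - A x * P x = A' n x * (P' n x - P x) + (A' n x - A x) * P x" by (simp add: algebra_simps)
      ultimately show "\<bar>A' n x * P' n x - A x * P x\<bar> \<le> (1 + \<bar>K\<bar>) * \<bar>P' n x - P x\<bar> + d * \<bar>P x\<bar>" by linarith
    qed (use iAP iAP' P in auto)
    also have "\<dots> = (1 + \<bar>K\<bar>) * (LINT x|M. \<bar>P' n x - P x\<bar>) + d * I" using P by (simp add: I_def)
    also have "\<dots> < e" using elim(2) d(3) by linarith
    finally show ?case .
  qed
  then show "\<exists>no. \<forall>n\<ge>no. norm ((LINT x|M. A' n x * P' n x) - (LINT x|M. A x * P x)) < e"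
    by (simp add: eventually_sequentially)
qed

section \<open>Continuity of translations in the square mean\<close>

lemma square_sum_le: "(s + t)\<^sup>2 \<le> 2 * s\<^sup>2 + 2 * (t::real)\<^sup>2"
  using zero_le_power2[of "s - t"] by (simp add: power2_eq_square algebra_simps)

text \<open>A measurable function is an almost everywhere limit of continuous functions. Clipping these to
  \<open>[-M, M]\<close> and multiplying by a continuous cut-off makes the convergence dominated.\<close>

lemma bounded_L2_approx_continuous:
  fixes F :: "'a::euclidean_space \<Rightarrow> real"
  assumes [measurable]: "F \<in> borel_measurable borel" and M: "\<And>x. \<bar>F x\<bar> \<le> M"
    and supp: "\<And>x. R < norm x \<Longrightarrow> F x = 0" and e: "e > 0"
  shows "\<exists>g. continuous_on UNIV g \<and> (\<forall>x. R + 1 < norm x \<longrightarrow> g x = 0) \<and>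
     integrable lborel (\<lambda>x. (F x - g x)\<^sup>2) \<and> (LINT x|lborel. (F x - g x)\<^sup>2) < e"
proof -
  have M0: "M \<ge> 0" using M[of 0] by linarith
  have "F measurable_on UNIV"
    using lebesgue_measurable_imp_measurable_on[of F UNIV] by (simp add: measurable_completion)
  then obtain N g where N: "negligible N" and gc: "\<And>n. continuous_on UNIV (g n)"
    and glim: "\<And>x. x \<notin> N \<Longrightarrow> (\<lambda>n. g n x) \<longlonglongrightarrow> F x"
    unfolding measurable_on_def by auto
  define c where "c x = max 0 (min 1 (R + 1 - norm x))" for x :: 'a
  define G where "G n x = c x * max (- M) (min M (g n x))" for n x
  have c: "0 \<le> c x" "c x \<le> 1" "R + 1 < norm x \<Longrightarrow> c x = 0" "norm x \<le> R \<Longrightarrow> c x = 1" for x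
    by (auto simp: c_def)
  have Gc: "continuous_on UNIV (G n)" for n
    unfolding G_def c_def by (intro continuous_intros gc)
  then have Gm [measurable]: "G n \<in> borel_measurable borel" for n by (rule borel_measurable_continuous_onI)
  have Gb: "\<bar>G n x\<bar> \<le> M" for n x
  proof -
    have "\<bar>max (- M) (min M (g n x))\<bar> \<le> M" using M0 by auto
    then have "c x * \<bar>max (- M) (min M (g n x))\<bar> \<le> 1 * M" using c[of x] by (intro mult_mono) auto
    then show ?thesis using c[of x] by (simp add: G_def abs_mult)
  qed
  have G0: "R + 1 < norm x \<Longrightarrow> G n x = 0" for n x using c(3) by (simp add: G_def)
  have Glim: "(\<lambda>n. G n x) \<longlonglongrightarrow> F x" if "x \<notin> N" for x
  proof -
    have "(\<lambda>n. G n x) \<longlonglongrightarrow> c x * max (- M) (min M (F x))"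
      unfolding G_def by (intro tendsto_intros glim that)
    moreover have "max (- M) (min M (F x)) = F x" using M[of x] by (auto simp: abs_le_iff)
    moreover have "c x * F x = F x" using c(4)[of x] supp[of x] by (cases "norm x \<le> R") auto
    ultimately show ?thesis by simp
  qed
  have "AE x in lebesgue. x \<notin> N" using N by (simp add: negligible_iff_null_sets AE_not_in)
  then have aeN: "AE x in lborel. x \<notin> N" by (simp only: AE_completion_iff)
  have lim: "AE x in lborel. (\<lambda>n. (F x - G n x)\<^sup>2) \<longlonglongrightarrow> 0"
    using aeN
  proof eventually_elim
    case (elim x)
    then show ?case using Glim[OF elim] by (auto intro!: tendsto_eq_intros)
  qed
  have w: "integrable lborel (\<lambda>x. (2 * M)\<^sup>2 * indicator (cball 0 (R + 1)) x :: real)"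
    using emeasure_lborel_cball_finite[of 0 "R + 1"]
    by (intro integrable_mult_right integrable_real_indicator) auto
  have dom: "AE x in lborel. norm ((F x - G n x)\<^sup>2) \<le> (2 * M)\<^sup>2 * indicator (cball 0 (R + 1)) x" for n
  proof (rule AE_I2)
    fix x
    show "norm ((F x - G n x)\<^sup>2) \<le> (2 * M)\<^sup>2 * indicator (cball 0 (R + 1)) x"
    proof (cases "norm x \<le> R + 1")
      case True
      have "\<bar>F x - G n x\<bar> \<le> 2 * M" using M[of x] Gb[of n x] by linarith
      then have "\<bar>F x - G n x\<bar>\<^sup>2 \<le> (2 * M)\<^sup>2" by (rule power_mono) simp
      then show ?thesis using True by simp
    qed (use supp[of x] G0[of x n] in auto)
  qed
  have meas: "(\<lambda>x. 0) \<in> borel_measurable lborel" "\<And>n. (\<lambda>x. (F x - G n x)\<^sup>2) \<in> borel_measurable lborel"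
    by measurable
  note dc = meas w lim dom
  have "(\<lambda>n. LINT x|lborel. (F x - G n x)\<^sup>2) \<longlonglongrightarrow> 0"
    using integral_dominated_convergence[OF dc] by simp
  from order_tendstoD(2)[OF this e] obtain n where "(LINT x|lborel. (F x - G n x)\<^sup>2) < e"
    by (auto simp: eventually_sequentially)
  then show ?thesis using Gc G0 integrable_dominated_convergence2[OF dc] by blast
qed

text \<open>Reduction to bounded functions: the truncations at height \<open>n\<close> converge in square mean, dominated by
  \<open>F\<^sup>2\<close>.\<close>

lemma L2_approx_continuous:
  fixes F :: "'a::euclidean_space \<Rightarrow> real"
  assumes [measurable]: "F \<in> borel_measurable borel" and sq: "integrable lborel (\<lambda>x. (F x)\<^sup>2)"
    and supp: "\<And>x. R < norm x \<Longrightarrow> F x = 0" and e: "e > 0"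
  shows "\<exists>g. continuous_on UNIV g \<and> (\<forall>x. R + 1 < norm x \<longrightarrow> g x = 0) \<and>
     integrable lborel (\<lambda>x. (F x - g x)\<^sup>2) \<and> (LINT x|lborel. (F x - g x)\<^sup>2) < e"
proof -
  define T where "T n x = max (- real n) (min (real n) (F x))" for n x
  have Tm [measurable]: "T n \<in> borel_measurable borel" for n unfolding T_def by measurable
  have dle: "\<bar>F x - T n x\<bar> \<le> \<bar>F x\<bar>" for n x by (auto simp: T_def)
  have lim: "AE x in lborel. (\<lambda>n. (F x - T n x)\<^sup>2) \<longlonglongrightarrow> 0"
  proof (rule AE_I2)
    fix x
    obtain m where m: "\<bar>F x\<bar> \<le> real m" using real_arch_simple by blast
    have "(F x - T n x)\<^sup>2 = 0" if "n \<ge> m" for n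
    proof -
      have "\<bar>F x\<bar> \<le> real n" using m that by linarith
      then show ?thesis by (auto simp: T_def abs_le_iff)
    qed
    then show "(\<lambda>n. (F x - T n x)\<^sup>2) \<longlonglongrightarrow> 0"
      by (intro tendsto_eventually) (auto simp: eventually_sequentially)
  qed
  have dom: "AE x in lborel. norm ((F x - T n x)\<^sup>2) \<le> (F x)\<^sup>2" for n
    using dle by (intro AE_I2) (simp add: abs_le_square_iff)
  have meas: "(\<lambda>x. 0) \<in> borel_measurable lborel" "\<And>n. (\<lambda>x. (F x - T n x)\<^sup>2) \<in> borel_measurable lborel"
    by measurable
  note dc = meas sq lim dom
  have "(\<lambda>n. LINT x|lborel. (F x - T n x)\<^sup>2) \<longlonglongrightarrow> 0"
    using integral_dominated_convergence[OF dc] by simp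
  then have "\<forall>\<^sub>F n in sequentially. (LINT x|lborel. (F x - T n x)\<^sup>2) < e / 4"
    by (rule order_tendstoD(2)) (use e in simp)
  then obtain n where n: "(LINT x|lborel. (F x - T n x)\<^sup>2) < e / 4"
    by (auto simp: eventually_sequentially)
  have iT: "integrable lborel (\<lambda>x. (F x - T n x)\<^sup>2)" by (rule integrable_dominated_convergence2[OF dc])
  have "\<bar>T n x\<bar> \<le> real n" "R < norm x \<Longrightarrow> T n x = 0" for x using supp[of x] by (auto simp: T_def)
  then obtain g where g: "continuous_on UNIV g" "\<And>x. R + 1 < norm x \<Longrightarrow> g x = 0"
    "integrable lborel (\<lambda>x. (T n x - g x)\<^sup>2)" "(LINT x|lborel. (T n x - g x)\<^sup>2) < e / 4"
    using bounded_L2_approx_continuous[OF Tm, of n "real n" R "e / 4"] e by (auto simp: divide_pos_pos)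
  have [measurable]: "g \<in> borel_measurable borel" using g(1) by (rule borel_measurable_continuous_onI)
  have le: "(F x - g x)\<^sup>2 \<le> 2 * (F x - T n x)\<^sup>2 + 2 * (T n x - g x)\<^sup>2" for x
    using square_sum_le[of "F x - T n x" "T n x - g x"] by simp
  have i2: "integrable lborel (\<lambda>x. 2 * (F x - T n x)\<^sup>2 + 2 * (T n x - g x)\<^sup>2)" using iT g(3) by simp
  have i: "integrable lborel (\<lambda>x. (F x - g x)\<^sup>2)"
    by (rule Bochner_Integration.integrable_bound[OF i2]) (use le in \<open>auto intro!: AE_I2\<close>)
  have "(LINT x|lborel. (F x - g x)\<^sup>2) \<le> (LINT x|lborel. 2 * (F x - T n x)\<^sup>2 + 2 * (T n x - g x)\<^sup>2)"
    by (rule integral_mono[OF i i2 le])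
  also have "\<dots> = 2 * (LINT x|lborel. (F x - T n x)\<^sup>2) + 2 * (LINT x|lborel. (T n x - g x)\<^sup>2)"
    using iT g(3) by simp
  also have "\<dots> < e" using n g(4) by simp
  finally show ?thesis using g(1,2) i by blast
qed

lemma nn_integral_translation:
  fixes f :: "'a::euclidean_space \<Rightarrow> ennreal"
  assumes "f \<in> borel_measurable borel"
  shows "(\<integral>\<^sup>+x. f (c + x) \<partial>lborel) = (\<integral>\<^sup>+x. f x \<partial>lborel)"
  using nn_integral_distr[of "(+) c" lborel borel f] assms lborel_distr_plus[of c] by simp

lemma nn_integral_two_plus_indicator:
  assumes [measurable]: "f \<in> borel_measurable M" "g \<in> borel_measurable M" "A \<in> sets M"
  shows "(\<integral>\<^sup>+x. 4 * f x + 4 * g x + c * indicator A x \<partial>M)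
    = 4 * (\<integral>\<^sup>+x. f x \<partial>M) + 4 * (\<integral>\<^sup>+x. g x \<partial>M) + c * emeasure M A"
  by (simp add: nn_integral_add nn_integral_cmult)

text \<open>For a continuous function with compact support this is uniform continuity; the general case follows
  by approximation, since the square mean is translation invariant.\<close>

lemma L2_translation_continuous:
  fixes F :: "'a::euclidean_space \<Rightarrow> real"
  assumes [measurable]: "F \<in> borel_measurable borel" and sq: "integrable lborel (\<lambda>x. (F x)\<^sup>2)"
    and supp: "\<And>x. R < norm x \<Longrightarrow> F x = 0" and e: "e > 0"
  shows "\<exists>d>0. \<forall>y. norm y < d \<longrightarrow> (\<integral>\<^sup>+x. ennreal ((F (y + x) - F x)\<^sup>2) \<partial>lborel) \<le> ennreal e"
proof -
  have "e / 12 > 0" using e by simp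
  from L2_approx_continuous[OF assms(1) sq supp this] obtain g where g: "continuous_on UNIV g" "\<And>x. R + 1 < norm x \<Longrightarrow> g x = 0"
    "integrable lborel (\<lambda>x. (F x - g x)\<^sup>2)" "(LINT x|lborel. (F x - g x)\<^sup>2) < e / 12"
    by blast
  have [measurable]: "g \<in> borel_measurable borel" using g(1) by (rule borel_measurable_continuous_onI)
  \<comment> \<open>The oscillation \<open>m\<close> of \<open>g\<close> is chosen so that its contribution \<open>2 m\<^sup>2 V\<close> is at most \<open>e / 3\<close>; the two
    approximation errors contribute \<open>4 e / 12\<close> each.\<close>
  define V where "V = measure lborel (cball (0::'a) (R + 2))"
  define m where "m = sqrt (e / (6 * (V + 1)))"
  have V: "V \<ge> 0" by (simp add: V_def)
  have m: "m > 0" "m\<^sup>2 = e / (6 * (V + 1))" using e V by (auto simp: m_def)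
  have "uniformly_continuous_on (cball 0 (R + 3)) g"
    by (rule compact_uniformly_continuous) (use g(1) continuous_on_subset in auto)
  then obtain d where d: "d > 0" "\<And>x y. norm x \<le> R + 3 \<Longrightarrow> norm y \<le> R + 3 \<Longrightarrow> dist y x < d \<Longrightarrow> dist (g y) (g x) < m"
    using m(1) unfolding uniformly_continuous_on_def by (metis mem_cball_0)
  have "(\<integral>\<^sup>+x. ennreal ((F (y + x) - F x)\<^sup>2) \<partial>lborel) \<le> ennreal e" if y: "norm y < min d 1" for y
  proof -
    have gd: "(g (y + x) - g x)\<^sup>2 \<le> m\<^sup>2 * indicator (cball 0 (R + 2)) x" for x
    proof (cases "norm x \<le> R + 2")
      case True
      have "norm (y + x) \<le> R + 3" using norm_triangle_ineq[of y x] True y by simp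
      then have "\<bar>g (y + x) - g x\<bar> < m" using d(2)[of x "y + x"] True y by (auto simp: dist_norm)
      then have "\<bar>g (y + x) - g x\<bar>\<^sup>2 \<le> m\<^sup>2" by (intro power_mono) auto
      then show ?thesis using True by simp
    next
      case False
      have "norm x \<le> norm (y + x) + norm y" using norm_triangle_ineq4[of "y + x" y] by simp
      then have "R + 1 < norm (y + x)" using False y by simp
      then show ?thesis using g(2)[of x] g(2)[of "y + x"] False by simp
    qed
    have le: "(F (y + x) - F x)\<^sup>2 \<le> 4 * (F (y + x) - g (y + x))\<^sup>2 + 4 * (F x - g x)\<^sup>2 + 2 * (g (y + x) - g x)\<^sup>2" for x
    proof -
      have "(F (y + x) - F x)\<^sup>2 \<le> 2 * ((F (y + x) - g (y + x)) - (F x - g x))\<^sup>2 + 2 * (g (y + x) - g x)\<^sup>2"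
        using square_sum_le[of "(F (y + x) - g (y + x)) - (F x - g x)" "g (y + x) - g x"] by (simp add: algebra_simps)
      moreover have "((F (y + x) - g (y + x)) - (F x - g x))\<^sup>2 \<le> 2 * (F (y + x) - g (y + x))\<^sup>2 + 2 * (F x - g x)\<^sup>2"
        using square_sum_le[of "F (y + x) - g (y + x)" "- (F x - g x)"] by (simp add: power2_eq_square algebra_simps)
      ultimately show ?thesis by linarith
    qed
    let ?E = "\<integral>\<^sup>+x. ennreal ((F x - g x)\<^sup>2) \<partial>lborel"
    have E: "?E \<le> ennreal (e / 12)"
      using g(3,4) by (subst nn_integral_eq_integral) (auto simp: less_imp_le ennreal_leI)
    have "(\<integral>\<^sup>+x. ennreal ((F (y + x) - F x)\<^sup>2) \<partial>lborel)
        \<le> (\<integral>\<^sup>+x. 4 * ennreal ((F (y + x) - g (y + x))\<^sup>2) + 4 * ennreal ((F x - g x)\<^sup>2)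
             + ennreal (2 * m\<^sup>2) * indicator (cball 0 (R + 2)) x \<partial>lborel)"
    proof (rule nn_integral_mono)
      fix x
      have "(F (y + x) - F x)\<^sup>2 \<le> 4 * (F (y + x) - g (y + x))\<^sup>2 + 4 * (F x - g x)\<^sup>2 + 2 * m\<^sup>2 * indicator (cball 0 (R + 2)) x"
        using le[of x] gd[of x] by linarith
      then have "ennreal ((F (y + x) - F x)\<^sup>2) \<le> ennreal (4 * (F (y + x) - g (y + x))\<^sup>2 + 4 * (F x - g x)\<^sup>2 + 2 * m\<^sup>2 * indicator (cball 0 (R + 2)) x)"
        by (rule ennreal_leI)
      also have "\<dots> = 4 * ennreal ((F (y + x) - g (y + x))\<^sup>2) + 4 * ennreal ((F x - g x)\<^sup>2)
             + ennreal (2 * m\<^sup>2) * indicator (cball 0 (R + 2)) x"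
        by (simp add: ennreal_plus ennreal_mult ennreal_indicator)
      finally show "ennreal ((F (y + x) - F x)\<^sup>2) \<le> 4 * ennreal ((F (y + x) - g (y + x))\<^sup>2) + 4 * ennreal ((F x - g x)\<^sup>2)
             + ennreal (2 * m\<^sup>2) * indicator (cball 0 (R + 2)) x" .
    qed
    also have "\<dots> = 4 * (\<integral>\<^sup>+x. ennreal ((F (y + x) - g (y + x))\<^sup>2) \<partial>lborel) + 4 * ?E
        + ennreal (2 * m\<^sup>2) * emeasure lborel (cball (0::'a) (R + 2))"
      by (rule nn_integral_two_plus_indicator) auto
    also have "(\<integral>\<^sup>+x. ennreal ((F (y + x) - g (y + x))\<^sup>2) \<partial>lborel) = ?E"
      by (rule nn_integral_translation[of "\<lambda>x. ennreal ((F x - g x)\<^sup>2)"]) measurable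
    also have "emeasure lborel (cball (0::'a) (R + 2)) = ennreal V"
      unfolding V_def using emeasure_lborel_cball_finite[of "0::'a" "R + 2"] by (intro emeasure_eq_ennreal_measure) auto
    also have "4 * ?E + 4 * ?E + ennreal (2 * m\<^sup>2) * ennreal V \<le> 4 * ennreal (e / 12) + 4 * ennreal (e / 12) + ennreal (2 * m\<^sup>2) * ennreal V"
      by (intro add_mono mult_left_mono E) auto
    also have "\<dots> = ennreal (4 * (e / 12) + 4 * (e / 12) + 2 * m\<^sup>2 * V)"
    proof -
      have "4 * ennreal (e / 12) = ennreal (4 * (e / 12))"
        using ennreal_mult[of 4 "e / 12"] e by (simp only: ennreal_numeral zero_le_numeral)
      moreover have "ennreal (2 * m\<^sup>2) * ennreal V = ennreal (2 * m\<^sup>2 * V)"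
        using V by (intro ennreal_mult[symmetric]) auto
      ultimately show ?thesis using e V by (simp add: ennreal_plus[symmetric] del: ennreal_plus)
    qed
    also have "\<dots> \<le> ennreal e"
    proof (rule ennreal_leI)
      have "2 * m\<^sup>2 * V \<le> e / 3" unfolding m(2) using e V by (simp add: field_simps)
      then show "4 * (e / 12) + 4 * (e / 12) + 2 * m\<^sup>2 * V \<le> e" by simp
    qed
    finally show ?thesis .
  qed
  then show ?thesis using d(1) by (intro exI[of _ "min d 1"]) auto
qed

section \<open>Mollification\<close>

text \<open>Jensen's inequality for the square, obtained from Cauchy--Schwarz by writing
  \<open>\<bar>f\<bar> k = (\<bar>f\<bar> \<surd>k) \<surd>k\<close>.\<close>

lemma square_average_le:
  assumes [measurable]: "f \<in> borel_measurable M" "k \<in> borel_measurable M" and k: "\<And>x. k x \<ge> (0::real)"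
    and k1: "(\<integral>\<^sup>+x. ennreal (k x) \<partial>M) = 1"
  shows "ennreal ((LINT x|M. f x * k x)\<^sup>2) \<le> (\<integral>\<^sup>+x. ennreal ((f x)\<^sup>2 * k x) \<partial>M)"
proof -
  have "ennreal \<bar>LINT x|M. f x * k x\<bar> \<le> (\<integral>\<^sup>+x. ennreal \<bar>f x * k x\<bar> \<partial>M)"
    using integral_norm_bound_ennreal[of M "\<lambda>x. f x * k x"]
    by (cases "integrable M (\<lambda>x. f x * k x)") (auto simp: not_integrable_integral_eq)
  also have "\<dots> = (\<integral>\<^sup>+x. ennreal (\<bar>f x\<bar> * sqrt (k x)) * ennreal (sqrt (k x)) \<partial>M)"
    using k by (intro nn_integral_cong) (simp add: ennreal_mult[symmetric] abs_mult mult.assoc)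
  finally have "(ennreal \<bar>LINT x|M. f x * k x\<bar>)\<^sup>2 \<le> (\<integral>\<^sup>+x. ennreal (\<bar>f x\<bar> * sqrt (k x)) * ennreal (sqrt (k x)) \<partial>M)\<^sup>2"
    by (intro power_mono) auto
  also have "\<dots> \<le> (\<integral>\<^sup>+x. (ennreal (\<bar>f x\<bar> * sqrt (k x)))\<^sup>2 \<partial>M) * (\<integral>\<^sup>+x. (ennreal (sqrt (k x)))\<^sup>2 \<partial>M)"
    by (rule Cauchy_Schwarz_nn_integral) measurable
  also have "\<dots> = (\<integral>\<^sup>+x. ennreal ((f x)\<^sup>2 * k x) \<partial>M)"
    using k k1 by (simp add: ennreal_power power_mult_distrib)
  finally show ?thesis by (simp add: ennreal_power)
qed

definition kernel_mass :: "real \<Rightarrow> real" where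
  "kernel_mass r = (LINT y::real^2|lborel. std_bump r (y$1) * std_bump r (y$2))"

text \<open>Only one of the two factors of the kernel carries the normalizing constant, so that
  \<open>unit_bump r \<otimes> std_bump r\<close> has total mass one.\<close>

definition unit_bump :: "real \<Rightarrow> real \<Rightarrow> real" where
  "unit_bump r t = inverse (kernel_mass r) * std_bump r t"

lemma std_bump_uminus: "std_bump r (- t) = std_bump r t"
  by (simp add: std_bump_def mult.commute)

lemma integrable_product_kernel:
  assumes ab: "bump r a" "bump r b"
  shows "integrable lborel (\<lambda>y::real^2. a (y$1) * b (y$2))"
proof -
  have "continuous_on UNIV (\<lambda>y::real^2. a (y$1) * b (y$2))"
    by (intro continuous_intros continuous_on_compose2[OF bump_continuous[OF ab(1), of UNIV]]
         continuous_on_compose2[OF bump_continuous[OF ab(2), of UNIV]]) auto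
  then have "integrable lborel (\<lambda>y::real^2. indicator (cball 0 (2 * r)) y *\<^sub>R (a (y$1) * b (y$2)))"
    by (intro borel_integrable_compact) (auto intro: continuous_on_subset)
  moreover have "(\<lambda>y::real^2. indicator (cball 0 (2 * r)) y *\<^sub>R (a (y$1) * b (y$2))) = (\<lambda>y. a (y$1) * b (y$2))"
  proof
    fix y :: "real^2"
    show "indicator (cball 0 (2 * r)) y *\<^sub>R (a (y$1) * b (y$2)) = a (y$1) * b (y$2)"
    proof (cases "norm y \<le> 2 * r")
      case False
      then have "r \<le> \<bar>y$1\<bar> \<or> r \<le> \<bar>y$2\<bar>" using norm_vec2_le[of y] by linarith
      then show ?thesis using bump_eq_0[OF ab(1)] bump_eq_0[OF ab(2)] by auto
    qed simp
  qed
  ultimately show ?thesis by simp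
qed

lemma kernel_mass_pos: "r > 0 \<Longrightarrow> kernel_mass r > 0"
proof -
  assume r: "r > 0"
  let ?k = "\<lambda>y::real^2. std_bump r (y$1) * std_bump r (y$2)"
  have i: "integrable lborel ?k" by (rule integrable_product_kernel[OF bump_std_bump bump_std_bump])
  have nn: "?k y \<ge> 0" for y by (simp add: std_bump_nonneg)
  have "kernel_mass r \<noteq> 0"
  proof
    assume "kernel_mass r = 0"
    then have "AE y in lborel. ?k y = 0"
      using integral_nonneg_eq_0_iff_AE[OF i] nn by (simp add: kernel_mass_def)
    then have "AE y in lborel. y \<notin> ball (0::real^2) r"
    proof eventually_elim
      case (elim y)
      then have "\<not> (\<bar>y$1\<bar> < r \<and> \<bar>y$2\<bar> < r)" using std_bump_pos[of "y$1" r] std_bump_pos[of "y$2" r] by force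
      then show ?case using component_le_norm_cart[of y 1] component_le_norm_cart[of y 2] by auto
    qed
    then have "emeasure lborel (ball (0::real^2) r) = 0" by (subst (asm) AE_iff_measurable[where N = "ball 0 r"]) auto
    moreover have "\<not> negligible (ball (0::real^2) r)" using r open_not_negligible[of "ball (0::real^2) r"] by simp
    ultimately show False by (simp add: negligible_iff_emeasure0 emeasure_completion)
  qed
  moreover have "kernel_mass r \<ge> 0" unfolding kernel_mass_def using nn by simp
  ultimately show ?thesis by simp
qed

lemma bump_unit_bump: "bump r (unit_bump r)"
  unfolding unit_bump_def[abs_def] by (rule bump_cmult[OF bump_std_bump])

lemma unit_bump_nonneg: "r > 0 \<Longrightarrow> unit_bump r t \<ge> 0"
  using kernel_mass_pos[of r] by (simp add: unit_bump_def std_bump_nonneg)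

lemma integral_unit_kernel:
  assumes "r > 0"
  shows "(LINT y::real^2|lborel. unit_bump r (y$1) * std_bump r (y$2)) = 1"
  using kernel_mass_pos[OF assms] integrable_product_kernel[OF bump_std_bump[of r] bump_std_bump[of r]]
  by (simp add: unit_bump_def mult.assoc kernel_mass_def[symmetric])

definition mollify :: "real \<Rightarrow> (real^2 \<Rightarrow> real) \<Rightarrow> real^2 \<Rightarrow> real" where
  "mollify r F = smear lborel F (\<lambda>y. y) (unit_bump r) (std_bump r)"

lemma unit_kernel_reflected:
  fixes x :: "real^2"
  assumes "r > 0"
  defines "k \<equiv> \<lambda>y::real^2. unit_bump r (x$1 - y$1) * std_bump r (x$2 - y$2)"
  shows "\<And>y. k y \<ge> 0" "integrable lborel k" "(LINT y|lborel. k y) = 1" "\<And>y. k y \<noteq> 0 \<Longrightarrow> dist x y < 2 * r"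
    "k (z + x) = unit_bump r (z$1) * std_bump r (z$2)"
proof -
  let ?q = "\<lambda>y::real^2. unit_bump r (y$1) * std_bump r (y$2)"
  have sym: "unit_bump r (- t) = unit_bump r t" for t by (simp add: unit_bump_def std_bump_uminus)
  have eq: "k y = ?q (- x + y)" for y
    using sym[of "x$1 - y$1"] std_bump_uminus[of r "x$2 - y$2"] by (simp add: k_def)
  show "k y \<ge> 0" for y using assms(1) by (simp add: k_def unit_bump_nonneg std_bump_nonneg)
  have i: "integrable lborel ?q" by (rule integrable_product_kernel[OF bump_unit_bump bump_std_bump])
  then have [measurable]: "?q \<in> borel_measurable borel" by (simp add: borel_measurable_integrable)
  show "integrable lborel k" unfolding eq by (rule lborel_integrable_translation[OF i])
  show "(LINT y|lborel. k y) = 1"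
    unfolding eq using lborel_integral_translation[of ?q "- x"] integral_unit_kernel[OF assms(1)] by simp
  show "dist x y < 2 * r" if "k y \<noteq> 0" for y
  proof -
    have "\<bar>x$1 - y$1\<bar> < r" "\<bar>x$2 - y$2\<bar> < r"
      using that bump_eq_0[OF bump_unit_bump, of r "x$1 - y$1"] bump_eq_0[OF bump_std_bump, of r "x$2 - y$2"]
      by (auto simp: k_def not_le[symmetric])
    then show ?thesis using norm_vec2_le[of "x - y"] by (simp add: dist_norm)
  qed
  show "k (z + x) = ?q z" by (simp add: eq)
qed

text \<open>Used twice: for the uniform convergence of mollifications, and to show that the averages of \<open>v\<close> against
  the smoothed Jacobian recover \<open>v \<circ> u\<^sup>-\<^sup>1\<close>.\<close>

lemma weighted_average_close:
  fixes f k :: "'a \<Rightarrow> real"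
  assumes k: "AE x in M. k x \<ge> 0" "integrable M k" and fk: "integrable M (\<lambda>x. f x * k x)"
    and close: "\<And>x. x \<in> space M \<Longrightarrow> k x \<noteq> 0 \<Longrightarrow> \<bar>f x - c\<bar> \<le> e"
  shows "\<bar>(LINT x|M. f x * k x) - c * (LINT x|M. k x)\<bar> \<le> e * (LINT x|M. k x)"
proof -
  have "(LINT x|M. f x * k x) - c * (LINT x|M. k x) = (LINT x|M. f x * k x - c * k x)" using k fk by simp
  then have "\<bar>(LINT x|M. f x * k x) - c * (LINT x|M. k x)\<bar> \<le> (LINT x|M. \<bar>f x * k x - c * k x\<bar>)"
    using integral_norm_bound[of M "\<lambda>x. f x * k x - c * k x"] by simp
  also have "\<dots> \<le> (LINT x|M. e * k x)"
  proof (rule integral_mono_AE)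
    show "AE x in M. \<bar>f x * k x - c * k x\<bar> \<le> e * k x"
      using k(1) AE_space
    proof eventually_elim
      case (elim x)
      have "f x * k x - c * k x = (f x - c) * k x" by (simp add: algebra_simps)
      then show ?case using elim close[of x] by (cases "k x = 0") (auto simp: abs_mult intro!: mult_right_mono)
    qed
  qed (use k fk in auto)
  also have "\<dots> = e * (LINT x|M. k x)" by simp
  finally show ?thesis .
qed

text \<open>The difference of the mollification and \<open>F\<close> is an average of the differences between \<open>F\<close> and its
  translates by less than \<open>2 r\<close>. Jensen's inequality and Tonelli's theorem bound its square mean by
  the largest one of these differences.\<close>

lemma mollify_L2:
  fixes F :: "real^2 \<Rightarrow> real"
  assumes [measurable]: "F \<in> borel_measurable borel" and sq: "integrable lborel (\<lambda>x. (F x)\<^sup>2)" and int: "integrable lborel F"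
    and supp: "\<And>x. R < norm x \<Longrightarrow> F x = 0" and e: "e > 0"
  shows "\<exists>d>0. \<forall>r. 0 < r \<and> r < d \<longrightarrow> (\<integral>\<^sup>+x. ennreal ((mollify r F x - F x)\<^sup>2) \<partial>lborel) \<le> ennreal e"
proof -
  from L2_translation_continuous[OF assms(1) sq supp e] obtain d where d: "d > 0"
    "\<And>y. norm y < d \<Longrightarrow> (\<integral>\<^sup>+x. ennreal ((F (y + x) - F x)\<^sup>2) \<partial>lborel) \<le> ennreal e" by blast
  have "(\<integral>\<^sup>+x. ennreal ((mollify r F x - F x)\<^sup>2) \<partial>lborel) \<le> ennreal e" if r: "0 < r" "2 * r < d" for r
  proof -
    let ?q = "\<lambda>y::real^2. unit_bump r (y$1) * std_bump r (y$2)"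
    let ?k = "\<lambda>(x::real^2) y::real^2. unit_bump r (x$1 - y$1) * std_bump r (x$2 - y$2)"
    note k = unit_kernel_reflected[OF r(1)]
    have i0: "integrable lborel ?q" by (rule integrable_product_kernel[OF bump_unit_bump bump_std_bump])
    then have m0 [measurable]: "?q \<in> borel_measurable borel" by (simp add: borel_measurable_integrable)
    have nn0: "?q z \<ge> 0" for z using r by (simp add: unit_bump_nonneg std_bump_nonneg)
    have k0: "(\<integral>\<^sup>+z. ennreal (?q z) \<partial>lborel) = 1"
      using nn_integral_eq_integral[OF i0] nn0 integral_unit_kernel[OF r(1)] by simp
    have "ennreal ((mollify r F x - F x)\<^sup>2) \<le> (\<integral>\<^sup>+z. ennreal ((F (z + x) - F x)\<^sup>2 * ?q z) \<partial>lborel)" for x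
    proof -
      have km [measurable]: "?k x \<in> borel_measurable borel" using k(2)[of x] by (simp add: borel_measurable_integrable)
      have "integrable lborel (\<lambda>y. F y * ?k x y)"
        using integrable_smear[OF int _ bump_unit_bump bump_std_bump, where h = "\<lambda>y. y" and w = x and r = r] by simp
      then have "mollify r F x - F x = (LINT y|lborel. (F y - F x) * ?k x y)"
        using k(2,3)[of x] unfolding mollify_def smear_def by (simp add: left_diff_distrib)
      moreover have "(\<integral>\<^sup>+y. ennreal (?k x y) \<partial>lborel) = 1"
        using nn_integral_eq_integral[OF k(2)[of x]] k(1,3)[of x] by simp
      ultimately have "ennreal ((mollify r F x - F x)\<^sup>2) \<le> (\<integral>\<^sup>+y. ennreal ((F y - F x)\<^sup>2 * ?k x y) \<partial>lborel)"
        using square_average_le[of "\<lambda>y. F y - F x" lborel "?k x"] k(1)[of x] by simp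
      also have "\<dots> = (\<integral>\<^sup>+z. ennreal ((F (x + z) - F x)\<^sup>2 * ?k x (x + z)) \<partial>lborel)"
        by (rule nn_integral_translation[symmetric]) measurable
      also have "\<dots> = (\<integral>\<^sup>+z. ennreal ((F (z + x) - F x)\<^sup>2 * ?q z) \<partial>lborel)"
        using k(5)[of x] by (intro nn_integral_cong) (simp only: add.commute)
      finally show ?thesis .
    qed
    then have "(\<integral>\<^sup>+x. ennreal ((mollify r F x - F x)\<^sup>2) \<partial>lborel)
       \<le> (\<integral>\<^sup>+x. (\<integral>\<^sup>+z. ennreal ((F (z + x) - F x)\<^sup>2 * ?q z) \<partial>lborel) \<partial>lborel)"
      by (rule nn_integral_mono)
    also have "\<dots> = (\<integral>\<^sup>+z. (\<integral>\<^sup>+x. ennreal ((F (z + x) - F x)\<^sup>2 * ?q z) \<partial>lborel) \<partial>lborel)"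
      by (rule lborel_pair.Fubini') measurable
    also have "\<dots> \<le> (\<integral>\<^sup>+z. ennreal e * ennreal (?q z) \<partial>lborel)"
    proof (rule nn_integral_mono)
      fix z :: "real^2"
      have "(\<integral>\<^sup>+x. ennreal ((F (z + x) - F x)\<^sup>2 * ?q z) \<partial>lborel) = (\<integral>\<^sup>+x. ennreal ((F (z + x) - F x)\<^sup>2) \<partial>lborel) * ennreal (?q z)"
        using nn0[of z] by (simp add: ennreal_mult nn_integral_multc)
      also have "\<dots> \<le> ennreal e * ennreal (?q z)"
      proof (cases "?q z = 0")
        case False
        then have "?k 0 (z + 0) \<noteq> 0" unfolding k(5) .
        from k(4)[OF this] have "norm z < 2 * r" by simp
        then show ?thesis using d(2)[of z] r by (intro mult_right_mono) auto
      qed auto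
      finally show "(\<integral>\<^sup>+x. ennreal ((F (z + x) - F x)\<^sup>2 * ?q z) \<partial>lborel) \<le> ennreal e * ennreal (?q z)" .
    qed
    also have "\<dots> = ennreal e" using k0 by (simp add: nn_integral_cmult)
    finally show ?thesis .
  qed
  then show ?thesis using d(1) by (intro exI[of _ "d / 2"]) auto
qed

section \<open>Smooth approximation of Sobolev functions\<close>

text \<open>The second and third conditions share the function \<open>f12\<close>: the symmetry of the second derivatives is
  built in, which is all that the closedness of \<open>df\<close> amounts to.\<close>

definition C2_bounded :: "(real^2 \<Rightarrow> real) \<Rightarrow> (real^2 \<Rightarrow> real) \<Rightarrow> (real^2 \<Rightarrow> real) \<Rightarrow> bool" where
  "C2_bounded f f1 f2 \<longleftrightarrow> (\<exists>f11 f12 f22.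
     (\<forall>g\<in>{f, f1, f2, f11, f12, f22}. bounded (range g)) \<and>
     (\<forall>x. (f has_derivative (\<lambda>h. f1 x * h$1 + f2 x * h$2)) (at x)) \<and>
     (\<forall>x. (f1 has_derivative (\<lambda>h. f11 x * h$1 + f12 x * h$2)) (at x)) \<and>
     (\<forall>x. (f2 has_derivative (\<lambda>h. f12 x * h$1 + f22 x * h$2)) (at x)))"

lemma C2_bounded_smear:
  fixes h :: "'a \<Rightarrow> real^2"
  assumes G: "integrable M G" and h: "h \<in> borel_measurable M" and ab: "bump r a" "bump r b"
  shows "C2_bounded (smear M G h a b) (smear M G h (deriv a) b) (smear M G h a (deriv b))"
proof -
  note d = bump_deriv[OF ab(1)] bump_deriv[OF ab(2)]
  note dd = bump_deriv[OF d(1)] bump_deriv[OF d(2)]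
  show ?thesis
    unfolding C2_bounded_def
    by (rule exI[of _ "smear M G h (deriv (deriv a)) b"], rule exI[of _ "smear M G h (deriv a) (deriv b)"],
        rule exI[of _ "smear M G h a (deriv (deriv b))"])
      (use bounded_smear[OF G h] has_derivative_smear[OF G h] ab d dd in blast)
qed

text \<open>The part of being a continuous function with square integrable weak gradient \<open>(D1, D2)\<close> that is
  needed for integration by parts. Unlike the weak formulation it concerns \<open>Q\<close> alone, and constants
  satisfy it trivially.\<close>

definition sobolev_approximable :: "(real^2) set \<Rightarrow> (real^2 \<Rightarrow> real) \<Rightarrow> (real^2 \<Rightarrow> real) \<Rightarrow> (real^2 \<Rightarrow> real) \<Rightarrow> bool" where
  "sobolev_approximable Q f D1 D2 \<longleftrightarrow>
     D1 \<in> borel_measurable (lebesgue_on Q) \<and> integrable (lebesgue_on Q) (\<lambda>x. (D1 x)\<^sup>2) \<and>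
     D2 \<in> borel_measurable (lebesgue_on Q) \<and> integrable (lebesgue_on Q) (\<lambda>x. (D2 x)\<^sup>2) \<and>
     (\<exists>p p1 p2. (\<forall>n::nat. C2_bounded (p n) (p1 n) (p2 n)) \<and> uniform_limit Q p f sequentially \<and>
        (\<lambda>n. LINT x|lebesgue_on Q. (p1 n x - D1 x)\<^sup>2) \<longlonglongrightarrow> 0 \<and>
        (\<lambda>n. LINT x|lebesgue_on Q. (p2 n x - D2 x)\<^sup>2) \<longlonglongrightarrow> 0)"

lemma sobolev_approximable_const: "sobolev_approximable Q (\<lambda>_. c) (\<lambda>_. 0) (\<lambda>_. 0)"
proof -
  have "C2_bounded (\<lambda>_. c) (\<lambda>_. 0) (\<lambda>_. 0)"
    unfolding C2_bounded_def by (intro exI[of _ "\<lambda>_. 0"]) auto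
  then show ?thesis
    unfolding sobolev_approximable_def
    by (intro conjI exI[of _ "\<lambda>n x. c"] exI[of _ "\<lambda>n x. 0"]) (auto intro: uniform_limit_const)
qed

text \<open>Passing from the completed measure to a Borel representative allows the use of Tonelli's theorem in
  the product space.\<close>

lemma borel_cutoff_exists:
  fixes D :: "real^2 \<Rightarrow> real"
  assumes D: "D \<in> borel_measurable (lebesgue_on (cball z R))" "integrable (lebesgue_on (cball z R)) (\<lambda>x. (D x)\<^sup>2)"
  shows "\<exists>G\<in>borel_measurable borel. integrable lborel G \<and> integrable lborel (\<lambda>x. (G x)\<^sup>2) \<and>
    (\<forall>x. x \<notin> cball z R \<longrightarrow> G x = 0) \<and> (AE x in lebesgue. x \<in> cball z R \<longrightarrow> D x = G x)"
proof -
  let ?Q = "cball z R"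
  have mD: "(\<lambda>x. indicator ?Q x *\<^sub>R D x) \<in> borel_measurable lebesgue"
    using D(1) by (subst (asm) borel_measurable_restrict_space_iff) auto
  have iD: "integrable lebesgue (\<lambda>x. indicator ?Q x *\<^sub>R (D x)\<^sup>2)"
    using D(2) by (subst (asm) integrable_restrict_space) auto
  from completion_ex_borel_measurable_real[OF mD] obtain H where
    H [measurable]: "H \<in> borel_measurable lborel" and ae: "AE x in lborel. indicator ?Q x *\<^sub>R D x = H x" by blast
  define G where "G x = indicator ?Q x * H x" for x
  have Gm [measurable]: "G \<in> borel_measurable lborel" unfolding G_def
    by (intro borel_measurable_times borel_measurable_indicator H) auto
  have ae': "AE x in lebesgue. indicator ?Q x *\<^sub>R D x = H x" using ae by (rule AE_completion)
  have "integrable lebesgue (\<lambda>x. (G x)\<^sup>2)"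
  proof (rule integrable_cong_AE_imp[OF iD])
    show "(\<lambda>x. (G x)\<^sup>2) \<in> borel_measurable lebesgue" by (rule measurable_completion) measurable
    show "AE x in lebesgue. indicator ?Q x *\<^sub>R (D x)\<^sup>2 = (G x)\<^sup>2"
      using ae' by eventually_elim (auto simp: G_def indicator_def)
  qed
  then have G2: "integrable lborel (\<lambda>x. (G x)\<^sup>2)" by (subst (asm) integrable_completion) auto
  have "integrable lborel (\<lambda>x. (G x)\<^sup>2 + indicator ?Q x)"
    using G2 emeasure_lborel_cball_finite[of z R]
    by (intro Bochner_Integration.integrable_add integrable_real_indicator) auto
  then have "integrable lborel G"
  proof (rule Bochner_Integration.integrable_bound)
    have "\<bar>t\<bar> \<le> t\<^sup>2 + 1" for t :: real
    proof -
      have "2 * \<bar>t\<bar> * 1 \<le> \<bar>t\<bar>\<^sup>2 + 1\<^sup>2" by (rule sum_squares_bound)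
      then show ?thesis using abs_ge_zero[of t] by (simp del: abs_ge_zero)
    qed
    then show "AE x in lborel. norm (G x) \<le> norm ((G x)\<^sup>2 + indicator ?Q x)"
      by (intro AE_I2) (auto simp: G_def indicator_def)
  qed simp
  moreover have "AE x in lebesgue. x \<in> ?Q \<longrightarrow> D x = G x"
    using ae' by eventually_elim (auto simp: G_def)
  ultimately show ?thesis using G2 Gm by (intro bexI[of _ G]) (auto simp: G_def)
qed

lemma set_integral_cutoff:
  fixes D \<psi> G :: "real^2 \<Rightarrow> real"
  assumes [measurable]: "G \<in> borel_measurable borel" "\<psi> \<in> borel_measurable borel" and Q: "Q \<subseteq> \<Omega>" "Q \<in> sets lebesgue"
    and D: "D \<in> borel_measurable (lebesgue_on Q)"
    and \<psi>: "\<And>y. y \<notin> Q \<Longrightarrow> \<psi> y = 0" and ae: "AE y in lebesgue. y \<in> Q \<longrightarrow> D y = G y"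
  shows "(LINT y:\<Omega>|lebesgue. D y * \<psi> y) = (LINT y|lborel. G y * \<psi> y)"
proof -
  have m: "(\<lambda>y. G y * \<psi> y) \<in> borel_measurable lborel" by measurable
  have "(LINT y:\<Omega>|lebesgue. D y * \<psi> y) = (LINT y|lebesgue. G y * \<psi> y)"
    unfolding set_lebesgue_integral_def
  proof (rule integral_cong_AE)
    have eq: "AE y in lebesgue. indicator \<Omega> y *\<^sub>R (D y * \<psi> y) = G y * \<psi> y"
      using ae
    proof eventually_elim
      case (elim y)
      then show ?case using \<psi>[of y] Q by (cases "y \<in> Q") auto
    qed
    show m': "(\<lambda>y. G y * \<psi> y) \<in> borel_measurable lebesgue" by (rule measurable_completion[OF m])
    show "(\<lambda>y. indicator \<Omega> y *\<^sub>R (D y * \<psi> y)) \<in> borel_measurable lebesgue"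
    proof -
      have "(\<lambda>y. indicator Q y *\<^sub>R D y) \<in> borel_measurable lebesgue"
        using D Q(2) by (subst (asm) borel_measurable_restrict_space_iff) auto
      moreover have "\<psi> \<in> borel_measurable lebesgue" by (rule measurable_completion) simp
      ultimately have "(\<lambda>y. indicator Q y *\<^sub>R D y * \<psi> y) \<in> borel_measurable lebesgue"
        by (rule borel_measurable_times)
      moreover have "(\<lambda>y. indicator Q y *\<^sub>R D y * \<psi> y) = (\<lambda>y. indicator \<Omega> y *\<^sub>R (D y * \<psi> y))"
      proof
        show "indicator Q y *\<^sub>R D y * \<psi> y = indicator \<Omega> y *\<^sub>R (D y * \<psi> y)" for y
          using \<psi>[of y] Q by (cases "y \<in> Q") auto
      qed
      ultimately show ?thesis by simp
    qed
    show "AE y in lebesgue. indicator \<Omega> y *\<^sub>R (D y * \<psi> y) = G y * \<psi> y" by (rule eq)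
  qed
  also have "\<dots> = (LINT y|lborel. G y * \<psi> y)" by (rule integral_completion[OF m])
  finally show ?thesis .
qed

lemma product_kernel_eq_0:
  fixes x y :: "real^2"
  assumes ab: "bump r a" "bump r b" and "2 * r \<le> dist x y"
  shows "a (x$1 - y$1) * b (x$2 - y$2) = 0"
proof -
  have "r \<le> \<bar>x$1 - y$1\<bar> \<or> r \<le> \<bar>x$2 - y$2\<bar>"
    using norm_vec2_le[of "x - y"] assms(3) by (auto simp: dist_norm)
  then show ?thesis using bump_eq_0[OF ab(1)] bump_eq_0[OF ab(2)] by auto
qed

lemma borel_measurable_reflected_kernel:
  fixes x :: "real^2"
  assumes "bump r a" "bump r b"
  shows "(\<lambda>y::real^2. a (x$1 - y$1) * b (x$2 - y$2)) \<in> borel_measurable borel"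
  by (intro borel_measurable_continuous_onI continuous_at_imp_continuous_on ballI
      has_derivative_continuous[OF has_derivative_reflected_kernel[OF assms]])

text \<open>The reflected kernel \<open>y \<mapsto> a(x\<^sub>1 - y\<^sub>1) b(x\<^sub>2 - y\<^sub>2)\<close> is a test function in \<open>y\<close>. Its derivative in
  \<open>y\<close> is minus the derivative in \<open>x\<close>, so the defining identity of weak derivatives says that
  differentiating the convolution of \<open>X\<close> gives the convolution of \<open>D\<close>.\<close>

lemma smear_weak_partial:
  fixes X D F G :: "real^2 \<Rightarrow> real" and x :: "real^2"
  assumes F: "F \<in> borel_measurable borel" and G: "G \<in> borel_measurable borel"
    and Q: "cball z R \<subseteq> \<Omega>" and sub: "cball x (2 * r) \<subseteq> cball z R"
    and X: "X \<in> borel_measurable (lebesgue_on (cball z R))" "AE y in lebesgue. y \<in> cball z R \<longrightarrow> X y = F y"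
    and D: "D \<in> borel_measurable (lebesgue_on (cball z R))" "AE y in lebesgue. y \<in> cball z R \<longrightarrow> D y = G y"
    and weak: "\<And>\<phi>. test_function \<Omega> \<phi> \<Longrightarrow>
      (LINT y:\<Omega>|lebesgue. X y * partial_deriv j \<phi> y) = - (LINT y:\<Omega>|lebesgue. D y * \<phi> y)"
    and ab: "bump r a" "bump r b"
  shows "j = 1 \<Longrightarrow> smear lborel F (\<lambda>y. y) (deriv a) b x = smear lborel G (\<lambda>y. y) a b x"
    and "j = 2 \<Longrightarrow> smear lborel F (\<lambda>y. y) a (deriv b) x = smear lborel G (\<lambda>y. y) a b x"
proof -
  define \<phi> where "\<phi> = (\<lambda>y::real^2. a (x$1 - y$1) * b (x$2 - y$2))"
  have tf: "test_function \<Omega> \<phi>"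
    unfolding \<phi>_def using Q sub by (intro test_function_kernel[OF ab]) auto
  have far: "2 * r \<le> dist x y" if "y \<notin> cball z R" for y
  proof (rule ccontr)
    assume "\<not> 2 * r \<le> dist x y"
    then have "y \<in> cball x (2 * r)" by simp
    then show False using that sub by blast
  qed
  have \<phi>m: "\<phi> \<in> borel_measurable borel" unfolding \<phi>_def by (rule borel_measurable_reflected_kernel[OF ab])
  have \<phi>0: "\<phi> y = 0" if "y \<notin> cball z R" for y
    unfolding \<phi>_def by (rule product_kernel_eq_0[OF ab far[OF that]])
  have rhs: "(LINT y:\<Omega>|lebesgue. D y * \<phi> y) = smear lborel G (\<lambda>y. y) a b x"
    unfolding set_integral_cutoff[OF G \<phi>m Q _ D(1) \<phi>0 D(2), simplified] by (simp add: smear_def \<phi>_def)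
  have lhs: "(LINT y:\<Omega>|lebesgue. X y * partial_deriv j \<phi> y) = - smear lborel F (\<lambda>y. y) a' b' x"
    if pd: "partial_deriv j \<phi> = (\<lambda>y. - (a' (x$1 - y$1) * b' (x$2 - y$2)))" and ab': "bump r a'" "bump r b'" for a' b'
  proof -
    have m: "partial_deriv j \<phi> \<in> borel_measurable borel"
      unfolding pd by (intro borel_measurable_uminus borel_measurable_reflected_kernel[OF ab'])
    have z: "partial_deriv j \<phi> y = 0" if "y \<notin> cball z R" for y
      unfolding pd using product_kernel_eq_0[OF ab' far[OF that]] by simp
    show ?thesis
      unfolding set_integral_cutoff[OF F m Q _ X(1) z X(2), simplified] by (simp add: smear_def pd)
  qed
  note pd = partial_deriv_eqI[OF has_derivative_reflected_kernel[OF ab, of x], folded \<phi>_def]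
  show "smear lborel F (\<lambda>y. y) (deriv a) b x = smear lborel G (\<lambda>y. y) a b x" if j: "j = 1"
    using lhs[of "deriv a" b] weak[OF tf] rhs pd(1) j bump_deriv[OF ab(1)] ab by simp
  show "smear lborel F (\<lambda>y. y) a (deriv b) x = smear lborel G (\<lambda>y. y) a b x" if j: "j = 2"
    using lhs[of a "deriv b"] weak[OF tf] rhs pd(2) j bump_deriv[OF ab(2)] ab by simp
qed

lemma mollify_tendsto_L2:
  fixes G D :: "real^2 \<Rightarrow> real"
  assumes G: "G \<in> borel_measurable borel" "integrable lborel G" "integrable lborel (\<lambda>x. (G x)\<^sup>2)"
    and supp: "\<And>x. x \<notin> cball z R \<Longrightarrow> G x = 0"
    and Q: "Q \<in> sets lebesgue" and ae: "AE x in lebesgue. x \<in> Q \<longrightarrow> D x = G x"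
    and D: "D \<in> borel_measurable (lebesgue_on Q)" and p: "\<And>n. p n \<in> borel_measurable (lebesgue_on Q)"
    and eq: "\<And>n x. x \<in> Q \<Longrightarrow> p n x = mollify (\<rho> n) G x"
    and \<rho>: "\<rho> \<longlonglongrightarrow> 0" "\<And>n. \<rho> n > 0"
  shows "(\<lambda>n. LINT x|lebesgue_on Q. (p n x - D x)\<^sup>2) \<longlonglongrightarrow> 0"
proof (rule LIMSEQ_I)
  fix e :: real assume e: "e > 0"
  have "G x = 0" if "norm z + R < norm x" for x
    using that norm_triangle_ineq2[of x z] by (intro supp) (auto simp: dist_norm norm_minus_commute)
  then have "\<exists>d>0. \<forall>r. 0 < r \<and> r < d \<longrightarrow> (\<integral>\<^sup>+x. ennreal ((mollify r G x - G x)\<^sup>2) \<partial>lborel) \<le> ennreal (e / 2)"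
    using e by (intro mollify_L2[OF G(1,3,2)]) auto
  then obtain d where d: "d > 0" and
    le: "\<And>r. 0 < r \<Longrightarrow> r < d \<Longrightarrow> (\<integral>\<^sup>+x. ennreal ((mollify r G x - G x)\<^sup>2) \<partial>lborel) \<le> ennreal (e / 2)" by blast
  have est: "norm ((LINT x|lebesgue_on Q. (p n x - D x)\<^sup>2) - 0) < e" if n: "\<rho> n < d" for n
  proof -
    have "(\<integral>\<^sup>+x. ennreal ((p n x - D x)\<^sup>2) \<partial>lebesgue_on Q) = (\<integral>\<^sup>+x. ennreal ((p n x - D x)\<^sup>2) * indicator Q x \<partial>lebesgue)"
      using Q by (subst nn_integral_restrict_space) auto
    also have "\<dots> \<le> (\<integral>\<^sup>+x. ennreal ((mollify (\<rho> n) G x - G x)\<^sup>2) \<partial>lebesgue)"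
      using ae by (intro nn_integral_mono_AE, eventually_elim) (auto simp: eq indicator_def)
    also have "\<dots> \<le> ennreal (e / 2)"
      unfolding nn_integral_completion using le[OF \<rho>(2) n] .
    finally have "(LINT x|lebesgue_on Q. (p n x - D x)\<^sup>2) \<le> e / 2"
      using D p e enn2real_leI[of "e / 2"] by (subst integral_eq_nn_integral) auto
    then show ?thesis using e by simp
  qed
  have "\<forall>\<^sub>F n in sequentially. \<rho> n < d" using \<rho>(1) d by (rule order_tendstoD)
  then show "\<exists>no. \<forall>n\<ge>no. norm ((LINT x|lebesgue_on Q. (p n x - D x)\<^sup>2) - 0) < e"
    using est by (auto simp: eventually_sequentially)
qed

lemma mollify_uniform_limit:
  fixes X F :: "real^2 \<Rightarrow> real"
  assumes F: "integrable lborel F" and FX: "\<And>x. x \<in> cball z R' \<Longrightarrow> F x = X x"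
    and X: "continuous_on (cball z R') X" and R: "R < R'" and \<rho>: "\<rho> \<longlonglongrightarrow> 0" "\<And>n. \<rho> n > 0"
  shows "uniform_limit (cball z R) (\<lambda>n. mollify (\<rho> n) F) X sequentially"
proof (rule uniform_limitI)
  fix e :: real assume e: "e > 0"
  have "uniformly_continuous_on (cball z R') X" by (rule compact_uniformly_continuous[OF X]) simp
  then obtain d where d: "d > 0" "\<And>x y. x \<in> cball z R' \<Longrightarrow> y \<in> cball z R' \<Longrightarrow> dist y x < d \<Longrightarrow> dist (X y) (X x) < e / 2"
    using e unfolding uniformly_continuous_on_def by (metis half_gt_zero)
  have "min d (R' - R) / 2 > 0" using d(1) R by simp
  from order_tendstoD(2)[OF \<rho>(1) this]
  show "\<forall>\<^sub>F n in sequentially. \<forall>x\<in>cball z R. dist (mollify (\<rho> n) F x) (X x) < e"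
  proof eventually_elim
    case (elim n)
    show ?case
    proof
      fix x assume x: "x \<in> cball z R"
      let ?k = "\<lambda>y::real^2. unit_bump (\<rho> n) (x$1 - y$1) * std_bump (\<rho> n) (x$2 - y$2)"
      note k = unit_kernel_reflected[OF \<rho>(2)[of n], where x = x]
      have "integrable lborel (\<lambda>y. F y * ?k y)"
        using integrable_smear[OF F _ bump_unit_bump bump_std_bump, where h = "\<lambda>y. y" and w = x and r = "\<rho> n"] by simp
      moreover have "\<bar>F y - X x\<bar> \<le> e / 2" if "?k y \<noteq> 0" for y
      proof -
        have "dist x y < min d (R' - R)" using k(4)[OF that] elim by simp
        moreover have "dist z y \<le> dist z x + dist x y" by (rule dist_triangle)
        ultimately have "y \<in> cball z R'" "x \<in> cball z R'" using x R by auto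
        then show ?thesis using d(2)[of x y] FX[of y] \<open>dist x y < min d (R' - R)\<close>
          by (auto simp: dist_commute dist_real_def abs_minus_commute less_imp_le)
      qed
      ultimately have "\<bar>(LINT y|lborel. F y * ?k y) - X x * (LINT y|lborel. ?k y)\<bar> \<le> e / 2 * (LINT y|lborel. ?k y)"
        using k(1,2) by (intro weighted_average_close) auto
      then show "dist (mollify (\<rho> n) F x) (X x) < e"
        using k(3) e by (simp add: mollify_def smear_def dist_real_def)
    qed
  qed
qed

text \<open>Mollifying a cut-off of \<open>X\<close> gives smooth functions whose gradients are, on a smaller ball,
  the mollified weak gradients, because the reflected kernel is an admissible test function.\<close>

lemma weak_gradient_sobolev_approximable:
  fixes X D1 D2 :: "real^2 \<Rightarrow> real"
  assumes R: "R < R'" and sub: "cball z R' \<subseteq> \<Omega>" and X: "continuous_on (cball z R') X"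
    and D1: "D1 \<in> borel_measurable (lebesgue_on (cball z R'))" "integrable (lebesgue_on (cball z R')) (\<lambda>x. (D1 x)\<^sup>2)"
    and D2: "D2 \<in> borel_measurable (lebesgue_on (cball z R'))" "integrable (lebesgue_on (cball z R')) (\<lambda>x. (D2 x)\<^sup>2)"
    and weak1: "\<And>\<phi>. test_function \<Omega> \<phi> \<Longrightarrow>
      (LINT y:\<Omega>|lebesgue. X y * partial_deriv 1 \<phi> y) = - (LINT y:\<Omega>|lebesgue. D1 y * \<phi> y)"
    and weak2: "\<And>\<phi>. test_function \<Omega> \<phi> \<Longrightarrow>
      (LINT y:\<Omega>|lebesgue. X y * partial_deriv 2 \<phi> y) = - (LINT y:\<Omega>|lebesgue. D2 y * \<phi> y)"
  shows "sobolev_approximable (cball z R) X D1 D2"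
proof -
  define F where "F x = indicator (cball z R') x *\<^sub>R X x" for x
  have iF: "integrable lborel F"
    unfolding F_def[abs_def] by (rule borel_integrable_compact[OF _ X]) simp
  then have mF: "F \<in> borel_measurable borel" by (simp add: borel_measurable_integrable)
  have FX: "F x = X x" if "x \<in> cball z R'" for x using that by (simp add: F_def)
  have mX: "X \<in> borel_measurable (lebesgue_on (cball z R'))"
    using X by (rule continuous_imp_measurable_on_sets_lebesgue) simp
  from borel_cutoff_exists[OF D1] obtain G1 where G1: "G1 \<in> borel_measurable borel" "integrable lborel G1"
    "integrable lborel (\<lambda>x. (G1 x)\<^sup>2)" "\<And>x. x \<notin> cball z R' \<Longrightarrow> G1 x = 0"
    "AE x in lebesgue. x \<in> cball z R' \<longrightarrow> D1 x = G1 x" by blast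
  from borel_cutoff_exists[OF D2] obtain G2 where G2: "G2 \<in> borel_measurable borel" "integrable lborel G2"
    "integrable lborel (\<lambda>x. (G2 x)\<^sup>2)" "\<And>x. x \<notin> cball z R' \<Longrightarrow> G2 x = 0"
    "AE x in lebesgue. x \<in> cball z R' \<longrightarrow> D2 x = G2 x" by blast
  define \<rho> where "\<rho> n = (R' - R) / 2 * inverse (real (Suc n))" for n
  have \<rho>: "\<rho> \<longlonglongrightarrow> 0" "\<And>n. \<rho> n > 0"
    using tendsto_mult_right_zero[OF LIMSEQ_inverse_real_of_nat, of "(R' - R) / 2"] R by (auto simp: \<rho>_def[abs_def])
  have \<rho>R: "2 * \<rho> n \<le> R' - R" for n
    using R mult_left_mono[of "inverse (real (Suc n))" 1 "R' - R"]
    by (simp add: \<rho>_def inverse_le_1_iff del: of_nat_Suc)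
  have near: "cball x (2 * \<rho> n) \<subseteq> cball z R'" if "x \<in> cball z R" for x n
  proof
    fix y assume "y \<in> cball x (2 * \<rho> n)"
    then show "y \<in> cball z R'" using that \<rho>R[of n] dist_triangle[of z y x] by simp
  qed
  let ?p = "\<lambda>n. mollify (\<rho> n) F"
  let ?p1 = "\<lambda>n. smear lborel F (\<lambda>y. y) (deriv (unit_bump (\<rho> n))) (std_bump (\<rho> n))"
  let ?p2 = "\<lambda>n. smear lborel F (\<lambda>y. y) (unit_bump (\<rho> n)) (deriv (std_bump (\<rho> n)))"
  have C2: "C2_bounded (?p n) (?p1 n) (?p2 n)" for n
    unfolding mollify_def by (rule C2_bounded_smear[OF iF _ bump_unit_bump bump_std_bump]) simp
  have eq1: "?p1 n x = mollify (\<rho> n) G1 x" and eq2: "?p2 n x = mollify (\<rho> n) G2 x" if "x \<in> cball z R" for n x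
    unfolding mollify_def
    using smear_weak_partial(1)[OF mF G1(1) sub near[OF that] mX _ D1(1) G1(5) weak1 bump_unit_bump bump_std_bump]
      smear_weak_partial(2)[OF mF G2(1) sub near[OF that] mX _ D2(1) G2(5) weak2 bump_unit_bump bump_std_bump]
      FX by auto
  have m: "p n \<in> borel_measurable (lebesgue_on Q)" if "\<And>x. \<exists>D. (p n has_derivative D) (at x)" for p :: "nat \<Rightarrow> real^2 \<Rightarrow> real" and n Q
  proof -
    have "continuous_on UNIV (p n)"
      using that by (intro continuous_at_imp_continuous_on) (blast intro: has_derivative_continuous)
    then have "p n \<in> borel_measurable borel" by (rule borel_measurable_continuous_onI)
    then have "p n \<in> borel_measurable lebesgue" by (intro measurable_completion) simp
    then show ?thesis by (rule measurable_restrict_space1)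
  qed
  have m12: "?p1 n \<in> borel_measurable (lebesgue_on Q)" "?p2 n \<in> borel_measurable (lebesgue_on Q)" for n Q
    using C2[of n] unfolding C2_bounded_def by (intro m; blast)+
  have Qs: "cball z R \<in> sets lebesgue" by simp
  have QQ: "cball z R \<subseteq> cball z R'" using R by auto
  have restr: "D \<in> borel_measurable (lebesgue_on (cball z R))" "integrable (lebesgue_on (cball z R)) (\<lambda>x. (D x)\<^sup>2)"
    if "D \<in> borel_measurable (lebesgue_on (cball z R'))" "integrable (lebesgue_on (cball z R')) (\<lambda>x. (D x)\<^sup>2)" for D :: "real^2 \<Rightarrow> real"
  proof -
    show "D \<in> borel_measurable (lebesgue_on (cball z R))" by (rule measurable_restrict_mono[OF that(1) QQ])
    have "set_integrable lebesgue (cball z R') (\<lambda>x. (D x)\<^sup>2)"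
      using that(2) unfolding set_integrable_def by (subst (asm) integrable_restrict_space) auto
    then have "set_integrable lebesgue (cball z R) (\<lambda>x. (D x)\<^sup>2)" by (rule set_integrable_subset[OF _ Qs QQ])
    then show "integrable (lebesgue_on (cball z R)) (\<lambda>x. (D x)\<^sup>2)"
      unfolding set_integrable_def by (subst integrable_restrict_space) auto
  qed
  have ae1: "AE x in lebesgue. x \<in> cball z R \<longrightarrow> D1 x = G1 x" 
    using G1(5) by eventually_elim (use QQ in blast)
  have ae2: "AE x in lebesgue. x \<in> cball z R \<longrightarrow> D2 x = G2 x" 
    using G2(5) by eventually_elim (use QQ in blast)
  show ?thesis
    unfolding sobolev_approximable_def
  proof (intro conjI exI allI)
    show "C2_bounded (?p n) (?p1 n) (?p2 n)" for n by (rule C2)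
    show "uniform_limit (cball z R) ?p X sequentially"
      by (rule mollify_uniform_limit[OF iF FX X R \<rho>])
    show "(\<lambda>n. LINT x|lebesgue_on (cball z R). (?p1 n x - D1 x)\<^sup>2) \<longlonglongrightarrow> 0"
      by (rule mollify_tendsto_L2[OF G1(1-4) Qs ae1 restr(1)[OF D1] m12(1) eq1 \<rho>])
    show "(\<lambda>n. LINT x|lebesgue_on (cball z R). (?p2 n x - D2 x)\<^sup>2) \<longlonglongrightarrow> 0"
      by (rule mollify_tendsto_L2[OF G2(1-4) Qs ae2 restr(1)[OF D2] m12(2) eq2 \<rho>])
  qed (rule restr[OF D1] restr[OF D2])+
qed

section \<open>Integration by parts against a composed kernel\<close>

lemma bounded_range_mult:
  fixes f g :: "'a \<Rightarrow> real"
  assumes "bounded (range f)" "bounded (range g)"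
  shows "bounded (range (\<lambda>x. f x * g x))"
proof -
  from assms obtain A B where A: "\<And>x. \<bar>f x\<bar> \<le> A" and B: "\<And>x. \<bar>g x\<bar> \<le> B" unfolding bounded_iff by auto
  have "\<bar>f x * g x\<bar> \<le> A * B" for x
    unfolding abs_mult using A[of x] B[of x] abs_ge_zero[of "f x"] by (intro mult_mono) linarith+
  then show ?thesis unfolding bounded_iff by auto
qed

lemma bounded_range_uminus:
  fixes f :: "'a \<Rightarrow> real"
  assumes "bounded (range f)"
  shows "bounded (range (\<lambda>x. - f x))"
  using assms unfolding bounded_iff by auto

lemma bounded_range_bump:
  assumes "bump r a" shows "bounded (range (\<lambda>x. a (h x)))"
  using bump_bounded[OF assms] unfolding bounded_iff by (metis (no_types, lifting) imageE real_norm_def)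

text \<open>As \<open>P\<close> vanishes on \<open>Q\<close> near the boundary, its extension by zero is differentiable everywhere and has
  compact support.\<close>

lemma integral_partial_cutoff_eq_0:
  fixes P p1 p2 :: "real^2 \<Rightarrow> real"
  assumes D: "\<And>x. (P has_derivative (\<lambda>h. p1 x * h$1 + p2 x * h$2)) (at x)"
    and bd: "bounded (range p1)" "bounded (range p2)"
    and Q: "compact Q" and C: "closed C" "C \<subseteq> interior Q"
    and z: "\<And>x. x \<in> Q \<Longrightarrow> x \<notin> C \<Longrightarrow> P x = 0 \<and> p1 x = 0 \<and> p2 x = 0"
  shows "integrable (lebesgue_on Q) p1" "integrable (lebesgue_on Q) p2"
    and "(LINT x|lebesgue_on Q. p1 x) = 0" "(LINT x|lebesgue_on Q. p2 x) = 0"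
proof -
  define G where "G x = (if x \<in> Q then P x else 0)" for x
  define E where "E x h = indicator Q x * (p1 x * h$1 + p2 x * h$2)" for x h :: "real^2"
  have "(G has_derivative E x) (at x)" for x
  proof (cases "x \<in> C")
    case True
    then have x: "x \<in> interior Q" "x \<in> Q" using C interior_subset by auto
    have "(G has_derivative (\<lambda>h. p1 x * h$1 + p2 x * h$2)) (at x)"
      by (rule has_derivative_transform_within_open[OF D open_interior x(1)])
        (use interior_subset in \<open>auto simp: G_def\<close>)
    then show ?thesis using x by (simp add: E_def[abs_def])
  next
    case False
    have "((\<lambda>_. 0) has_derivative (\<lambda>_. 0)) (at x)" by simp
    then have "(G has_derivative (\<lambda>_. 0)) (at x)"
      by (rule has_derivative_transform_within_open[of _ _ _ _ "- C"]) (use C False z in \<open>auto simp: G_def\<close>)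
    moreover have "E x = (\<lambda>_. 0)" using z[of x] False by (cases "x \<in> Q") (auto simp: E_def[abs_def])
    ultimately show ?thesis by simp
  qed
  note DG = this
  have supp: "bounded {x. G x \<noteq> 0}"
    by (rule bounded_subset[OF compact_imp_bounded[OF Q]]) (auto simp: G_def)
  obtain B1 where B1: "\<And>x. \<bar>p1 x\<bar> \<le> B1" using bd(1) unfolding bounded_iff by auto
  obtain B2 where B2: "\<And>x. \<bar>p2 x\<bar> \<le> B2" using bd(2) unfolding bounded_iff by auto
  have E1: "E x (axis 1 1) = indicator Q x *\<^sub>R p1 x" and E2: "E x (axis 2 1) = indicator Q x *\<^sub>R p2 x" for x
    by (auto simp: E_def axis_def)
  have b1: "\<bar>E x (axis 1 1)\<bar> \<le> B1" and b2: "\<bar>E x (axis 2 1)\<bar> \<le> B2" for x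
    using B1[of x] B2[of x] abs_ge_zero[of "p1 x"] abs_ge_zero[of "p2 x"] unfolding E1 E2
    by (auto simp: indicator_def simp del: abs_ge_zero)
  note I1 = integral_directional_derivative_eq_0[OF DG b1 supp, unfolded E1]
  note I2 = integral_directional_derivative_eq_0[OF DG b2 supp, unfolded E2]
  have Qs: "Q \<inter> space lebesgue \<in> sets lebesgue" using Q by (simp add: lmeasurable_compact fmeasurableD)
  have conv: "integrable (lebesgue_on Q) p \<and> (LINT x|lebesgue_on Q. p x) = 0"
    if "integrable lborel (\<lambda>x. indicator Q x *\<^sub>R p x)" "(LINT x|lborel. indicator Q x *\<^sub>R p x) = 0" for p :: "real^2 \<Rightarrow> real"
    using that borel_measurable_integrable[OF that(1)]
    by (simp add: integrable_restrict_space[OF Qs] integral_restrict_space[OF Qs] integrable_completion integral_completion)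
  show "integrable (lebesgue_on Q) p1" "integrable (lebesgue_on Q) p2"
    "(LINT x|lebesgue_on Q. p1 x) = 0" "(LINT x|lebesgue_on Q. p2 x) = 0"
    using conv[OF I1] conv[OF I2] by auto
qed

lemma has_derivative_composed_kernel:
  fixes u1 u2 :: "real^2 \<Rightarrow> real"
  assumes u1: "(u1 has_derivative (\<lambda>h. a1 * h$1 + a2 * h$2)) (at x)"
    and u2: "(u2 has_derivative (\<lambda>h. b1 * h$1 + b2 * h$2)) (at x)"
    and ab: "bump r \<alpha>" "bump r \<beta>"
  shows "((\<lambda>x. \<alpha> (s - u1 x) * \<beta> (t - u2 x)) has_derivative
    (\<lambda>h. (- (deriv \<alpha> (s - u1 x) * \<beta> (t - u2 x)) * a1 - \<alpha> (s - u1 x) * deriv \<beta> (t - u2 x) * b1) * h$1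
       + (- (deriv \<alpha> (s - u1 x) * \<beta> (t - u2 x)) * a2 - \<alpha> (s - u1 x) * deriv \<beta> (t - u2 x) * b2) * h$2)) (at x)"
proof -
  have "((\<lambda>x. s - u1 x) has_derivative (\<lambda>h. 0 - (a1 * h$1 + a2 * h$2))) (at x)"
    by (intro has_derivative_diff has_derivative_const u1)
  from has_derivative_compose[OF this DERIV_bump[OF ab(1), unfolded has_field_derivative_def]]
  have 1: "((\<lambda>x. \<alpha> (s - u1 x)) has_derivative (\<lambda>h. deriv \<alpha> (s - u1 x) * (0 - (a1 * h$1 + a2 * h$2)))) (at x)" .
  have "((\<lambda>x. t - u2 x) has_derivative (\<lambda>h. 0 - (b1 * h$1 + b2 * h$2))) (at x)"
    by (intro has_derivative_diff has_derivative_const u2)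
  from has_derivative_compose[OF this DERIV_bump[OF ab(2), unfolded has_field_derivative_def]]
  have 2: "((\<lambda>x. \<beta> (t - u2 x)) has_derivative (\<lambda>h. deriv \<beta> (t - u2 x) * (0 - (b1 * h$1 + b2 * h$2)))) (at x)" .
  show ?thesis
    by (rule has_derivative_eq_rhs[OF has_derivative_mult[OF 1 2]]) (auto simp: algebra_simps)
qed

text \<open>Stokes' theorem for the form \<open>f \<psi> dg\<close>, whose differential is
  \<open>\<psi> df \<and> dg + f d\<psi> \<and> dg\<close> because \<open>ddg = 0\<close>; here \<open>\<psi>\<close> is a kernel composed with \<open>(u1, u2)\<close> and
  \<open>d\<psi> = - A du1 - B du2\<close>. The kernel confines the form to \<open>C\<close>, away from the boundary of \<open>Q\<close>.\<close>

lemma smooth_pairing_identity: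
  fixes f g u1 u2 :: "real^2 \<Rightarrow> real"
  assumes f: "C2_bounded f f1 f2" and g: "C2_bounded g g1 g2" and u1: "C2_bounded u1 a1 a2" and u2: "C2_bounded u2 b1 b2"
    and ab: "bump r \<alpha>" "bump r \<beta>"
    and Q: "compact Q" and C: "closed C" "C \<subseteq> interior Q"
    and sep: "\<And>x. x \<in> Q \<Longrightarrow> x \<notin> C \<Longrightarrow> r \<le> \<bar>s - u1 x\<bar> \<or> r \<le> \<bar>t - u2 x\<bar>"
  defines "\<psi> \<equiv> \<lambda>x. \<alpha> (s - u1 x) * \<beta> (t - u2 x)"
    and "A \<equiv> \<lambda>x. deriv \<alpha> (s - u1 x) * \<beta> (t - u2 x)" and "B \<equiv> \<lambda>x. \<alpha> (s - u1 x) * deriv \<beta> (t - u2 x)"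
  shows "(LINT x|lebesgue_on Q. \<psi> x * (f1 x * g2 x) - \<psi> x * (f2 x * g1 x)
      - f x * A x * (a1 x * g2 x) + f x * A x * (a2 x * g1 x)
      - f x * B x * (b1 x * g2 x) + f x * B x * (b2 x * g1 x)) = 0"
proof -
  obtain g11 g12 g22 where bg: "bounded (range g1)" "bounded (range g2)" "bounded (range g11)" "bounded (range g12)" "bounded (range g22)"
    and Dg: "\<And>x. (g1 has_derivative (\<lambda>h. g11 x * h$1 + g12 x * h$2)) (at x)"
      "\<And>x. (g2 has_derivative (\<lambda>h. g12 x * h$1 + g22 x * h$2)) (at x)"
    using g unfolding C2_bounded_def by blast
  have bf: "bounded (range f)" "bounded (range f1)" "bounded (range f2)"
    and Df: "\<And>x. (f has_derivative (\<lambda>h. f1 x * h$1 + f2 x * h$2)) (at x)"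
    using f unfolding C2_bounded_def by blast+
  have bu: "bounded (range a1)" "bounded (range a2)"
    and Du: "\<And>x. (u1 has_derivative (\<lambda>h. a1 x * h$1 + a2 x * h$2)) (at x)"
    using u1 unfolding C2_bounded_def by blast+
  have bv: "bounded (range b1)" "bounded (range b2)"
    and Dv: "\<And>x. (u2 has_derivative (\<lambda>h. b1 x * h$1 + b2 x * h$2)) (at x)"
    using u2 unfolding C2_bounded_def by blast+
  have b\<psi>: "bounded (range \<psi>)" "bounded (range A)" "bounded (range B)"
    unfolding \<psi>_def A_def B_def
    by (intro bounded_range_mult bounded_range_bump[OF ab(1)] bounded_range_bump[OF ab(2)]
        bounded_range_bump[OF bump_deriv[OF ab(1)]] bounded_range_bump[OF bump_deriv[OF ab(2)]])+
  have D\<psi>: "(\<psi> has_derivative (\<lambda>h. (- A x * a1 x - B x * b1 x) * h$1 + (- A x * a2 x - B x * b2 x) * h$2)) (at x)" for x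
    unfolding \<psi>_def A_def B_def by (rule has_derivative_composed_kernel[OF Du Dv ab])
  have van: "\<psi> x = 0 \<and> A x = 0 \<and> B x = 0" if "x \<in> Q" "x \<notin> C" for x
    using sep[OF that] bump_eq_0[OF ab(1)] bump_eq_0[OF ab(2)] bump_eq_0[OF bump_deriv[OF ab(1)]] bump_eq_0[OF bump_deriv[OF ab(2)]]
    by (auto simp: \<psi>_def A_def B_def)
  define q where "q f' a b G G' = (\<lambda>x. f' x * \<psi> x * G x + f x * (- A x * a x - B x * b x) * G x + f x * \<psi> x * G' x)"
    for f' a b G G' :: "real^2 \<Rightarrow> real"
  have bq: "bounded (range (q f' a b G G'))"
    if "bounded (range f')" "bounded (range a)" "bounded (range b)" "bounded (range G)" "bounded (range G')" for f' a b G G'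
    unfolding q_def using that bf b\<psi>
    by (intro bounded_plus_comp bounded_range_mult bounded_minus_comp bounded_range_uminus) auto
  have DP: "((\<lambda>x. f x * \<psi> x * G x) has_derivative (\<lambda>h. q f1 a1 b1 G G1 x * h$1 + q f2 a2 b2 G G2 x * h$2)) (at x)"
    if "(G has_derivative (\<lambda>h. G1 x * h$1 + G2 x * h$2)) (at x)" for G G1 G2 :: "real^2 \<Rightarrow> real" and x
    by (rule has_derivative_eq_rhs[OF has_derivative_mult[OF has_derivative_mult[OF Df D\<psi>] that]])
      (auto simp: q_def algebra_simps)
  note I2 = integral_partial_cutoff_eq_0[OF DP[OF Dg(2)] bq bq Q C]
  note I1 = integral_partial_cutoff_eq_0[OF DP[OF Dg(1)] bq bq Q C]
  have 2: "integrable (lebesgue_on Q) (q f1 a1 b1 g2 g12)" "(LINT x|lebesgue_on Q. q f1 a1 b1 g2 g12 x) = 0"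
    by (rule I2(1) I2(3); (intro bf bu bv bg)?; simp add: van q_def)+
  have 1: "integrable (lebesgue_on Q) (q f2 a2 b2 g1 g12)" "(LINT x|lebesgue_on Q. q f2 a2 b2 g1 g12 x) = 0"
    by (rule I1(2) I1(4); (intro bf bu bv bg)?; simp add: van q_def)+
  have "(LINT x|lebesgue_on Q. q f1 a1 b1 g2 g12 x - q f2 a2 b2 g1 g12 x) = 0" using 1 2 by simp
  then show ?thesis by (simp add: q_def algebra_simps)
qed

lemma continuous_on_compact_integrable:
  fixes h :: "real^2 \<Rightarrow> real"
  assumes "compact Q" "continuous_on Q h"
  shows "integrable (lebesgue_on Q) h"
proof -
  have Qs: "Q \<inter> space lebesgue \<in> sets lebesgue" using assms by (simp add: lmeasurable_compact fmeasurableD)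
  have i: "integrable lborel (\<lambda>x. indicator Q x *\<^sub>R h x)" by (rule borel_integrable_compact[OF assms])
  show ?thesis
    unfolding integrable_restrict_space[OF Qs] using i borel_measurable_integrable[OF i] by (simp add: integrable_completion)
qed

lemma integrable_continuous_mult:
  fixes A :: "real^2 \<Rightarrow> real"
  assumes Q: "compact Q" and A: "continuous_on Q A" and P: "integrable (lebesgue_on Q) P"
  shows "integrable (lebesgue_on Q) (\<lambda>x. A x * P x)"
proof -
  have "bounded (A ` Q)" using compact_continuous_image[OF A Q] by (rule compact_imp_bounded)
  then obtain K where K: "\<And>x. x \<in> Q \<Longrightarrow> \<bar>A x\<bar> \<le> K" unfolding bounded_iff by auto
  show ?thesis
  proof (rule Bochner_Integration.integrable_bound)
    show "integrable (lebesgue_on Q) (\<lambda>x. K * P x)" using P by simp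
    show "(\<lambda>x. A x * P x) \<in> borel_measurable (lebesgue_on Q)"
      using borel_measurable_integrable[OF continuous_on_compact_integrable[OF Q A]] borel_measurable_integrable[OF P]
      by (rule borel_measurable_times)
    show "AE x in lebesgue_on Q. norm (A x * P x) \<le> norm (K * P x)"
    proof (rule AE_I2)
      fix x assume "x \<in> space (lebesgue_on Q)"
      then have "\<bar>A x\<bar> \<le> \<bar>K\<bar>" using K[of x] by (simp add: space_restrict_space)
      then show "norm (A x * P x) \<le> norm (K * P x)" by (simp add: abs_mult mult_right_mono)
    qed
  qed
qed

lemma tendsto_integral_triple_product:
  fixes A X Y :: "real^2 \<Rightarrow> real"
  assumes Q: "compact Q" and A': "\<And>n. continuous_on Q (A' n)" and A: "uniform_limit Q A' A sequentially"
    and X': "\<And>n. continuous_on Q (X' n)" and X: "X \<in> borel_measurable (lebesgue_on Q)" "integrable (lebesgue_on Q) (\<lambda>x. (X x)\<^sup>2)"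
    and limX: "(\<lambda>n. LINT x|lebesgue_on Q. (X' n x - X x)\<^sup>2) \<longlonglongrightarrow> 0"
    and Y': "\<And>n. continuous_on Q (Y' n)" and Y: "Y \<in> borel_measurable (lebesgue_on Q)" "integrable (lebesgue_on Q) (\<lambda>x. (Y x)\<^sup>2)"
    and limY: "(\<lambda>n. LINT x|lebesgue_on Q. (Y' n x - Y x)\<^sup>2) \<longlonglongrightarrow> 0"
  shows "(\<lambda>n. LINT x|lebesgue_on Q. A' n x * (X' n x * Y' n x)) \<longlonglongrightarrow> (LINT x|lebesgue_on Q. A x * (X x * Y x))"
    and "\<And>n. integrable (lebesgue_on Q) (\<lambda>x. A' n x * (X' n x * Y' n x))"
    and "integrable (lebesgue_on Q) (\<lambda>x. A x * (X x * Y x))"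
proof -
  have cA: "continuous_on Q A" by (rule uniform_limit_theorem[OF _ A]) (use A' in auto)
  have m: "h \<in> borel_measurable (lebesgue_on Q)" if "continuous_on Q h" for h :: "real^2 \<Rightarrow> real"
    by (rule borel_measurable_integrable[OF continuous_on_compact_integrable[OF Q that]])
  have sq: "integrable (lebesgue_on Q) (\<lambda>x. (h x)\<^sup>2)" if "continuous_on Q h" for h :: "real^2 \<Rightarrow> real"
    by (intro continuous_on_compact_integrable Q continuous_intros that)
  have iP': "integrable (lebesgue_on Q) (\<lambda>x. X' n x * Y' n x)" for n
    by (intro continuous_on_compact_integrable Q continuous_intros X' Y')
  have iP: "integrable (lebesgue_on Q) (\<lambda>x. X x * Y x)"
    by (rule integrable_mult_square_integrable[OF X(1) Y(1) X(2) Y(2)])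
  have bd: "\<exists>K. \<forall>x\<in>space (lebesgue_on Q). \<bar>h x\<bar> \<le> K" if "continuous_on Q h" for h :: "real^2 \<Rightarrow> real"
    using compact_imp_bounded[OF compact_continuous_image[OF that Q]] by (auto simp: bounded_iff space_restrict_space)
  obtain K where K: "\<And>x. x \<in> space (lebesgue_on Q) \<Longrightarrow> \<bar>A x\<bar> \<le> K" using bd[OF cA] by blast
  obtain K' where K': "\<And>n x. x \<in> space (lebesgue_on Q) \<Longrightarrow> \<bar>A' n x\<bar> \<le> K' n" using bd[OF A'] by metis
  have lim: "(\<lambda>n. LINT x|lebesgue_on Q. \<bar>X' n x * Y' n x - X x * Y x\<bar>) \<longlonglongrightarrow> 0"
    by (intro tendsto_integral_abs_mult_diff m X' Y' X Y sq limX limY)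
  have unif: "uniform_limit (space (lebesgue_on Q)) A' A sequentially" using A by (simp add: space_restrict_space)
  show "(\<lambda>n. LINT x|lebesgue_on Q. A' n x * (X' n x * Y' n x)) \<longlonglongrightarrow> (LINT x|lebesgue_on Q. A x * (X x * Y x))"
    by (rule tendsto_integral_uniform_mult[OF m[OF A'] m[OF cA] iP' iP lim unif K K'])
  show "integrable (lebesgue_on Q) (\<lambda>x. A' n x * (X' n x * Y' n x))" for n by (rule integrable_continuous_mult[OF Q A' iP'])
  show "integrable (lebesgue_on Q) (\<lambda>x. A x * (X x * Y x))" by (rule integrable_continuous_mult[OF Q cA iP])
qed

lemma uniform_limit_bump:
  fixes u :: "real^2 \<Rightarrow> real"
  assumes a: "bump r a" and u: "uniform_limit Q u' u sequentially"
  shows "uniform_limit Q (\<lambda>n x. a (s - u' n x)) (\<lambda>x. a (s - u x)) sequentially"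
proof (rule uniform_limitI)
  fix e :: real assume e: "e > 0"
  obtain M where M: "M \<ge> 0" "\<And>t. \<bar>deriv a t\<bar> \<le> M" using bump_bounded[OF bump_deriv[OF a]] by blast
  have "e / (M + 1) > 0" using e M by simp
  from uniform_limitD[OF u this]
  show "\<forall>\<^sub>F n in sequentially. \<forall>x\<in>Q. dist (a (s - u' n x)) (a (s - u x)) < e"
  proof eventually_elim
    case (elim n)
    show ?case
    proof
      fix x assume "x \<in> Q"
      then have d: "\<bar>u x - u' n x\<bar> < e / (M + 1)" using elim by (simp add: dist_real_def abs_minus_commute)
      have "\<bar>a (s - u' n x) - a (s - u x)\<bar> \<le> M * \<bar>u x - u' n x\<bar>"
        using bump_increment_le[OF a M(2), of "s - u x" "u x - u' n x"] by simp
      also have "\<dots> \<le> M * (e / (M + 1))" using d M by (intro mult_left_mono) auto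
      also have "\<dots> < e" using e M by (simp add: field_simps)
      finally show "dist (a (s - u' n x)) (a (s - u x)) < e" by (simp add: dist_real_def)
    qed
  qed
qed

text \<open>Each term is a continuous factor, converging uniformly, times a product of two gradient entries,
  each converging in square mean. The margin \<open>\<delta>\<close> keeps the composed kernels of the approximations
  supported in \<open>C\<close> as well.\<close>

lemma sobolev_pairing_identity:
  fixes f g u1 u2 :: "real^2 \<Rightarrow> real"
  assumes f: "sobolev_approximable Q f f1 f2" and g: "sobolev_approximable Q g g1 g2"
    and u1: "sobolev_approximable Q u1 a1 a2" and u2: "sobolev_approximable Q u2 b1 b2"
    and ab: "bump r \<alpha>" "bump r \<beta>"
    and Q: "compact Q" and C: "closed C" "C \<subseteq> interior Q"
    and \<delta>: "\<delta> > 0" and sep: "\<And>x. x \<in> Q \<Longrightarrow> x \<notin> C \<Longrightarrow> r + \<delta> \<le> \<bar>s - u1 x\<bar> \<or> r + \<delta> \<le> \<bar>t - u2 x\<bar>"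
  defines "\<psi> \<equiv> \<lambda>x. \<alpha> (s - u1 x) * \<beta> (t - u2 x)"
    and "A \<equiv> \<lambda>x. deriv \<alpha> (s - u1 x) * \<beta> (t - u2 x)" and "B \<equiv> \<lambda>x. \<alpha> (s - u1 x) * deriv \<beta> (t - u2 x)"
  shows "(LINT x|lebesgue_on Q. \<psi> x * (f1 x * g2 x) - \<psi> x * (f2 x * g1 x)
      - f x * A x * (a1 x * g2 x) + f x * A x * (a2 x * g1 x)
      - f x * B x * (b1 x * g2 x) + f x * B x * (b2 x * g1 x)) = 0"
proof -
  obtain f' f1' f2' where f': "\<And>n. C2_bounded (f' n) (f1' n) (f2' n)" "uniform_limit Q f' f sequentially"
    "(\<lambda>n. LINT x|lebesgue_on Q. (f1' n x - f1 x)\<^sup>2) \<longlonglongrightarrow> 0" "(\<lambda>n. LINT x|lebesgue_on Q. (f2' n x - f2 x)\<^sup>2) \<longlonglongrightarrow> 0"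
    using f unfolding sobolev_approximable_def by blast
  obtain g' g1' g2' where g': "\<And>n. C2_bounded (g' n) (g1' n) (g2' n)"
    "(\<lambda>n. LINT x|lebesgue_on Q. (g1' n x - g1 x)\<^sup>2) \<longlonglongrightarrow> 0" "(\<lambda>n. LINT x|lebesgue_on Q. (g2' n x - g2 x)\<^sup>2) \<longlonglongrightarrow> 0"
    using g unfolding sobolev_approximable_def by blast
  obtain u' a1' a2' where u': "\<And>n. C2_bounded (u' n) (a1' n) (a2' n)" "uniform_limit Q u' u1 sequentially"
    "(\<lambda>n. LINT x|lebesgue_on Q. (a1' n x - a1 x)\<^sup>2) \<longlonglongrightarrow> 0" "(\<lambda>n. LINT x|lebesgue_on Q. (a2' n x - a2 x)\<^sup>2) \<longlonglongrightarrow> 0"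
    using u1 unfolding sobolev_approximable_def by blast
  obtain v' b1' b2' where v': "\<And>n. C2_bounded (v' n) (b1' n) (b2' n)" "uniform_limit Q v' u2 sequentially"
    "(\<lambda>n. LINT x|lebesgue_on Q. (b1' n x - b1 x)\<^sup>2) \<longlonglongrightarrow> 0" "(\<lambda>n. LINT x|lebesgue_on Q. (b2' n x - b2 x)\<^sup>2) \<longlonglongrightarrow> 0"
    using u2 unfolding sobolev_approximable_def by blast
  note L2 = f g u1 u2
  have cont: "continuous_on Q p" "continuous_on Q p1" "continuous_on Q p2" if "C2_bounded p p1 p2" for p p1 p2
    using that unfolding C2_bounded_def
    by (meson continuous_at_imp_continuous_on has_derivative_continuous)+
  have ulim_cont: "continuous_on Q p" if "\<And>n. C2_bounded (p' n) (p1 n) (p2 n)" "uniform_limit Q p' p sequentially" for p p' p1 p2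
    using uniform_limit_theorem[OF _ that(2)] cont(1)[OF that(1)] by simp
  have bounded: "bounded (p ` Q)" if "continuous_on Q p" for p :: "real^2 \<Rightarrow> real"
    by (rule compact_imp_bounded[OF compact_continuous_image[OF that Q]])
  have cc: "continuous_on Q (\<lambda>x. a (s - p x))" if "bump r a" "continuous_on Q p" for a s and p :: "real^2 \<Rightarrow> real"
    by (rule continuous_on_compose2[OF bump_continuous[OF that(1), of UNIV]]) (auto intro!: continuous_intros that(2))
  note ab' = bump_deriv[OF ab(1)] bump_deriv[OF ab(2)]
  note cu = ulim_cont[OF u'(1,2)] and cv = ulim_cont[OF v'(1,2)] and cf = ulim_cont[OF f'(1,2)]
  define \<psi>' where "\<psi>' n x = \<alpha> (s - u' n x) * \<beta> (t - v' n x)" for n x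
  define A' where "A' n x = deriv \<alpha> (s - u' n x) * \<beta> (t - v' n x)" for n x
  define B' where "B' n x = \<alpha> (s - u' n x) * deriv \<beta> (t - v' n x)" for n x
  have lim\<psi>: "uniform_limit Q \<psi>' \<psi> sequentially" "uniform_limit Q A' A sequentially" "uniform_limit Q B' B sequentially"
    unfolding \<psi>'_def[abs_def] A'_def[abs_def] B'_def[abs_def] \<psi>_def A_def B_def
    by (intro uniform_lim_mult uniform_limit_bump[OF ab(1) u'(2)] uniform_limit_bump[OF ab(2) v'(2)]
        uniform_limit_bump[OF ab'(1) u'(2)] uniform_limit_bump[OF ab'(2) v'(2)]
        bounded cc[OF ab(1)] cc[OF ab(2)] cc[OF ab'(1)] cc[OF ab'(2)] cu cv)+
  have c': "continuous_on Q (\<psi>' n)" "continuous_on Q (A' n)" "continuous_on Q (B' n)" for n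
    unfolding \<psi>'_def[abs_def] A'_def[abs_def] B'_def[abs_def]
    by (intro continuous_on_mult cc[OF ab(1)] cc[OF ab(2)] cc[OF ab'(1)] cc[OF ab'(2)] cont(1)[OF u'(1)] cont(1)[OF v'(1)])+
  have c: "continuous_on Q A" "continuous_on Q B"
    using uniform_limit_theorem[OF _ lim\<psi>(2)] uniform_limit_theorem[OF _ lim\<psi>(3)] c' by simp_all
  have limf: "uniform_limit Q (\<lambda>n x. f' n x * A' n x) (\<lambda>x. f x * A x) sequentially"
    "uniform_limit Q (\<lambda>n x. f' n x * B' n x) (\<lambda>x. f x * B x) sequentially"
    by (intro uniform_lim_mult f'(2) lim\<psi> bounded cf c)+
  have cf': "continuous_on Q (\<lambda>x. f' n x * A' n x)" "continuous_on Q (\<lambda>x. f' n x * B' n x)" for n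
    by (intro continuous_intros c' cont(1)[OF f'(1)])+
  have sq: "f1 \<in> borel_measurable (lebesgue_on Q)" "integrable (lebesgue_on Q) (\<lambda>x. (f1 x)\<^sup>2)"
    "f2 \<in> borel_measurable (lebesgue_on Q)" "integrable (lebesgue_on Q) (\<lambda>x. (f2 x)\<^sup>2)"
    "g1 \<in> borel_measurable (lebesgue_on Q)" "integrable (lebesgue_on Q) (\<lambda>x. (g1 x)\<^sup>2)"
    "g2 \<in> borel_measurable (lebesgue_on Q)" "integrable (lebesgue_on Q) (\<lambda>x. (g2 x)\<^sup>2)"
    "a1 \<in> borel_measurable (lebesgue_on Q)" "integrable (lebesgue_on Q) (\<lambda>x. (a1 x)\<^sup>2)"
    "a2 \<in> borel_measurable (lebesgue_on Q)" "integrable (lebesgue_on Q) (\<lambda>x. (a2 x)\<^sup>2)"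
    "b1 \<in> borel_measurable (lebesgue_on Q)" "integrable (lebesgue_on Q) (\<lambda>x. (b1 x)\<^sup>2)"
    "b2 \<in> borel_measurable (lebesgue_on Q)" "integrable (lebesgue_on Q) (\<lambda>x. (b2 x)\<^sup>2)"
    using L2 unfolding sobolev_approximable_def by blast+
  note triple = tendsto_integral_triple_product[OF Q]
  note T1 = triple[OF c'(1) lim\<psi>(1) cont(2)[OF f'(1)] sq(1,2) f'(3) cont(3)[OF g'(1)] sq(7,8) g'(3)]
  note T2 = triple[OF c'(1) lim\<psi>(1) cont(3)[OF f'(1)] sq(3,4) f'(4) cont(2)[OF g'(1)] sq(5,6) g'(2)]
  note T3 = triple[OF cf'(1) limf(1) cont(2)[OF u'(1)] sq(9,10) u'(3) cont(3)[OF g'(1)] sq(7,8) g'(3)]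
  note T4 = triple[OF cf'(1) limf(1) cont(3)[OF u'(1)] sq(11,12) u'(4) cont(2)[OF g'(1)] sq(5,6) g'(2)]
  note T5 = triple[OF cf'(2) limf(2) cont(2)[OF v'(1)] sq(13,14) v'(3) cont(3)[OF g'(1)] sq(7,8) g'(3)]
  note T6 = triple[OF cf'(2) limf(2) cont(3)[OF v'(1)] sq(15,16) v'(4) cont(2)[OF g'(1)] sq(5,6) g'(2)]
  let ?I' = "\<lambda>n. LINT x|lebesgue_on Q. \<psi>' n x * (f1' n x * g2' n x) - \<psi>' n x * (f2' n x * g1' n x)
      - f' n x * A' n x * (a1' n x * g2' n x) + f' n x * A' n x * (a2' n x * g1' n x)
      - f' n x * B' n x * (b1' n x * g2' n x) + f' n x * B' n x * (b2' n x * g1' n x)"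
  let ?I = "LINT x|lebesgue_on Q. \<psi> x * (f1 x * g2 x) - \<psi> x * (f2 x * g1 x)
      - f x * A x * (a1 x * g2 x) + f x * A x * (a2 x * g1 x)
      - f x * B x * (b1 x * g2 x) + f x * B x * (b2 x * g1 x)"
  have "?I' \<longlonglongrightarrow> ?I"
    using tendsto_add[OF tendsto_diff[OF tendsto_add[OF tendsto_diff[OF tendsto_diff[OF T1(1) T2(1)] T3(1)] T4(1)] T5(1)] T6(1)]
    by (simp add: T1(2,3) T2(2,3) T3(2,3) T4(2,3) T5(2,3) T6(2,3))
  moreover have "\<forall>\<^sub>F n in sequentially. ?I' n = 0"
    using uniform_limitD[OF u'(2) \<delta>] uniform_limitD[OF v'(2) \<delta>]
  proof eventually_elim
    case (elim n)
    have "r \<le> \<bar>s - u' n x\<bar> \<or> r \<le> \<bar>t - v' n x\<bar>" if "x \<in> Q" "x \<notin> C" for x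
    proof -
      have "\<bar>u' n x - u1 x\<bar> < \<delta>" "\<bar>v' n x - u2 x\<bar> < \<delta>" using elim that by (auto simp: dist_real_def)
      then show ?thesis using sep[OF that] by linarith
    qed
    from smooth_pairing_identity[OF f'(1)[of n] g'(1)[of n] u'(1)[of n] v'(1)[of n] ab Q C this]
    show ?case by (simp add: \<psi>'_def A'_def B'_def)
  qed
  then have "?I' \<longlonglongrightarrow> 0" by (rule tendsto_eventually)
  ultimately show ?thesis by (rule LIMSEQ_unique)
qed

section \<open>Two-by-two matrices with proportional stretch\<close>

text \<open>Read the columns of \<open>A\<close> and \<open>B\<close> as complex numbers \<open>a, b\<close> and \<open>c, d\<close>. Proportional stretches with
  positive determinants give \<open>cnj a b = L cnj c d\<close> and \<open>\<bar>a\<bar>\<^sup>2 = L \<bar>c\<bar>\<^sup>2\<close>, hence \<open>b c = a d\<close>. The two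
  conclusions are the imaginary and real parts of this equation; for gradients they say
  \<open>dv \<and> du = 0\<close>.\<close>

lemma proportional_stretch_wedge_eq_0:
  fixes A B :: "real^2^2"
  assumes A: "det A > 0" and B: "det B > 0" and l: "l > 0" and S: "stretch A = l *\<^sub>R stretch B"
  shows "B$1$1 * A$2$2 - B$1$2 * A$2$1 + (B$2$1 * A$1$2 - B$2$2 * A$1$1) = 0"
    and "B$1$1 * A$1$2 - B$1$2 * A$1$1 - (B$2$1 * A$2$2 - B$2$2 * A$2$1) = 0"
proof -
  have "transpose A ** A = stretch A ** stretch A" using stretch_2[of A] by simp
  also have "\<dots> = (l * l) *\<^sub>R (stretch B ** stretch B)"
    unfolding S by (simp add: vec_eq_iff matrix_matrix_mult_def sum_2 algebra_simps)
  also have "\<dots> = (l * l) *\<^sub>R (transpose B ** B)" using stretch_2[of B] by simp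
  finally have e: "(transpose A ** A) $ i $ j = ((l * l) *\<^sub>R (transpose B ** B)) $ i $ j" for i j by simp
  define a b c d where "a = Complex (A$1$1) (A$2$1)" "b = Complex (A$1$2) (A$2$2)"
    "c = Complex (B$1$1) (B$2$1)" "d = Complex (B$1$2) (B$2$2)"
  note abcd = a_b_c_d_def
  define L where "L = l * l"
  have L: "L > 0" using l by (simp add: L_def)
  have e11: "A$1$1 * A$1$1 + A$2$1 * A$2$1 = L * (B$1$1 * B$1$1 + B$2$1 * B$2$1)"
    and e22: "A$1$2 * A$1$2 + A$2$2 * A$2$2 = L * (B$1$2 * B$1$2 + B$2$2 * B$2$2)"
    and e12: "A$1$1 * A$1$2 + A$2$1 * A$2$2 = L * (B$1$1 * B$1$2 + B$2$1 * B$2$2)"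
    using e[of 1 1] e[of 2 2] e[of 1 2]
    by (simp_all add: matrix_matrix_mult_def transpose_def sum_2 L_def)
  have "(det A)\<^sup>2 = (A$1$1 * A$1$1 + A$2$1 * A$2$1) * (A$1$2 * A$1$2 + A$2$2 * A$2$2) - (A$1$1 * A$1$2 + A$2$1 * A$2$2)\<^sup>2"
    by (simp add: det_2 power2_eq_square algebra_simps)
  also have "\<dots> = (L * det B)\<^sup>2"
    unfolding e11 e22 e12 by (simp add: det_2 power2_eq_square algebra_simps)
  finally have "det A = L * det B" using A B L by (simp add: power2_eq_iff_nonneg)
  then have ab: "cnj a * b = of_real L * (cnj c * d)"
    using e12 by (simp add: complex_eq_iff abcd det_2 algebra_simps)
  have aa: "a * cnj a = of_real L * (c * cnj c)"
    using e11 by (simp add: complex_eq_iff abcd algebra_simps)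
  have "c \<noteq> 0" using B by (auto simp: abcd det_2 complex_eq_iff)
  have "(of_real L * (c * cnj c)) * (b * c) = a * c * (cnj a * b)" unfolding aa[symmetric] by (simp add: algebra_simps)
  also have "\<dots> = (of_real L * (c * cnj c)) * (a * d)" unfolding ab by (simp add: algebra_simps)
  finally have "b * c = a * d" using L \<open>c \<noteq> 0\<close> by simp
  then have "Re (b * c) = Re (a * d)" "Im (b * c) = Im (a * d)" by simp_all
  then show "B$1$1 * A$2$2 - B$1$2 * A$2$1 + (B$2$1 * A$1$2 - B$2$2 * A$1$1) = 0"
    "B$1$1 * A$1$2 - B$1$2 * A$1$1 - (B$2$1 * A$2$2 - B$2$2 * A$2$1) = 0"
    by (simp_all add: abcd algebra_simps)
qed

text \<open>Twice the square of the conformal part is the square of the Hilbert--Schmidt norm plus twice the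
  determinant.\<close>

lemma entry_square_le_conformal_part:
  fixes A :: "real^2^2"
  assumes "det A > 0"
  shows "(A$i$j)\<^sup>2 \<le> 2 * (norm (conformal_part A))\<^sup>2"
proof -
  have n: "(norm (conformal_part A))\<^sup>2 = ((A$1$1 + A$2$2)\<^sup>2 + (A$2$1 - A$1$2)\<^sup>2) / 2"
    unfolding power2_norm_eq_inner
    by (simp add: inner_vec_def sum_2 conformal_part_def vector_2 power2_eq_square field_simps)
  have "2 * (norm (conformal_part A))\<^sup>2 = (A$1$1)\<^sup>2 + (A$1$2)\<^sup>2 + (A$2$1)\<^sup>2 + (A$2$2)\<^sup>2 + 2 * det A"
    unfolding n by (simp add: det_2 power2_eq_square field_simps)
  moreover have "i = 1 \<or> i = 2" "j = 1 \<or> j = 2" by (rule exhaust_2)+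
  then have "(A$i$j)\<^sup>2 \<le> (A$1$1)\<^sup>2 + (A$1$2)\<^sup>2 + (A$2$1)\<^sup>2 + (A$2$2)\<^sup>2" by auto
  ultimately show ?thesis using assms by linarith
qed

lemma weak_gradient_component_approximable:
  fixes u :: "real^2 \<Rightarrow> real^2" and Du :: "real^2 \<Rightarrow> real^2^2"
  assumes W: "weak_gradient \<Omega> u Du" and u: "continuous_on \<Omega> u"
    and R: "R < R'" and sub: "cball z R' \<subseteq> \<Omega>"
    and det: "AE z\<in>\<Omega> in lebesgue. det (Du z) > 0"
    and H: "set_integrable lebesgue \<Omega> H" and le: "\<And>x. (norm (conformal_part (Du x)))\<^sup>2 \<le> H x"
  shows "sobolev_approximable (cball z R) (\<lambda>x. u x $ i) (\<lambda>x. Du x $ i $ 1) (\<lambda>x. Du x $ i $ 2)"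
proof -
  let ?Q = "cball z R'"
  have Qs: "?Q \<inter> space lebesgue \<in> sets lebesgue" by simp
  have "set_integrable lebesgue ?Q Du" using W sub unfolding weak_gradient_def locally_integrable_on_def by simp
  then have "integrable (lebesgue_on ?Q) Du"
    unfolding set_integrable_def integrable_restrict_space[OF Qs] .
  then have mD: "Du \<in> borel_measurable (lebesgue_on ?Q)" by (rule borel_measurable_integrable)
  have c: "continuous_on UNIV (\<lambda>A::real^2^2. A $ i $ j)" for j by (intro continuous_intros)
  have m: "(\<lambda>x. Du x $ i $ j) \<in> borel_measurable (lebesgue_on ?Q)" for j
    using measurable_compose[OF mD borel_measurable_continuous_onI[OF c]] .
  have "set_integrable lebesgue ?Q H" by (rule set_integrable_subset[OF H _ sub]) simp
  then have iH: "integrable (lebesgue_on ?Q) H"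
    unfolding set_integrable_def integrable_restrict_space[OF Qs] .
  have "AE x in lebesgue. x \<in> ?Q \<longrightarrow> det (Du x) > 0"
    using det by eventually_elim (use sub in auto)
  then have det': "AE x in lebesgue_on ?Q. det (Du x) > 0" by (simp add: AE_restrict_space_iff[OF Qs])
  have sq: "integrable (lebesgue_on ?Q) (\<lambda>x. (Du x $ i $ j)\<^sup>2)" for j
  proof (rule Bochner_Integration.integrable_bound)
    show "integrable (lebesgue_on ?Q) (\<lambda>x. 2 * H x)" using iH by simp
    show "(\<lambda>x. (Du x $ i $ j)\<^sup>2) \<in> borel_measurable (lebesgue_on ?Q)" by (intro borel_measurable_power m)
    show "AE x in lebesgue_on ?Q. norm ((Du x $ i $ j)\<^sup>2) \<le> norm (2 * H x)"
      using det'
    proof eventually_elim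
      case (elim x)
      from entry_square_le_conformal_part[OF this, of i j] le[of x] show ?case by simp
    qed
  qed
  have cu: "continuous_on ?Q (\<lambda>x. u x $ i)" by (intro continuous_intros continuous_on_subset[OF u sub])
  show ?thesis
    using W unfolding weak_gradient_def
    by (intro weak_gradient_sobolev_approximable[OF R sub cu m sq m sq]) blast+
qed

section \<open>Conformality in complex coordinates\<close>

definition to_complex :: "real^2 \<Rightarrow> complex" where "to_complex p = Complex (p$1) (p$2)"

definition of_complex :: "complex \<Rightarrow> real^2" where "of_complex \<zeta> = vector [Re \<zeta>, Im \<zeta>]"

lemma of_complex_nth: "of_complex \<zeta> $ 1 = Re \<zeta>" "of_complex \<zeta> $ 2 = Im \<zeta>"
  by (simp_all add: of_complex_def vector_2)

lemma to_complex_of_complex [simp]: "to_complex (of_complex \<zeta>) = \<zeta>"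
  by (simp add: to_complex_def of_complex_nth)

lemma of_complex_to_complex [simp]: "of_complex (to_complex p) = p"
  by (simp add: to_complex_def vec_eq_iff forall_2 of_complex_nth)

lemma dist_of_complex: "dist (of_complex \<zeta>) (of_complex \<xi>) = dist \<zeta> \<xi>"
  by (simp add: dist_norm norm_vec_def L2_set_def sum_2 of_complex_nth cmod_def)

lemma bounded_linear_to_complex: "bounded_linear to_complex"
proof (rule bounded_linear_intro[of _ 1])
  fix p q :: "real^2" and r :: real
  show "to_complex (p + q) = to_complex p + to_complex q" "to_complex (r *\<^sub>R p) = r *\<^sub>R to_complex p"
    by (simp_all add: to_complex_def complex_eq_iff)
  show "norm (to_complex p) \<le> norm p * 1"
    by (simp add: norm_vec_def L2_set_def sum_2 to_complex_def cmod_def)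
qed

lemma bounded_linear_of_complex: "bounded_linear of_complex"
proof (rule bounded_linear_intro[of _ 1])
  fix p q :: complex and r :: real
  show "of_complex (p + q) = of_complex p + of_complex q" "of_complex (r *\<^sub>R p) = r *\<^sub>R of_complex p"
    by (simp_all add: vec_eq_iff forall_2 of_complex_nth)
  show "norm (of_complex p) \<le> norm p * 1"
    by (simp add: norm_vec_def L2_set_def sum_2 of_complex_nth cmod_def)
qed

lemma Cauchy_Riemann_field_derivative:
  fixes F1 F2 :: "real^2 \<Rightarrow> real"
  assumes F1: "(F1 has_derivative (\<lambda>h. a * h$1 + b * h$2)) (at (of_complex \<zeta>))"
    and F2: "(F2 has_derivative (\<lambda>h. c * h$1 + d * h$2)) (at (of_complex \<zeta>))"
    and CR: "a = d" "b = - c"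
  shows "((\<lambda>\<zeta>. Complex (F1 (of_complex \<zeta>)) (F2 (of_complex \<zeta>))) has_field_derivative Complex a c) (at \<zeta>)"
proof -
  note v = bounded_linear_imp_has_derivative[OF bounded_linear_of_complex]
  have 1: "((\<lambda>\<zeta>. F1 (of_complex \<zeta>)) has_derivative (\<lambda>h. a * Re h + b * Im h)) (at \<zeta>)"
    using has_derivative_compose[OF v F1] by (simp add: of_complex_nth)
  have 2: "((\<lambda>\<zeta>. F2 (of_complex \<zeta>)) has_derivative (\<lambda>h. c * Re h + d * Im h)) (at \<zeta>)"
    using has_derivative_compose[OF v F2] by (simp add: of_complex_nth)
  have "((\<lambda>\<zeta>. complex_of_real (F1 (of_complex \<zeta>)) + \<i> * complex_of_real (F2 (of_complex \<zeta>))) has_derivative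
     (\<lambda>h. complex_of_real (a * Re h + b * Im h) + \<i> * complex_of_real (c * Re h + d * Im h))) (at \<zeta>)"
    by (intro has_derivative_add has_derivative_mult_right has_derivative_of_real 1 2)
  moreover have "(\<lambda>h. complex_of_real (a * Re h + b * Im h) + \<i> * complex_of_real (c * Re h + d * Im h)) = (*) (Complex a c)"
    using CR by (auto simp: fun_eq_iff complex_eq_iff)
  ultimately show ?thesis by (simp add: has_field_derivative_def Complex_eq)
qed

lemma field_derivative_conformal:
  assumes "(F has_field_derivative D) (at (to_complex p))"
  shows "\<exists>A. conformal_matrix A \<and> ((\<lambda>q. of_complex (F (to_complex q))) has_derivative (\<lambda>h. A *v h)) (at p)"
proof -
  let ?A = "vector [vector [Re D, - Im D], vector [Im D, Re D]] :: real^2^2"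
  have "((\<lambda>q. F (to_complex q)) has_derivative (\<lambda>h. D * to_complex h)) (at p)"
    using has_derivative_compose[OF bounded_linear_imp_has_derivative[OF bounded_linear_to_complex] assms[unfolded has_field_derivative_def]] .
  from bounded_linear.has_derivative[OF bounded_linear_of_complex this]
  have "((\<lambda>q. of_complex (F (to_complex q))) has_derivative (\<lambda>h. of_complex (D * to_complex h))) (at p)" .
  moreover have "of_complex (D * to_complex h) = ?A *v h" for h
    by (simp add: vec_eq_iff forall_2 of_complex_nth to_complex_def matrix_vector_mult_def sum_2 vector_2)
  ultimately show ?thesis unfolding conformal_matrix_def by (intro exI[of _ ?A]) auto
qed

section \<open>Factorization through a planar Sobolev homeomorphism\<close>

text \<open>Pairing with \<open>g = u\<^sub>2\<close> isolates the first partial derivative of the kernel, since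
  \<open>du\<^sub>2 \<and> du\<^sub>2 = 0\<close> and \<open>du\<^sub>1 \<and> du\<^sub>2 = J\<close>; pairing with \<open>g = u\<^sub>1\<close> isolates the second.\<close>

lemma partial_smear_jacobian:
  fixes u :: "real^2 \<Rightarrow> real^2" and Du :: "real^2 \<Rightarrow> real^2^2" and f :: "real^2 \<Rightarrow> real"
  assumes su: "\<And>i. sobolev_approximable Q (\<lambda>x. u x $ i) (\<lambda>x. Du x $ i $ 1) (\<lambda>x. Du x $ i $ 2)"
    and sf: "sobolev_approximable Q f f1 f2"
    and cu: "continuous_on Q u" and cf: "continuous_on Q f"
    and ab: "bump r \<alpha>" "bump r \<beta>"
    and Q: "compact Q" and C: "closed C" "C \<subseteq> interior Q"
    and \<delta>: "\<delta> > 0" and sep: "\<And>x. x \<in> Q \<Longrightarrow> x \<notin> C \<Longrightarrow> r + \<delta> \<le> \<bar>w$1 - u x$1\<bar> \<or> r + \<delta> \<le> \<bar>w$2 - u x$2\<bar>"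
  defines "\<psi> \<equiv> \<lambda>x. \<alpha> (w$1 - u x$1) * \<beta> (w$2 - u x$2)"
  shows "smear (lebesgue_on Q) (\<lambda>x. f x * det (Du x)) u (deriv \<alpha>) \<beta> w
      = (LINT x|lebesgue_on Q. \<psi> x * (f1 x * Du x$2$2 - f2 x * Du x$2$1))"
    and "smear (lebesgue_on Q) (\<lambda>x. f x * det (Du x)) u \<alpha> (deriv \<beta>) w
      = - (LINT x|lebesgue_on Q. \<psi> x * (f1 x * Du x$1$2 - f2 x * Du x$1$1))"
    and "integrable (lebesgue_on Q) (\<lambda>x. f x * det (Du x))"
proof -
  have mDu: "(\<lambda>x. Du x $ i $ j) \<in> borel_measurable (lebesgue_on Q)"
    and sqDu: "integrable (lebesgue_on Q) (\<lambda>x. (Du x $ i $ j)\<^sup>2)" for i j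
  proof -
    have "j = 1 \<or> j = 2" by (rule exhaust_2)
    then show "(\<lambda>x. Du x $ i $ j) \<in> borel_measurable (lebesgue_on Q)" "integrable (lebesgue_on Q) (\<lambda>x. (Du x $ i $ j)\<^sup>2)"
      using su[of i] unfolding sobolev_approximable_def by auto
  qed
  have mf: "f1 \<in> borel_measurable (lebesgue_on Q)" "f2 \<in> borel_measurable (lebesgue_on Q)"
    "integrable (lebesgue_on Q) (\<lambda>x. (f1 x)\<^sup>2)" "integrable (lebesgue_on Q) (\<lambda>x. (f2 x)\<^sup>2)"
    using sf unfolding sobolev_approximable_def by auto
  have "integrable (lebesgue_on Q) (\<lambda>x. det (Du x))"
    unfolding det_2 by (intro Bochner_Integration.integrable_diff integrable_mult_square_integrable mDu sqDu)
  then show iJ: "integrable (lebesgue_on Q) (\<lambda>x. f x * det (Du x))" by (rule integrable_continuous_mult[OF Q cf])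
  have Qs: "Q \<in> sets lebesgue" using Q by (simp add: lmeasurable_compact fmeasurableD)
  have mu: "u \<in> borel_measurable (lebesgue_on Q)" by (rule continuous_imp_measurable_on_sets_lebesgue[OF cu Qs])
  have cc: "continuous_on Q (\<lambda>x. a (t - u x $ i))" if "bump r a" for a t i
    by (rule continuous_on_compose2[OF bump_continuous[OF that, of UNIV]]) (auto intro!: continuous_intros cu)
  have c\<psi>: "continuous_on Q \<psi>" unfolding \<psi>_def by (intro continuous_on_mult cc ab)
  have iw: "integrable (lebesgue_on Q) (\<lambda>x. \<psi> x * (f1 x * Du x$i$2 - f2 x * Du x$i$1))" for i
    by (intro integrable_continuous_mult[OF Q c\<psi>] Bochner_Integration.integrable_diff
        integrable_mult_square_integrable mf mDu sqDu)
  note ab' = bump_deriv[OF ab(1)] bump_deriv[OF ab(2)]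
  note pairing = sobolev_pairing_identity[OF sf su su[of 1] su[of 2] ab Q C \<delta> sep]
  have "(LINT x|lebesgue_on Q. \<psi> x * (f1 x * Du x$2$2 - f2 x * Du x$2$1)
      - f x * det (Du x) * (deriv \<alpha> (w$1 - u x$1) * \<beta> (w$2 - u x$2))) = 0"
    using pairing[of 2] by (simp add: \<psi>_def det_2 algebra_simps)
  then show "smear (lebesgue_on Q) (\<lambda>x. f x * det (Du x)) u (deriv \<alpha>) \<beta> w
      = (LINT x|lebesgue_on Q. \<psi> x * (f1 x * Du x$2$2 - f2 x * Du x$2$1))"
    using iw[of 2] integrable_smear[OF iJ mu ab'(1) ab(2)] by (simp add: smear_def)
  have "(LINT x|lebesgue_on Q. \<psi> x * (f1 x * Du x$1$2 - f2 x * Du x$1$1)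
      + f x * det (Du x) * (\<alpha> (w$1 - u x$1) * deriv \<beta> (w$2 - u x$2))) = 0"
    using pairing[of 1] by (simp add: \<psi>_def det_2 algebra_simps)
  then show "smear (lebesgue_on Q) (\<lambda>x. f x * det (Du x)) u \<alpha> (deriv \<beta>) w
      = - (LINT x|lebesgue_on Q. \<psi> x * (f1 x * Du x$1$2 - f2 x * Du x$1$1))"
    using iw[of 1] integrable_smear[OF iJ mu ab(1) ab'(2)] by (simp add: smear_def)
qed

text \<open>The heart of the argument: \<open>\<phi>\<close> is the uniform limit of the quotients \<open>\<Phi>\<^sub>n / T\<^sub>n\<close>, called \<open>F n\<close> below,
  of the smoothed images under \<open>u\<close> of \<open>v J dx\<close> and \<open>J dx\<close>.\<close>

lemma quotient_map_holomorphic: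
  fixes u v \<phi> :: "real^2 \<Rightarrow> real^2" and Du Dv :: "real^2 \<Rightarrow> real^2^2" and z :: "real^2" and R \<rho> :: real
  defines "Q \<equiv> cball z R"
  assumes R: "R > 0"
    and su: "\<And>i. sobolev_approximable Q (\<lambda>x. u x $ i) (\<lambda>x. Du x $ i $ 1) (\<lambda>x. Du x $ i $ 2)"
    and sv: "\<And>i. sobolev_approximable Q (\<lambda>x. v x $ i) (\<lambda>x. Dv x $ i $ 1) (\<lambda>x. Dv x $ i $ 2)"
    and cu: "continuous_on Q u" and cv: "continuous_on Q v"
    and J: "AE x in lebesgue_on Q. det (Du x) > 0"
    and wedge: "AE x in lebesgue_on Q.
       Dv x$1$1 * Du x$2$2 - Dv x$1$2 * Du x$2$1 + (Dv x$2$1 * Du x$1$2 - Dv x$2$2 * Du x$1$1) = 0 \<and>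
       Dv x$1$1 * Du x$1$2 - Dv x$1$2 * Du x$1$1 - (Dv x$2$1 * Du x$2$2 - Dv x$2$2 * Du x$2$1) = 0"
    and \<rho>: "\<rho> > 0" and far: "\<And>x. x \<in> Q \<Longrightarrow> R / 2 < dist z x \<Longrightarrow> 4 * \<rho> \<le> dist (u z) (u x)"
    and c\<phi>: "continuous_on (cball (u z) (2 * \<rho>)) \<phi>"
    and v\<phi>: "\<And>x. x \<in> Q \<Longrightarrow> u x \<in> cball (u z) (2 * \<rho>) \<Longrightarrow> v x = \<phi> (u x)"
  shows "(\<lambda>\<zeta>. to_complex (\<phi> (of_complex \<zeta>))) holomorphic_on ball (to_complex (u z)) (\<rho> / 2)"
proof -
  let ?M = "lebesgue_on Q"
  have Q: "compact Q" "Q \<in> sets lebesgue" unfolding Q_def by auto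
  define C where "C = cball z (R / 2)"
  have C: "closed C" "C \<subseteq> interior Q" using R by (auto simp: C_def Q_def interior_cball)
  have mu: "u \<in> borel_measurable ?M" by (rule continuous_imp_measurable_on_sets_lebesgue[OF cu Q(2)])
  define W where "W = ball (u z) \<rho>"
  define \<delta> where "\<delta> n = \<rho> / 2 * inverse (real (Suc n))" for n
  have \<delta>: "\<delta> n > 0" "\<delta> n \<le> \<rho> / 2" for n
    using \<rho> mult_left_mono[of "inverse (real (Suc n))" 1 "\<rho> / 2"] by (auto simp: \<delta>_def inverse_le_1_iff simp del: of_nat_Suc)
  have \<delta>lim: "\<delta> \<longlonglongrightarrow> 0"
    using tendsto_mult_right_zero[OF LIMSEQ_inverse_real_of_nat, of "\<rho> / 2"] by (simp add: \<delta>_def[abs_def])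
  \<comment> \<open>For \<open>w\<close> within \<open>\<rho>\<close> of \<open>u z\<close> the kernel at \<open>w - u x\<close> vanishes, with a margin \<open>\<rho> / 2\<close>, unless
    \<open>x\<close> lies in the smaller disc \<open>C\<close>.\<close>
  have sep: "\<delta> n + \<rho> / 2 \<le> \<bar>w$1 - u x$1\<bar> \<or> \<delta> n + \<rho> / 2 \<le> \<bar>w$2 - u x$2\<bar>"
    if "w \<in> W" "x \<in> Q" "x \<notin> C" for w x n
  proof -
    have "4 * \<rho> \<le> dist (u z) (u x)" using that by (intro far) (auto simp: C_def)
    also have "\<dots> \<le> dist (u z) w + dist w (u x)" by (rule dist_triangle)
    finally have "3 * \<rho> \<le> norm (w - u x)" using that by (simp add: W_def dist_norm)
    then show ?thesis using norm_vec2_le[of "w - u x"] \<delta>(2)[of n] \<rho> by auto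
  qed
  define \<psi> where "\<psi> n w x = std_bump (\<delta> n) (w$1 - u x$1) * std_bump (\<delta> n) (w$2 - u x$2)"
    for n and w x :: "real^2"
  define S where "S f n = smear ?M (\<lambda>x. f x * det (Du x)) u (std_bump (\<delta> n)) (std_bump (\<delta> n))" for f n
  define S1 where "S1 f n = smear ?M (\<lambda>x. f x * det (Du x)) u (deriv (std_bump (\<delta> n))) (std_bump (\<delta> n))" for f n
  define S2 where "S2 f n = smear ?M (\<lambda>x. f x * det (Du x)) u (std_bump (\<delta> n)) (deriv (std_bump (\<delta> n)))" for f n
  have \<rho>2: "\<rho> / 2 > 0" using \<rho> by simp
  have jac: "S1 f n w = (LINT x|?M. \<psi> n w x * (f1 x * Du x$2$2 - f2 x * Du x$2$1))"
      "S2 f n w = - (LINT x|?M. \<psi> n w x * (f1 x * Du x$1$2 - f2 x * Du x$1$1))"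
      "integrable ?M (\<lambda>x. f x * det (Du x))"
    if "sobolev_approximable Q f f1 f2" "continuous_on Q f" "w \<in> W" for f f1 f2 n w
    using partial_smear_jacobian[OF su that(1) cu that(2) bump_std_bump bump_std_bump Q(1) C \<rho>2 sep[OF that(3), where n = n]]
    unfolding S1_def S2_def \<psi>_def by auto
  have DS: "(S f n has_derivative (\<lambda>h. S1 f n w * h$1 + S2 f n w * h$2)) (at w)"
    if "integrable ?M (\<lambda>x. f x * det (Du x))" for f n w
    unfolding S_def S1_def S2_def by (rule has_derivative_smear[OF that mu bump_std_bump bump_std_bump])
  have zW: "u z \<in> W" using \<rho> by (simp add: W_def)
  define T where "T = S (\<lambda>_. 1)"
  note s1 = sobolev_approximable_const[of Q 1] and c1 = continuous_on_const[of Q "1::real"]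
  have iJ: "integrable ?M (\<lambda>x. 1 * det (Du x))" by (rule jac(3)[OF s1 c1 zW])
  \<comment> \<open>The gradient of \<open>T\<close> is an integral against the differential of the constant one.\<close>
  have DT: "(T n has_derivative (\<lambda>h. 0)) (at w)" if "w \<in> W" for n w
    using DS[OF iJ, of n w] jac(1,2)[OF s1 c1 that, of n] by (simp add: T_def)
  have Tconst: "T n w = T n (u z)" if "w \<in> W" for n w
  proof -
    have "\<exists>c. \<forall>w\<in>W. T n w = c"
      by (rule has_derivative_zero_constant) (use DT in \<open>auto simp: W_def intro: has_derivative_at_withinI\<close>)
    then show ?thesis using that zW by auto
  qed
  have \<psi>nn: "\<psi> n w x \<ge> 0" for n w x by (simp add: \<psi>_def std_bump_nonneg)
  have i\<psi>: "integrable ?M (\<lambda>x. f x * det (Du x) * \<psi> n w x)" if "integrable ?M (\<lambda>x. f x * det (Du x))" for f n w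
    using integrable_smear[OF that mu bump_std_bump bump_std_bump] by (simp add: \<psi>_def)
  have Tpos: "T n (u z) > 0" for n
  proof -
    have eq: "T n (u z) = (LINT x|?M. det (Du x) * \<psi> n (u z) x)" by (simp add: T_def S_def smear_def \<psi>_def)
    have i: "integrable ?M (\<lambda>x. det (Du x) * \<psi> n (u z) x)" using i\<psi>[OF iJ] by simp
    have nn: "AE x in ?M. 0 \<le> det (Du x) * \<psi> n (u z) x" using J by eventually_elim (simp add: \<psi>nn)
    have "T n (u z) \<noteq> 0"
    proof
      assume "T n (u z) = 0"
      then have "AE x in ?M. det (Du x) * \<psi> n (u z) x = 0"
        using integral_nonneg_eq_0_iff_AE[OF i nn] eq by simp
      with J have "AE x in ?M. \<psi> n (u z) x = 0" by eventually_elim auto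
      then have ae: "AE x in lebesgue. x \<in> Q \<longrightarrow> \<psi> n (u z) x = 0" using Q(2) by (simp add: AE_restrict_space_iff)
      have "isCont u z" using cu R by (intro continuous_on_interior) (auto simp: Q_def interior_cball)
      then obtain d where d: "d > 0" "\<And>x. dist x z < d \<Longrightarrow> dist (u x) (u z) < \<delta> n"
        using \<delta>(1)[of n] unfolding continuous_at_eps_delta by blast
      have "AE x in lebesgue. x \<notin> ball z (min d R)"
        using ae
      proof eventually_elim
        case (elim x)
        show ?case
        proof
          assume x: "x \<in> ball z (min d R)"
          then have "norm (u z - u x) < \<delta> n" using d(2)[of x] by (simp add: dist_commute dist_norm norm_minus_commute)
          then have "\<bar>u z$1 - u x$1\<bar> < \<delta> n" "\<bar>u z$2 - u x$2\<bar> < \<delta> n"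
            using component_le_norm_cart[of "u z - u x" 1] component_le_norm_cart[of "u z - u x" 2] by auto
          then have "\<psi> n (u z) x > 0" unfolding \<psi>_def by (intro mult_pos_pos std_bump_pos)
          then show False using elim x by (simp add: Q_def)
        qed
      qed
      then have "negligible (ball z (min d R))" by (simp add: negligible_iff_null_sets AE_iff_null_sets)
      moreover have "ball z (min d R) \<noteq> {}" using d(1) R by simp
      ultimately show False using open_not_negligible[of "ball z (min d R)"] by simp
    qed
    moreover have "T n (u z) \<ge> 0" unfolding eq by (rule integral_nonneg_AE[OF nn])
    ultimately show ?thesis by simp
  qed
  have cvi: "continuous_on Q (\<lambda>x. v x $ i)" for i by (intro continuous_intros cv)
  have iv: "integrable ?M (\<lambda>x. v x $ i * det (Du x))" for i by (rule jac(3)[OF sv cvi zW])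
  define F where "F n i w = S (\<lambda>x. v x $ i) n w / T n (u z)" for n i w
  define F1 where "F1 n i w = S1 (\<lambda>x. v x $ i) n w / T n (u z)" for n i w
  define F2 where "F2 n i w = S2 (\<lambda>x. v x $ i) n w / T n (u z)" for n i w
  have DF: "(F n i has_derivative (\<lambda>h. F1 n i w * h$1 + F2 n i w * h$2)) (at w)" for n i w
  proof -
    have "((\<lambda>w. inverse (T n (u z)) * S (\<lambda>x. v x $ i) n w) has_derivative
       (\<lambda>h. inverse (T n (u z)) * (S1 (\<lambda>x. v x $ i) n w * h$1 + S2 (\<lambda>x. v x $ i) n w * h$2))) (at w)"
      by (rule has_derivative_mult_right[OF DS[OF iv]])
    then show ?thesis by (simp add: F_def[abs_def] F1_def F2_def field_simps add_divide_distrib)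
  qed
  have meas: "(\<lambda>x. \<psi> n w x * (Dv x$i$1 * Du x$j$2 - Dv x$i$2 * Du x$j$1)) \<in> borel_measurable ?M" for n w i j
  proof -
    have m: "(\<lambda>x. Du x $ i $ j) \<in> borel_measurable ?M" "(\<lambda>x. Dv x $ i $ j) \<in> borel_measurable ?M" for i j
    proof -
      have "j = 1 \<or> j = 2" by (rule exhaust_2)
      then show "(\<lambda>x. Du x $ i $ j) \<in> borel_measurable ?M" "(\<lambda>x. Dv x $ i $ j) \<in> borel_measurable ?M"
        using su[of i] sv[of i] unfolding sobolev_approximable_def by auto
    qed
    have c: "continuous_on Q (\<lambda>x. w $ k - u x $ k)" for k by (intro continuous_intros cu)
    have "continuous_on Q (\<psi> n w)" unfolding \<psi>_def
      by (intro continuous_on_mult continuous_on_compose2[OF bump_continuous[OF bump_std_bump, of UNIV] c]) auto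
    then have "\<psi> n w \<in> borel_measurable ?M" by (rule continuous_imp_measurable_on_sets_lebesgue) (rule Q)
    then show ?thesis by (intro borel_measurable_times borel_measurable_diff m)
  qed
  \<comment> \<open>The Cauchy--Riemann equations are the imaginary and real parts of \<open>dv \<and> du = 0\<close>, integrated
    against the kernel.\<close>
  have CR: "F1 n 1 w = F2 n 2 w" "F2 n 1 w = - F1 n 2 w" if w: "w \<in> W" for n w
  proof -
    have "S1 (\<lambda>x. v x $ 1) n w = S2 (\<lambda>x. v x $ 2) n w"
      unfolding jac(1)[OF sv cvi w] jac(2)[OF sv cvi w] integral_minus[symmetric]
    proof (rule integral_cong_AE)
      show "AE x in ?M. \<psi> n w x * (Dv x$1$1 * Du x$2$2 - Dv x$1$2 * Du x$2$1) =
        - (\<psi> n w x * (Dv x$2$1 * Du x$1$2 - Dv x$2$2 * Du x$1$1))"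
        using wedge
      proof eventually_elim
        case (elim x)
        then have "Dv x$1$1 * Du x$2$2 - Dv x$1$2 * Du x$2$1 = - (Dv x$2$1 * Du x$1$2 - Dv x$2$2 * Du x$1$1)" by linarith
        then show ?case by (simp only: mult_minus_right)
      qed
    qed (intro borel_measurable_uminus meas)+
    then show "F1 n 1 w = F2 n 2 w" by (simp add: F1_def F2_def)
    have "S2 (\<lambda>x. v x $ 1) n w = - S1 (\<lambda>x. v x $ 2) n w"
      unfolding jac(1)[OF sv cvi w] jac(2)[OF sv cvi w] neg_equal_iff_equal
    proof (rule integral_cong_AE)
      show "AE x in ?M. \<psi> n w x * (Dv x$1$1 * Du x$1$2 - Dv x$1$2 * Du x$1$1) =
        \<psi> n w x * (Dv x$2$1 * Du x$2$2 - Dv x$2$2 * Du x$2$1)"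
        using wedge
      proof eventually_elim
        case (elim x)
        then have "Dv x$1$1 * Du x$1$2 - Dv x$1$2 * Du x$1$1 = Dv x$2$1 * Du x$2$2 - Dv x$2$2 * Du x$2$1" by linarith
        then show ?case by (simp only:)
      qed
    qed (intro meas)+
    then show "F2 n 1 w = - F1 n 2 w" by (simp add: F1_def F2_def)
  qed
  let ?F = "\<lambda>n \<zeta>. Complex (F n 1 (of_complex \<zeta>)) (F n 2 (of_complex \<zeta>))"
  let ?\<zeta> = "to_complex (u z)"
  have inW: "of_complex \<zeta> \<in> W" if "\<zeta> \<in> ball ?\<zeta> \<rho>" for \<zeta>
    using that dist_of_complex[of ?\<zeta> \<zeta>] by (simp add: W_def)
  have hol: "?F n holomorphic_on ball ?\<zeta> \<rho>" for n
    unfolding holomorphic_on_open[OF open_ball]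
    using Cauchy_Riemann_field_derivative[OF DF DF CR[OF inW]] by blast
  have close: "\<forall>\<^sub>F n in sequentially. \<forall>w\<in>W. \<bar>F n i w - \<phi> w $ i\<bar> \<le> e" if e: "e > 0" for e i
  proof -
    have "uniformly_continuous_on (cball (u z) (2 * \<rho>)) \<phi>" by (rule compact_uniformly_continuous[OF c\<phi>]) simp
    then obtain d where d: "d > 0" "\<And>p q. p \<in> cball (u z) (2 * \<rho>) \<Longrightarrow> q \<in> cball (u z) (2 * \<rho>) \<Longrightarrow> dist q p < d \<Longrightarrow> dist (\<phi> q) (\<phi> p) < e"
      using e unfolding uniformly_continuous_on_def by metis
    have "\<forall>\<^sub>F n in sequentially. \<delta> n < d / 2" using \<delta>lim by (rule order_tendstoD(2)) (use d in simp)
    then show ?thesis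
    proof eventually_elim
      case (elim n)
      show ?case
      proof
        fix w assume w: "w \<in> W"
        have "\<bar>(LINT x|?M. v x $ i * (det (Du x) * \<psi> n w x)) - \<phi> w $ i * (LINT x|?M. det (Du x) * \<psi> n w x)\<bar>
            \<le> e * (LINT x|?M. det (Du x) * \<psi> n w x)"
        proof (rule weighted_average_close)
          show "AE x in ?M. 0 \<le> det (Du x) * \<psi> n w x" using J by eventually_elim (simp add: \<psi>nn)
          show "integrable ?M (\<lambda>x. det (Du x) * \<psi> n w x)" using i\<psi>[OF iJ] by simp
          show "integrable ?M (\<lambda>x. v x $ i * (det (Du x) * \<psi> n w x))" using i\<psi>[OF iv] by (simp add: mult.assoc)
          fix x assume "x \<in> space ?M" and nz: "det (Du x) * \<psi> n w x \<noteq> 0"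
          then have x: "x \<in> Q" by (simp add: space_restrict_space)
          have "\<bar>w$1 - u x$1\<bar> < \<delta> n" "\<bar>w$2 - u x$2\<bar> < \<delta> n"
            using nz bump_eq_0[OF bump_std_bump, of "\<delta> n" "w$1 - u x$1"] bump_eq_0[OF bump_std_bump, of "\<delta> n" "w$2 - u x$2"]
            by (auto simp: \<psi>_def not_le[symmetric])
          then have wd: "dist w (u x) < 2 * \<delta> n" using norm_vec2_le[of "w - u x"] by (simp add: dist_norm)
          have "dist (u z) (u x) \<le> dist (u z) w + dist w (u x)" by (rule dist_triangle)
          then have ux: "u x \<in> cball (u z) (2 * \<rho>)" using wd w \<delta>(2)[of n] by (simp add: W_def)
          have "w \<in> cball (u z) (2 * \<rho>)" using w \<rho> by (simp add: W_def)
          from d(2)[OF this ux] have "norm (\<phi> (u x) - \<phi> w) < e" using wd elim by (simp add: dist_commute dist_norm norm_minus_commute)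
          then show "\<bar>v x $ i - \<phi> w $ i\<bar> \<le> e"
            using component_le_norm_cart[of "\<phi> (u x) - \<phi> w" i] v\<phi>[OF x ux] by simp
        qed
        moreover have "(LINT x|?M. det (Du x) * \<psi> n w x) = T n (u z)"
          unfolding Tconst[OF w, symmetric] by (simp add: T_def S_def smear_def \<psi>_def)
        moreover have "(LINT x|?M. v x $ i * (det (Du x) * \<psi> n w x)) = F n i w * T n (u z)"
          using Tpos[of n] by (simp add: F_def S_def smear_def \<psi>_def mult.assoc)
        ultimately have "\<bar>F n i w * T n (u z) - \<phi> w $ i * T n (u z)\<bar> \<le> e * T n (u z)" by simp
        then have "\<bar>F n i w - \<phi> w $ i\<bar> * T n (u z) \<le> e * T n (u z)"
          using Tpos[of n] by (simp add: abs_mult left_diff_distrib[symmetric])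
        then show "\<bar>F n i w - \<phi> w $ i\<bar> \<le> e" using Tpos[of n] by simp
      qed
    qed
  qed
  have ul: "uniform_limit (cball ?\<zeta> (\<rho> / 2)) ?F (\<lambda>\<zeta>. to_complex (\<phi> (of_complex \<zeta>))) sequentially"
  proof (rule uniform_limitI)
    fix e :: real assume "e > 0"
    then have e: "e / 3 > 0" by simp
    show "\<forall>\<^sub>F n in sequentially. \<forall>\<zeta>\<in>cball ?\<zeta> (\<rho> / 2). dist (?F n \<zeta>) (to_complex (\<phi> (of_complex \<zeta>))) < e"
      using close[OF e, of 1] close[OF e, of 2]
    proof eventually_elim
      case (elim n)
      show ?case
      proof
        fix \<zeta> assume "\<zeta> \<in> cball ?\<zeta> (\<rho> / 2)"
        then have w: "of_complex \<zeta> \<in> W" using \<rho> by (intro inW) auto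
        have "dist (?F n \<zeta>) (to_complex (\<phi> (of_complex \<zeta>)))
           \<le> \<bar>F n 1 (of_complex \<zeta>) - \<phi> (of_complex \<zeta>) $ 1\<bar> + \<bar>F n 2 (of_complex \<zeta>) - \<phi> (of_complex \<zeta>) $ 2\<bar>"
          using cmod_le[of "?F n \<zeta> - to_complex (\<phi> (of_complex \<zeta>))"] by (simp add: dist_norm to_complex_def)
        also have "\<dots> \<le> e / 3 + e / 3" using elim w by (intro add_mono) auto
        also have "\<dots> < e" using e by simp
        finally show "dist (?F n \<zeta>) (to_complex (\<phi> (of_complex \<zeta>))) < e" .
      qed
    qed
  qed
  have ev: "\<forall>\<^sub>F n in sequentially. continuous_on (cball ?\<zeta> (\<rho> / 2)) (?F n) \<and> ?F n holomorphic_on ball ?\<zeta> (\<rho> / 2)"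
  proof (rule always_eventually, rule allI, rule conjI)
    fix n
    have "cball ?\<zeta> (\<rho> / 2) \<subseteq> ball ?\<zeta> \<rho>" "ball ?\<zeta> (\<rho> / 2) \<subseteq> ball ?\<zeta> \<rho>" using \<rho> by auto
    then show "continuous_on (cball ?\<zeta> (\<rho> / 2)) (?F n)" "?F n holomorphic_on ball ?\<zeta> (\<rho> / 2)"
      using hol[of n] by (blast intro: holomorphic_on_imp_continuous_on continuous_on_subset holomorphic_on_subset)+
  qed
  show ?thesis by (rule holomorphic_uniform_limit[OF ev ul sequentially_bot])
qed

theorem corollary2:
  fixes \<Omega> :: "(real^2) set"
    and u v :: "real^2 \<Rightarrow> real^2"
    and Du Dv :: "real^2 \<Rightarrow> real^2^2"
    and K :: "real^2 \<Rightarrow> real"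
  assumes "open \<Omega>" and "connected \<Omega>"
    and "u \<in> W11 \<Omega>" and "v \<in> W11 \<Omega>"
    and "weak_gradient \<Omega> u Du" and "weak_gradient \<Omega> v Dv"
    and "continuous_on \<Omega> u" and "continuous_on \<Omega> v"
    and "AE z\<in>\<Omega> in lebesgue. det (Du z) > 0"
    and "AE z\<in>\<Omega> in lebesgue. det (Dv z) > 0"
    and "set_integrable lebesgue \<Omega>
           (\<lambda>z. (norm (conformal_part (Du z)))\<^sup>2 + (norm (conformal_part (Dv z)))\<^sup>2)"
    and "set_integrable lebesgue \<Omega> K"
    and "AE z\<in>\<Omega> in lebesgue. (op_norm (Du z))\<^sup>2 \<le> K z * det (Du z)"
    and "AE z\<in>\<Omega> in lebesgue. \<exists>l>0. stretch (Du z) = l *\<^sub>R stretch (Dv z)"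
  shows "\<forall>z \<in> \<Omega> - branch_set \<Omega> u.
           \<exists>r>0. \<exists>\<phi> :: real^2 \<Rightarrow> real^2.
             ball z r \<subseteq> \<Omega> \<and> conformal_map_on \<phi> (u ` ball z r) \<and>
             (\<forall>x \<in> ball z r. v x = \<phi> (u x))"
proof
  fix z assume "z \<in> \<Omega> - branch_set \<Omega> u"
  then have "local_homeomorphism_at \<Omega> u z" by (simp add: branch_set_def)
  then obtain U g where U: "open U" "z \<in> U" "U \<subseteq> \<Omega>" and uU: "open (u ` U)" and hom: "homeomorphism U (u ` U) u g"
    unfolding local_homeomorphism_at_def by blast
  have gu: "g (u x) = x" if "x \<in> U" for x using hom that by (rule homeomorphism_apply1)
  obtain R' where R': "R' > 0" "cball z R' \<subseteq> U" using open_contains_cball[of U] U by blast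
  define R where "R = R' / 2"
  define Q where "Q = cball z R"
  have R: "0 < R" "R < R'" using R' by (auto simp: R_def)
  have QU: "Q \<subseteq> U" using R R' by (auto simp: Q_def)
  have sub: "cball z R' \<subseteq> \<Omega>" using R' U by blast
  have Qs: "Q \<inter> space lebesgue \<in> sets lebesgue" by (simp add: Q_def)
  have su: "sobolev_approximable Q (\<lambda>x. u x $ i) (\<lambda>x. Du x $ i $ 1) (\<lambda>x. Du x $ i $ 2)" for i
    unfolding Q_def by (rule weak_gradient_component_approximable[OF assms(5,7) R(2) sub assms(9,11)]) simp
  have sv: "sobolev_approximable Q (\<lambda>x. v x $ i) (\<lambda>x. Dv x $ i $ 1) (\<lambda>x. Dv x $ i $ 2)" for i
    unfolding Q_def by (rule weak_gradient_component_approximable[OF assms(6,8) R(2) sub assms(10,11)]) simp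
  have cu: "continuous_on Q u" and cv: "continuous_on Q v"
    using assms(7,8) QU U(3) by (meson continuous_on_subset)+
  have onQ: "AE x in lebesgue_on Q. P x" if "AE z\<in>\<Omega> in lebesgue. P z" for P
  proof -
    have "AE x in lebesgue. x \<in> Q \<longrightarrow> P x" using that by eventually_elim (use QU U(3) in auto)
    then show ?thesis by (simp add: AE_restrict_space_iff[OF Qs])
  qed
  have J: "AE x in lebesgue_on Q. det (Du x) > 0" by (rule onQ[OF assms(9)])
  have wedge: "AE x in lebesgue_on Q.
       Dv x$1$1 * Du x$2$2 - Dv x$1$2 * Du x$2$1 + (Dv x$2$1 * Du x$1$2 - Dv x$2$2 * Du x$1$1) = 0 \<and>
       Dv x$1$1 * Du x$1$2 - Dv x$1$2 * Du x$1$1 - (Dv x$2$1 * Du x$2$2 - Dv x$2$2 * Du x$2$1) = 0"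
    using J onQ[OF assms(10)] onQ[OF assms(14)]
  proof eventually_elim
    case (elim x)
    then obtain l where "l > 0" "stretch (Du x) = l *\<^sub>R stretch (Dv x)" by blast
    then show ?case using proportional_stretch_wedge_eq_0[OF elim(1,2)] by blast
  qed
  \<comment> \<open>By injectivity \<open>u\<close> stays away from \<open>u z\<close> off the half-size disc, so kernels centred near \<open>u z\<close>
    pull back to functions supported away from the boundary of \<open>Q\<close>.\<close>
  obtain \<eta> where \<eta>: "\<eta> > 0" "\<And>x. x \<in> Q \<Longrightarrow> R / 2 < dist z x \<Longrightarrow> \<eta> \<le> dist (u z) (u x)"
  proof -
    let ?A = "u ` (Q - ball z (R / 2))"
    have "compact ?A"
    proof (rule compact_continuous_image)
      show "continuous_on (Q - ball z (R / 2)) u" using cu by (rule continuous_on_subset) auto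
      show "compact (Q - ball z (R / 2))" by (intro compact_diff) (auto simp: Q_def)
    qed
    moreover have "u z \<notin> ?A"
    proof
      assume "u z \<in> ?A"
      then obtain x where "x \<in> Q" "x \<notin> ball z (R / 2)" "u z = u x" by blast
      then have "x = z" using gu[of x] gu[of z] QU U(2) by auto
      then show False using \<open>x \<notin> ball z (R / 2)\<close> R by simp
    qed
    ultimately obtain d where "d > 0" "\<forall>y\<in>?A. d \<le> dist (u z) y"
      using separate_point_closed[of ?A "u z"] compact_imp_closed by blast
    then show ?thesis by (intro that[of d]) auto
  qed
  obtain \<sigma> where \<sigma>: "\<sigma> > 0" "cball (u z) \<sigma> \<subseteq> u ` U" using open_contains_cball[of "u ` U"] uU U(2) by blast
  \<comment> \<open>Small enough for the disc of radius \<open>2 \<rho>\<close> to lie in the image, where \<open>g\<close> is continuous, and for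
    points off the half-size disc to be mapped at least \<open>4 \<rho>\<close> away from \<open>u z\<close>.\<close>
  define \<rho> where "\<rho> = min (\<eta> / 4) (\<sigma> / 2)"
  have \<rho>: "\<rho> > 0" using \<eta>(1) \<sigma>(1) by (simp add: \<rho>_def)
  have far: "4 * \<rho> \<le> dist (u z) (u x)" if "x \<in> Q" "R / 2 < dist z x" for x
    using \<eta>(2)[OF that] by (simp add: \<rho>_def min_def split: if_splits)
  have \<rho>U: "cball (u z) (2 * \<rho>) \<subseteq> u ` U" using \<sigma>(2) by (auto simp: \<rho>_def)
  define \<phi> where "\<phi> = (\<lambda>p. v (g p))"
  have v\<phi>: "v x = \<phi> (u x)" if "x \<in> U" for x using gu[OF that] by (simp add: \<phi>_def)
  have c\<phi>: "continuous_on (cball (u z) (2 * \<rho>)) \<phi>"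
    unfolding \<phi>_def
  proof (rule continuous_on_compose2[of \<Omega> v])
    show "continuous_on \<Omega> v" by (rule assms(8))
    show "continuous_on (cball (u z) (2 * \<rho>)) g" using hom \<rho>U by (meson homeomorphism_def continuous_on_subset)
    show "g ` cball (u z) (2 * \<rho>) \<subseteq> \<Omega>" using \<rho>U gu U(3) by force
  qed
  have hol: "(\<lambda>\<zeta>. to_complex (\<phi> (of_complex \<zeta>))) holomorphic_on ball (to_complex (u z)) (\<rho> / 2)"
    using QU v\<phi> by (intro quotient_map_holomorphic[OF R(1) su[unfolded Q_def] sv[unfolded Q_def] cu[unfolded Q_def] cv[unfolded Q_def]
          J[unfolded Q_def] wedge[unfolded Q_def] \<rho> far[unfolded Q_def] c\<phi>]) (auto simp: Q_def)
  have conf: "\<exists>A. conformal_matrix A \<and> (\<phi> has_derivative (\<lambda>h. A *v h)) (at p)" if p: "p \<in> ball (u z) (\<rho> / 2)" for p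
  proof -
    have "to_complex p \<in> ball (to_complex (u z)) (\<rho> / 2)"
      using p dist_of_complex[of "to_complex (u z)" "to_complex p"] by simp
    then obtain D where "((\<lambda>\<zeta>. to_complex (\<phi> (of_complex \<zeta>))) has_field_derivative D) (at (to_complex p))"
      using hol unfolding holomorphic_on_open[OF open_ball] by blast
    from field_derivative_conformal[OF this] show ?thesis by simp
  qed
  have "open (U \<inter> u -` ball (u z) (\<rho> / 2))"
    using assms(7) U by (intro continuous_open_preimage) (auto intro: continuous_on_subset)
  moreover have "z \<in> U \<inter> u -` ball (u z) (\<rho> / 2)" using U(2) \<rho> by simp
  ultimately obtain r where r: "r > 0" "ball z r \<subseteq> U \<inter> u -` ball (u z) (\<rho> / 2)" by (meson openE)
  have "conformal_map_on \<phi> (u ` ball z r)" unfolding conformal_map_on_def using conf r(2) by blast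
  moreover have "\<forall>x\<in>ball z r. v x = \<phi> (u x)" using v\<phi> r(2) by blast
  moreover have "ball z r \<subseteq> \<Omega>" using r(2) U(3) by blast
  ultimately show "\<exists>r>0. \<exists>\<phi> :: real^2 \<Rightarrow> real^2.
             ball z r \<subseteq> \<Omega> \<and> conformal_map_on \<phi> (u ` ball z r) \<and> (\<forall>x \<in> ball z r. v x = \<phi> (u x))"
    using r(1) by blast
qed

end
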